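(* Let $\Gamma=(V,E)$ be a finite connected planar quiver, $k$ a field of characteristic $0$, and $I\subseteq R^2$ a two-sided ideal of $k\Gamma$ such that $k\Gamma/I$ is acyclic. Then the classes in $H^1(k\Gamma,k\Gamma/I)$ of the elements of $(\mathfrak{B}_2\setminus\mathfrak{B}_E)\cup\mathfrak{B}_{\mathbb{P}}$ form a $k$-basis of $H^1(k\Gamma,k\Gamma/I)$.
   Context: For a path $p$, $t(p),h(p)$ are its start and end vertex; paths multiply by left-to-right concatenation (product $0$ if they do not concatenate). $R$ is the ideal generated by $E$, $\overline{x}=x+I$. A differential operator from $k\Gamma$ to $k\Gamma/I$ is a $k$-linear map with $D(xy)=D(x)\overline{y}+\overline{x}D(y)$; $H^1(k\Gamma,k\Gamma/I)$ is the space of these modulo the inner ones $x\mapsto m\overline{x}-\overline{x}m$ ($m\in k\Gamma/I$). $\mathscr{Q}$ is a fixed $k$-basis of $k\Gamma/I$ consisting of residue classes of paths and containing the classes of all vertices and arrows; for $\overline{s}\in\mathscr{Q}$, $t(\overline{s}),h(\overline{s})$ are the start/end vertex of any representing path (well defined). $k\Gamma/I$ is acyclic if every $\overline{q}\in\mathscr{Q}$ with $t(\overline{q})=h(\overline{q})$ is the class of a vertex. For $r\in E$ and $\overline{s}\in\mathscr{Q}$ with $t(r)=t(\overline{s})$, $h(r)=h(\overline{s})$, $D_{r,\overline{s}}$ is the unique differential operator $k\Gamma\to k\Gamma/I$ with $D_{r,\overline{s}}(r)=\overline{s}$ and vanishing on all other arrows and vertices. $\mathfrak{B}_2$ is the set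 of all such $D_{r,\overline{s}}$, and $\mathfrak{B}_E=\{D_{p,\overline{p}}\mid p\in E\}$. A planar quiver is a quiver with a fixed embedding in $\mathbb{R}^2$; its faces are the connected components of $\mathbb{R}^2\setminus\Gamma$, exactly one of which, $f_0$, is unbounded. For a face $f$ whose boundary consists of the ordered list of arrows $p_1,\dots,p_s$ (arrows bordering $f$ on both sides appearing twice), $D_{\mathbbm{p}_f}=\sum_i\epsilon_iD_{p_i,\overline{p_i}}$ with $\epsilon_i=+1$ if $p_i$ runs clockwise viewed from the interior of $f$, $-1$ otherwise. $\mathfrak{B}_{\mathbb{P}}=\{D_{\mathbbm{p}_f}\mid f\text{ a face},\ f\neq f_0\}$. *)

theory Defs
  imports "HOL-Complex_Analysis.Complex_Analysis"
begin

text \<open>A quiver is given by a vertex set V, an arrow set E and maps src (start vertex t)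
  and tgt (end vertex h).  A path is a pair (v, as): start vertex v and a list of
  arrows; (v, []) is the trivial path at v.  Paths compose left to right.\<close>

type_synonym ('v,'a) qpath = "'v \<times> 'a list"

definition is_path :: "'v set \<Rightarrow> 'a set \<Rightarrow> ('a \<Rightarrow> 'v) \<Rightarrow> ('a \<Rightarrow> 'v) \<Rightarrow> ('v,'a) qpath \<Rightarrow> bool" where
  "is_path V E src tgt p \<longleftrightarrow>
     fst p \<in> V \<and> set (snd p) \<subseteq> E \<and>
     (snd p \<noteq> [] \<longrightarrow> src (hd (snd p)) = fst p) \<and>
     (\<forall>i. Suc i < length (snd p) \<longrightarrow> tgt (snd p ! i) = src (snd p ! Suc i))"

definition path_t :: "('v,'a) qpath \<Rightarrow> 'v" where
  "path_t p = fst p"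

definition path_h :: "('a \<Rightarrow> 'v) \<Rightarrow> ('v,'a) qpath \<Rightarrow> 'v" where
  "path_h tgt p = (if snd p = [] then fst p else tgt (last (snd p)))"

definition arrow_path :: "('a \<Rightarrow> 'v) \<Rightarrow> 'a \<Rightarrow> ('v,'a) qpath" where
  "arrow_path src a = (src a, [a])"

definition PA :: "'v set \<Rightarrow> 'a set \<Rightarrow> ('a \<Rightarrow> 'v) \<Rightarrow> ('a \<Rightarrow> 'v) \<Rightarrow> (('v,'a) qpath \<Rightarrow> 'k::field) set" where
  "PA V E src tgt = {x. finite {p. x p \<noteq> 0} \<and> (\<forall>p. x p \<noteq> 0 \<longrightarrow> is_path V E src tgt p)}"

definition pelem :: "('v,'a) qpath \<Rightarrow> (('v,'a) qpath \<Rightarrow> 'k::field)" where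
  "pelem p = (\<lambda>q. if q = p then 1 else 0)"

definition padd :: "(('v,'a) qpath \<Rightarrow> 'k::field) \<Rightarrow> (('v,'a) qpath \<Rightarrow> 'k) \<Rightarrow> (('v,'a) qpath \<Rightarrow> 'k)" where
  "padd x y = (\<lambda>p. x p + y p)"

definition psub :: "(('v,'a) qpath \<Rightarrow> 'k::field) \<Rightarrow> (('v,'a) qpath \<Rightarrow> 'k) \<Rightarrow> (('v,'a) qpath \<Rightarrow> 'k)" where
  "psub x y = (\<lambda>p. x p - y p)"

definition pscale :: "'k::field \<Rightarrow> (('v,'a) qpath \<Rightarrow> 'k) \<Rightarrow> (('v,'a) qpath \<Rightarrow> 'k)" where
  "pscale c x = (\<lambda>p. c * x p)"

definition pmult :: "'v set \<Rightarrow> 'a set \<Rightarrow> ('a \<Rightarrow> 'v) \<Rightarrow> ('a \<Rightarrow> 'v) \<Rightarrow>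
    (('v,'a) qpath \<Rightarrow> 'k::field) \<Rightarrow> (('v,'a) qpath \<Rightarrow> 'k) \<Rightarrow> (('v,'a) qpath \<Rightarrow> 'k)" where
  "pmult V E src tgt x y = (\<lambda>p. if is_path V E src tgt p then
      (\<Sum>i\<in>{0..length (snd p)}. x (fst p, take i (snd p)) *
          y (path_h tgt (fst p, take i (snd p)), drop i (snd p)))
     else 0)"

definition is_ideal :: "'v set \<Rightarrow> 'a set \<Rightarrow> ('a \<Rightarrow> 'v) \<Rightarrow> ('a \<Rightarrow> 'v) \<Rightarrow> (('v,'a) qpath \<Rightarrow> 'k::field) set \<Rightarrow> bool" where
  "is_ideal V E src tgt I \<longleftrightarrow>
     I \<subseteq> PA V E src tgt \<and> (\<lambda>_. 0) \<in> I \<and>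
     (\<forall>x\<in>I. \<forall>y\<in>I. padd x y \<in> I) \<and>
     (\<forall>c. \<forall>x\<in>I. pscale c x \<in> I) \<and>
     (\<forall>x\<in>I. \<forall>y\<in>PA V E src tgt. pmult V E src tgt x y \<in> I \<and> pmult V E src tgt y x \<in> I)"

text \<open>R is the ideal generated by the arrows, so R^2 is the span of the paths of length
  at least 2; I is contained in R^2 iff every element of I vanishes on paths of length
  less than 2.\<close>

definition in_R2 :: "(('v,'a) qpath \<Rightarrow> 'k::field) set \<Rightarrow> bool" where
  "in_R2 I \<longleftrightarrow> (\<forall>x\<in>I. \<forall>p. length (snd p) < 2 \<longrightarrow> x p = 0)"

text \<open>Q is given by a set Qp of representing paths (one for each basis class).\<close>

definition lincomb_paths :: "('v,'a) qpath set \<Rightarrow> (('v,'a) qpath \<Rightarrow> 'k::field) \<Rightarrow> (('v,'a) qpath \<Rightarrow> 'k)" where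
  "lincomb_paths Q c = (\<lambda>p. \<Sum>q\<in>{q\<in>Q. c q \<noteq> 0}. c q * pelem q p)"

definition path_class_basis :: "'v set \<Rightarrow> 'a set \<Rightarrow> ('a \<Rightarrow> 'v) \<Rightarrow> ('a \<Rightarrow> 'v) \<Rightarrow>
    (('v,'a) qpath \<Rightarrow> 'k::field) set \<Rightarrow> ('v,'a) qpath set \<Rightarrow> bool" where
  "path_class_basis V E src tgt I Q \<longleftrightarrow>
     (\<forall>q\<in>Q. is_path V E src tgt q) \<and>
     (\<forall>c::('v,'a) qpath \<Rightarrow> 'k. finite {q\<in>Q. c q \<noteq> 0} \<longrightarrow> lincomb_paths Q c \<in> I \<longrightarrow> (\<forall>q\<in>Q. c q = 0)) \<and>
     (\<forall>x\<in>PA V E src tgt. \<exists>c::('v,'a) qpath \<Rightarrow> 'k. finite {q\<in>Q. c q \<noteq> 0} \<and> psub x (lincomb_paths Q c) \<in> I) \<and>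
     (\<forall>v\<in>V. \<exists>q\<in>Q. psub (pelem q) (pelem (v, [])) \<in> I) \<and>
     (\<forall>a\<in>E. \<exists>q\<in>Q. psub (pelem q) (pelem (arrow_path src a)) \<in> I)"

definition acyclic_quot :: "'v set \<Rightarrow> ('a \<Rightarrow> 'v) \<Rightarrow>
    (('v,'a) qpath \<Rightarrow> 'k::field) set \<Rightarrow> ('v,'a) qpath set \<Rightarrow> bool" where
  "acyclic_quot V tgt I Q \<longleftrightarrow>
     (\<forall>q\<in>Q. path_t q = path_h tgt q \<longrightarrow> (\<exists>v\<in>V. psub (pelem q) (pelem (v, [])) \<in> I))"

text \<open>A map k Gamma -> k Gamma / I is represented by a lift D into k Gamma; everything
  is read modulo I.\<close>

type_synonym ('v,'a,'k) op = "(('v,'a) qpath \<Rightarrow> 'k) \<Rightarrow> (('v,'a) qpath \<Rightarrow> 'k)"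

definition diffop :: "'v set \<Rightarrow> 'a set \<Rightarrow> ('a \<Rightarrow> 'v) \<Rightarrow> ('a \<Rightarrow> 'v) \<Rightarrow>
    (('v,'a) qpath \<Rightarrow> 'k::field) set \<Rightarrow> ('v,'a,'k) op \<Rightarrow> bool" where
  "diffop V E src tgt I D \<longleftrightarrow>
     (\<forall>x\<in>PA V E src tgt. D x \<in> PA V E src tgt) \<and>
     (\<forall>x\<in>PA V E src tgt. \<forall>y\<in>PA V E src tgt. psub (D (padd x y)) (padd (D x) (D y)) \<in> I) \<and>
     (\<forall>c. \<forall>x\<in>PA V E src tgt. psub (D (pscale c x)) (pscale c (D x)) \<in> I) \<and>
     (\<forall>x\<in>PA V E src tgt. \<forall>y\<in>PA V E src tgt.
        psub (D (pmult V E src tgt x y))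
             (padd (pmult V E src tgt (D x) y) (pmult V E src tgt x (D y))) \<in> I)"

definition inner_op :: "'v set \<Rightarrow> 'a set \<Rightarrow> ('a \<Rightarrow> 'v) \<Rightarrow> ('a \<Rightarrow> 'v) \<Rightarrow>
    (('v,'a) qpath \<Rightarrow> 'k::field) set \<Rightarrow> ('v,'a,'k) op \<Rightarrow> bool" where
  "inner_op V E src tgt I D \<longleftrightarrow>
     (\<exists>m\<in>PA V E src tgt. \<forall>x\<in>PA V E src tgt.
        psub (D x) (psub (pmult V E src tgt m x) (pmult V E src tgt x m)) \<in> I)"

definition lincomb_ops :: "'i set \<Rightarrow> ('i \<Rightarrow> 'k::field) \<Rightarrow> ('i \<Rightarrow> ('v,'a,'k) op) \<Rightarrow> ('v,'a,'k) op" where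
  "lincomb_ops J c F = (\<lambda>x p. \<Sum>j\<in>{j\<in>J. c j \<noteq> 0}. c j * F j x p)"

definition H1_basis :: "'v set \<Rightarrow> 'a set \<Rightarrow> ('a \<Rightarrow> 'v) \<Rightarrow> ('a \<Rightarrow> 'v) \<Rightarrow>
    (('v,'a) qpath \<Rightarrow> 'k::field) set \<Rightarrow> 'i set \<Rightarrow> ('i \<Rightarrow> ('v,'a,'k) op) \<Rightarrow> bool" where
  "H1_basis V E src tgt I J F \<longleftrightarrow>
     (\<forall>j\<in>J. diffop V E src tgt I (F j)) \<and>
     (\<forall>c::'i \<Rightarrow> 'k. finite {j\<in>J. c j \<noteq> 0} \<longrightarrow>
         inner_op V E src tgt I (lincomb_ops J c F) \<longrightarrow> (\<forall>j\<in>J. c j = 0)) \<and>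
     (\<forall>D. diffop V E src tgt I D \<longrightarrow>
         (\<exists>c::'i \<Rightarrow> 'k. finite {j\<in>J. c j \<noteq> 0} \<and>
            inner_op V E src tgt I (\<lambda>x. psub (D x) (lincomb_ops J c F x))))"

text \<open>D_{r,s}: the (unique modulo I) differential operator with D(r) = s and vanishing
  on all other arrows and on all vertices.\<close>

definition Drs :: "'v set \<Rightarrow> 'a set \<Rightarrow> ('a \<Rightarrow> 'v) \<Rightarrow> ('a \<Rightarrow> 'v) \<Rightarrow>
    (('v,'a) qpath \<Rightarrow> 'k::field) set \<Rightarrow> 'a \<Rightarrow> ('v,'a) qpath \<Rightarrow> ('v,'a,'k) op" where
  "Drs V E src tgt I r s = (SOME D. diffop V E src tgt I D \<and>
      psub (D (pelem (arrow_path src r))) (pelem s) \<in> I \<and>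
      (\<forall>a\<in>E. a \<noteq> r \<longrightarrow> D (pelem (arrow_path src a)) \<in> I) \<and>
      (\<forall>v\<in>V. D (pelem (v, [])) \<in> I))"

definition quiver_connected :: "'v set \<Rightarrow> 'a set \<Rightarrow> ('a \<Rightarrow> 'v) \<Rightarrow> ('a \<Rightarrow> 'v) \<Rightarrow> bool" where
  "quiver_connected V E src tgt \<longleftrightarrow>
     (\<forall>u\<in>V. \<forall>v\<in>V. (\<lambda>x y. \<exists>a\<in>E. (src a = x \<and> tgt a = y) \<or> (src a = y \<and> tgt a = x))\<^sup>*\<^sup>* u v)"

definition graph_image :: "'v set \<Rightarrow> 'a set \<Rightarrow> ('v \<Rightarrow> complex) \<Rightarrow> ('a \<Rightarrow> real \<Rightarrow> complex) \<Rightarrow> complex set" where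
  "graph_image V E pos \<gamma> = pos ` V \<union> (\<Union>a\<in>E. path_image (\<gamma> a))"

definition planar_embedding :: "'v set \<Rightarrow> 'a set \<Rightarrow> ('a \<Rightarrow> 'v) \<Rightarrow> ('a \<Rightarrow> 'v) \<Rightarrow>
    ('v \<Rightarrow> complex) \<Rightarrow> ('a \<Rightarrow> real \<Rightarrow> complex) \<Rightarrow> bool" where
  "planar_embedding V E src tgt pos \<gamma> \<longleftrightarrow>
     inj_on pos V \<and>
     (\<forall>a\<in>E. simple_path (\<gamma> a) \<and> pathstart (\<gamma> a) = pos (src a) \<and> pathfinish (\<gamma> a) = pos (tgt a)) \<and>
     (\<forall>a\<in>E. path_image (\<gamma> a) \<inter> pos ` V \<subseteq> {pos (src a), pos (tgt a)}) \<and>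
     (\<forall>a\<in>E. \<forall>b\<in>E. a \<noteq> b \<longrightarrow> path_image (\<gamma> a) \<inter> path_image (\<gamma> b) \<subseteq> pos ` V)"

definition bounded_faces :: "'v set \<Rightarrow> 'a set \<Rightarrow> ('v \<Rightarrow> complex) \<Rightarrow> ('a \<Rightarrow> real \<Rightarrow> complex) \<Rightarrow> complex set set" where
  "bounded_faces V E pos \<gamma> = {f \<in> components (- graph_image V E pos \<gamma>). bounded f}"

text \<open>face_sign f a is the sum of the signs epsilon_i over the occurrences p_i = a in the
  boundary of f (+1 clockwise as seen from the interior of f, -1 otherwise).
  Equivalently, sum_a face_sign f a * (arc of a) is the boundary cycle of f traversed
  clockwise, i.e. the unique integer combination of the arcs whose winding number is
  -1 around every point of f and 0 around every other point off the quiver.\<close>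

definition face_sign :: "'v set \<Rightarrow> 'a set \<Rightarrow> ('v \<Rightarrow> complex) \<Rightarrow> ('a \<Rightarrow> real \<Rightarrow> complex) \<Rightarrow>
    complex set \<Rightarrow> 'a \<Rightarrow> int" where
  "face_sign V E pos \<gamma> f = (THE c. (\<forall>a. a \<notin> E \<longrightarrow> c a = 0) \<and>
      (\<forall>z. z \<notin> graph_image V E pos \<gamma> \<longrightarrow>
         (\<Sum>a\<in>E. of_int (c a) * winding_number (\<gamma> a) z) = (if z \<in> f then -1 else 0)))"

definition Dface :: "'v set \<Rightarrow> 'a set \<Rightarrow> ('a \<Rightarrow> 'v) \<Rightarrow> ('a \<Rightarrow> 'v) \<Rightarrow>
    ('v \<Rightarrow> complex) \<Rightarrow> ('a \<Rightarrow> real \<Rightarrow> complex) \<Rightarrow>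
    (('v,'a) qpath \<Rightarrow> 'k::field) set \<Rightarrow> complex set \<Rightarrow> ('v,'a,'k) op" where
  "Dface V E src tgt pos \<gamma> I f = (\<lambda>x p. \<Sum>a\<in>E.
      of_int (face_sign V E pos \<gamma> f a) * Drs V E src tgt I a (arrow_path src a) x p)"

end

theory Submission
  imports Defs "HOL-Library.Function_Algebras"
begin

text \<open>
  Subtracting an inner derivation, a derivation may be assumed to vanish on the vertices; it then
  sends an arrow $a$ to a combination of basis paths parallel to $a$. By acyclicity the inner
  derivations that vanish on the vertices come from combinations $\sum_v l_v v$ of vertices and
  multiply $a$ by $l_{t(a)} - l_{h(a)}$. So the claim reduces to: the boundary vectors of the bounded
  faces form a basis of $k^E$ modulo coboundaries.

  For the planar part, build the quiver from one vertex by adding leaves and chords, and compare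
  chains of arcs with their winding number functions on the complement. Janiszewski's theorem shows
  that a leaf does not change the faces and that a chord only cuts faces along a Jordan curve through
  it. Inductively, winding numbers determine a chain, and the integral cycles correspond exactly to
  the integer functions that are constant on faces and vanish on the unbounded one. Hence
  the face boundaries form a basis of the cycles. Over the rationals every chain is a cycle plus a
  coboundary, orthogonally, and rational functionals on $k$ transfer independence to $k$.
\<close>

subsection \<open>Winding numbers and faces of plane quivers\<close>

text \<open>Faces are given only as connected components of a complement, so there is no boundary
  walk to read signs from. The signs of a face are a \<open>THE\<close> over winding numbers:
  \<open>spans_regions\<close> must supply a witness and \<open>wind_injective\<close> its
  uniqueness. The defining property does not mention boundaries, so uniqueness has to hold for all
  chains and not just for cycles; winding numbers of open arcs are not integers, which makes complex
  coefficients natural there. Loops would turn arcs into closed curves with disconnected complement.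
  They are excluded algebraically: as \<open>I\<close> lies in R^2, a loop keeps a class different
  from every vertex, which acyclicity forbids. The detour through the rationals is forced by the
  orthogonal splitting: a sum of squares in \<open>k\<close> can vanish without its terms vanishing,
  for instance when \<open>k\<close> contains a square root of -1. The quotient of the path algebra
  is never formed; all of its algebra is congruence modulo \<open>I\<close>.\<close>

text \<open>A function on faces, written as a total function on the plane. The first clause
  constrains it only off \<open>S\<close>; the second makes it vanish on the unbounded component
  when \<open>S\<close> is compact. In this form a function for a smaller set serves unchanged for a
  larger one.\<close>

definition region_fun :: "complex set \<Rightarrow> (complex \<Rightarrow> 'b::zero) \<Rightarrow> bool" where
  "region_fun S h \<longleftrightarrow> (\<forall>x y. connected_component (- S) x y \<longrightarrow> h x = h y) \<and>
     (\<exists>R. \<forall>z. R \<le> norm z \<longrightarrow> h z = 0)"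

lemma region_fun_mono: "region_fun S' h \<Longrightarrow> S' \<subseteq> S \<Longrightarrow> region_fun S h"
  unfolding region_fun_def by (meson Compl_anti_mono connected_component_of_subset)

lemma region_fun_combine:
  assumes f: "region_fun S f" and g: "region_fun S g" and F: "F 0 0 = 0"
  shows "region_fun S (\<lambda>z. F (f z) (g z))"
proof -
  obtain R1 R2 where R: "\<And>z. R1 \<le> norm z \<Longrightarrow> f z = 0" "\<And>z. R2 \<le> norm z \<Longrightarrow> g z = 0"
    using f g unfolding region_fun_def by blast
  have "f x = f y" "g x = g y" if "connected_component (- S) x y" for x y
    using f g that unfolding region_fun_def by blast+
  moreover have "F (f z) (g z) = 0" if "max R1 R2 \<le> norm z" for z
    using R[of z] that F by simp
  ultimately show ?thesis unfolding region_fun_def by metis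
qed

text \<open>The inverse of the parametrisation would embed a nonempty open subset of the plane into
  the line, against invariance of dimension.\<close>

lemma interior_arc_image:
  fixes g :: "real \<Rightarrow> complex"
  assumes "arc g"
  shows "interior (path_image g) = {}"
proof (rule ccontr)
  assume ne: "interior (path_image g) \<noteq> {}"
  obtain f where f: "homeomorphism (path_image g) {0..1::real} f g" 
    using assms homeomorphism_arc homeomorphism_sym by metis
  have "DIM(complex) \<le> DIM(real)"
  proof (rule invariance_of_dimension)
    show "continuous_on (interior (path_image g)) f"
      by (rule continuous_on_subset[OF homeomorphism_cont1[OF f] interior_subset])
    show "inj_on f (interior (path_image g))"
      by (rule inj_on_inverseI[where g = g])
        (use homeomorphism_apply1[OF f] interior_subset in blast)
  qed (use ne in auto)
  then show False by simp
qed

text \<open>Shrinking \<open>S\<close> to \<open>S'\<close> may merge components. As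
  \<open>S\<close> has no interior outside \<open>S'\<close>, every point off \<open>S'\<close>
  shares its component with points off \<open>S\<close>, and by \<open>const\<close> the value of
  \<open>h\<close> at such a point does not depend on the choice.\<close>

lemma region_fun_extend:
  assumes "compact S" "closed S'" "S' \<subseteq> S" "interior S \<subseteq> S'"
    and h: "region_fun S h"
    and const: "\<And>x y. x \<notin> S \<Longrightarrow> y \<notin> S \<Longrightarrow> connected_component (- S') x y \<Longrightarrow> h x = h y"
  obtains h' where "region_fun S' h'" "\<And>z. z \<notin> S \<Longrightarrow> h' z = h z"
proof -
  define Y where "Y x = (SOME y. y \<notin> S \<and> connected_component (- S') x y)" for x
  have Y: "Y x \<notin> S \<and> connected_component (- S') x (Y x)" if "x \<notin> S'" for x
  proof -
    have "x \<in> closure (- S)"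
      using that assms(4) by (auto simp: closure_complement)
    moreover have "open (connected_component_set (- S') x)"
      using assms(2) by (simp add: open_Compl open_connected_component)
    moreover have "x \<in> connected_component_set (- S') x"
      using that by simp
    ultimately have "- S \<inter> connected_component_set (- S') x \<noteq> {}"
      by (metis IntI empty_iff open_Int_closure_eq_empty Int_commute)
    then have "\<exists>y. y \<notin> S \<and> connected_component (- S') x y" by auto
    then show ?thesis unfolding Y_def by (rule someI_ex)
  qed
  obtain R where R: "\<And>z. R \<le> norm z \<Longrightarrow> h z = 0"
    using h unfolding region_fun_def by auto
  obtain B where B: "\<And>x. x \<in> S \<Longrightarrow> norm x \<le> B"
    using compact_imp_bounded[OF assms(1)] bounded_iff by metis
  define h' where "h' x = (if x \<in> S' then 0 else h (Y x))" for x
  have eq: "h' z = h z" if "z \<notin> S" for z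
    using that const[of z "Y z"] Y[of z] assms(3) by (auto simp: h'_def)
  have "region_fun S' h'"
    unfolding region_fun_def
  proof (intro conjI allI impI)
    fix x y assume xy: "connected_component (- S') x y"
    then have nin: "x \<notin> S'" "y \<notin> S'" using connected_component_in by fastforce+
    have "connected_component (- S') (Y x) (Y y)"
      by (meson Y nin xy connected_component_sym connected_component_trans)
    then show "h' x = h' y"
      using const[of "Y x" "Y y"] Y nin by (simp add: h'_def)
  next
    show "\<exists>R. \<forall>z. R \<le> cmod z \<longrightarrow> h' z = 0"
    proof (intro exI allI impI)
      \<comment> \<open>Beyond \<open>B + 1\<close> the point lies off \<open>S\<close>, where
        \<open>h'\<close> agrees with \<open>h\<close>; beyond \<open>R\<close> the latter is
        zero.\<close>
      fix z assume z: "max R (B + 1) \<le> cmod z"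
      then have "z \<notin> S" using B[of z] by force
      then show "h' z = 0" using eq R z by auto
    qed
  qed
  then show thesis using eq that by blast
qed

text \<open>A component of \<open>- S\<close> is pinned down by the component of \<open>- S'\<close>
  around it and one bit \<open>\<phi>\<close>. The bit will be constant for a leaf and the side of a
  Jordan curve for a chord.\<close>

lemma finite_components_refine:
  assumes "finite (components (- S'))" "S' \<subseteq> S"
    and c: "\<And>x y. x \<notin> S \<Longrightarrow> y \<notin> S \<Longrightarrow> connected_component (- S') x y \<Longrightarrow> (\<phi> x :: bool) = \<phi> y
        \<Longrightarrow> connected_component (- S) x y"
  shows "finite (components (- S))"
proof -
  define F where "F f = (let x = (SOME x. x \<in> f) in (connected_component_set (- S') x, \<phi> x))" for f
  have pt: "(SOME x. x \<in> f) \<in> f \<and> (SOME x. x \<in> f) \<notin> S \<and> f = connected_component_set (- S) (SOME x. x \<in> f)"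
    if f: "f \<in> components (- S)" for f
  proof -
    have 1: "(SOME x. x \<in> f) \<in> f"
      using in_components_nonempty[OF f] by (simp add: some_in_eq)
    moreover have "f \<subseteq> - S" using f by (rule in_components_subset)
    moreover have "f = connected_component_set (- S) (SOME x. x \<in> f)"
      using f 1 by (metis componentsE connected_component_eq)
    ultimately show ?thesis by blast
  qed
  have "inj_on F (components (- S))"
  proof (rule inj_onI)
    fix f g assume f: "f \<in> components (- S)" and g: "g \<in> components (- S)" and "F f = F g"
    then have "connected_component_set (- S') (SOME x. x \<in> f) = connected_component_set (- S') (SOME x. x \<in> g)"
       "\<phi> (SOME x. x \<in> f) = \<phi> (SOME x. x \<in> g)"
      by (simp_all add: F_def Let_def)
    moreover have "(SOME x. x \<in> g) \<in> - S'" using pt[OF g] assms(2) by blast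
    ultimately have "connected_component (- S) (SOME x. x \<in> f) (SOME x. x \<in> g)"
      using pt[OF f] pt[OF g] c by (metis connected_component_refl mem_Collect_eq)
    then show "f = g" using pt[OF f] pt[OF g] by (metis connected_component_eq mem_Collect_eq)
  qed
  moreover have "F ` components (- S) \<subseteq> components (- S') \<times> UNIV"
    using pt assms(2) by (auto simp: F_def Let_def components_def) 
  moreover have "finite (components (- S') \<times> (UNIV :: bool set))" using assms(1) by simp
  ultimately show ?thesis by (metis finite_imageD finite_subset)
qed

section \<open>Chains, boundaries and stepwise construction of a plane quiver without loops\<close>

locale plane_quiver =
  fixes V :: "'v set" and E :: "'a set" and src tgt :: "'a \<Rightarrow> 'v"
    and pos :: "'v \<Rightarrow> complex" and \<gamma> :: "'a \<Rightarrow> real \<Rightarrow> complex"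
  assumes finV: "finite V" and finE: "finite E"
    and ends: "\<And>a. a \<in> E \<Longrightarrow> src a \<in> V" "\<And>a. a \<in> E \<Longrightarrow> tgt a \<in> V"
    and no_loop: "\<And>a. a \<in> E \<Longrightarrow> src a \<noteq> tgt a"
    and emb: "planar_embedding V E src tgt pos \<gamma>"
begin

definition wind :: "('a \<Rightarrow> complex) \<Rightarrow> complex \<Rightarrow> complex" where
  "wind c z = (\<Sum>a\<in>E. c a * winding_number (\<gamma> a) z)"

text \<open>The boundary map from 1-chains to 0-chains; its kernel is the space of cycles. Integer
  coefficients occur for face boundaries, rational ones for orthogonality.\<close>

definition bdry :: "('a \<Rightarrow> 'b::comm_ring_1) \<Rightarrow> 'v \<Rightarrow> 'b" where
  "bdry c v = (\<Sum>a\<in>E. c a * ((if tgt a = v then 1 else 0) - (if src a = v then 1 else 0)))"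

abbreviation image_of :: "'v set \<Rightarrow> 'a set \<Rightarrow> complex set" where
  "image_of V' E' \<equiv> graph_image V' E' pos \<gamma>"

text \<open>A chord joins two vertices already present and so closes a cycle; a leaf brings one new
  vertex and leaves the cycle space unchanged. Every intermediate stage is connected.\<close>

inductive built :: "'v set \<Rightarrow> 'a set \<Rightarrow> bool" where
  vertex: "v \<in> V \<Longrightarrow> built {v} {}"
| chord: "built V' E' \<Longrightarrow> a \<in> E \<Longrightarrow> a \<notin> E' \<Longrightarrow> src a \<in> V' \<Longrightarrow> tgt a \<in> V' \<Longrightarrow> built V' (insert a E')"
| leaf: "built V' E' \<Longrightarrow> a \<in> E \<Longrightarrow> u \<in> V' \<Longrightarrow> w \<notin> V' \<Longrightarrow> (src a = u \<and> tgt a = w \<or> src a = w \<and> tgt a = u) \<Longrightarrow>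
    built (insert w V') (insert a E')"

lemma built_sub:
  assumes "built V' E'"
  shows "V' \<subseteq> V" "E' \<subseteq> E" "\<And>a. a \<in> E' \<Longrightarrow> src a \<in> V' \<and> tgt a \<in> V'"
proof -
  have "V' \<subseteq> V \<and> E' \<subseteq> E \<and> (\<forall>a\<in>E'. src a \<in> V' \<and> tgt a \<in> V')"
    using assms by induction (use ends in auto)
  then show "V' \<subseteq> V" "E' \<subseteq> E" "\<And>a. a \<in> E' \<Longrightarrow> src a \<in> V' \<and> tgt a \<in> V'" by auto
qed

text \<open>A built subquiver with the largest number of vertices and arrows already contains every
  arrow that touches it, so connectedness makes it the whole quiver.\<close>

lemma built_all:
  assumes conn: "quiver_connected V E src tgt" and "V \<noteq> {}"
  shows "built V E"
proof -
  define M where "M = {p. built (fst p) (snd p)}"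
  have "p \<in> Pow V \<times> Pow E" if "p \<in> M" for p
    using that built_sub(1,2)[of "fst p" "snd p"] by (simp add: M_def mem_Times_iff)
  then have "M \<subseteq> Pow V \<times> Pow E" by blast
  then have finM: "finite M" using finV finE by (meson finite_Pow_iff finite_SigmaI finite_subset)
  obtain v where v: "v \<in> V" using assms by blast
  have "({v}, {}) \<in> M" using built.vertex[OF v] by (simp add: M_def)
  then obtain p where p: "p \<in> M" and pmax: "\<And>q. q \<in> M \<Longrightarrow> card (fst q) + card (snd q) \<le> card (fst p) + card (snd p)"
    using finM obtains_MAX[of M "\<lambda>p. card (fst p) + card (snd p)"] Max_ge
    by (metis (no_types, lifting) empty_iff finite_imageI imageI)
  obtain V' E' where pe: "p = (V', E')" by force
  have b: "built V' E'" using p pe M_def by simp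
  note sub = built_sub[OF b]
  have finV': "finite V'" and finE': "finite E'" using sub finV finE finite_subset by blast+
  have closed: "a \<in> E'" if aE: "a \<in> E" and aV: "src a \<in> V' \<or> tgt a \<in> V'" for a
  proof (rule ccontr)
    assume na: "a \<notin> E'"
    consider "src a \<in> V'" "tgt a \<in> V'" | "src a \<in> V'" "tgt a \<notin> V'" | "src a \<notin> V'" "tgt a \<in> V'"
      using aV by blast
    then show False
    proof cases
      case 1
      then have "(V', insert a E') \<in> M" using built.chord[OF b] aE na by (simp add: M_def)
      from pmax[OF this] show False using pe na finE' by simp
    next
      case 2
      then have "(insert (tgt a) V', insert a E') \<in> M"
        using built.leaf[OF b, of a "src a" "tgt a"] aE na by (simp add: M_def)
      from pmax[OF this] show False using pe na finE' finV' 2 by simp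
    next
      case 3
      then have "(insert (src a) V', insert a E') \<in> M"
        using built.leaf[OF b, of a "tgt a" "src a"] aE na by (simp add: M_def)
      from pmax[OF this] show False using pe na finE' finV' 3 by simp
    qed
  qed
  have "V' \<noteq> {}" using b by cases auto
  then obtain u where u: "u \<in> V'" by blast
  have "w \<in> V'" if "w \<in> V" for w
  proof -
    have "(\<lambda>x y. \<exists>a\<in>E. (src a = x \<and> tgt a = y) \<or> (src a = y \<and> tgt a = x))\<^sup>*\<^sup>* u w"
      using conn that u sub(1) unfolding quiver_connected_def by blast
    then show ?thesis
      by induction (use u closed sub(3) in blast)+
  qed
  then have "V' = V" using sub by blast
  moreover have "E' = E" using closed sub ends \<open>V' = V\<close> by blast
  ultimately show ?thesis using b by simp
qed

lemma inj_pos: "inj_on pos V" using emb by (simp add: planar_embedding_def)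

lemma arc_\<gamma>: "a \<in> E \<Longrightarrow> arc (\<gamma> a)"
  using emb no_loop[of a] ends[of a] inj_pos
  by (auto simp: planar_embedding_def arc_simple_path inj_on_eq_iff)

lemma ends_\<gamma>: "a \<in> E \<Longrightarrow> pathstart (\<gamma> a) = pos (src a)" "a \<in> E \<Longrightarrow> pathfinish (\<gamma> a) = pos (tgt a)"
  using emb by (auto simp: planar_embedding_def)

lemma compact_image_of:
  assumes "V' \<subseteq> V" "E' \<subseteq> E"
  shows "compact (image_of V' E')"
  unfolding graph_image_def
proof (rule compact_Un)
  show "compact (pos ` V')" using assms finV finite_subset by (blast intro: finite_imp_compact)
  show "compact (\<Union>a\<in>E'. path_image (\<gamma> a))"
    using assms finE finite_subset by (blast intro: compact_UN compact_arc_image arc_\<gamma>)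
qed

text \<open>Distinct arcs meet only at vertices, and an arc passes through no vertices but its ends.
  The intersection is therefore one point for a leaf and two for a chord, which is what decides how
  Janiszewski's theorem applies.\<close>

lemma arc_Int_image_of:
  assumes "built V' E'" "a \<in> E" "a \<notin> E'"
  shows "path_image (\<gamma> a) \<inter> image_of V' E' = pos ` ({src a, tgt a} \<inter> V')"
proof
  note sub = built_sub[OF assms(1)]
  have inV: "path_image (\<gamma> b) \<inter> pos ` V \<subseteq> {pos (src b), pos (tgt b)}" if "b \<in> E" for b
    using emb that by (auto simp: planar_embedding_def)
  have two: "path_image (\<gamma> a) \<inter> path_image (\<gamma> b) \<subseteq> pos ` V" if "b \<in> E'" for b
  proof -
    have "b \<in> E" "a \<noteq> b" using that assms sub by auto
    then show ?thesis using emb assms(2) unfolding planar_embedding_def by blast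
  qed
  show "path_image (\<gamma> a) \<inter> image_of V' E' \<subseteq> pos ` ({src a, tgt a} \<inter> V')"
  proof
    fix x assume x: "x \<in> path_image (\<gamma> a) \<inter> image_of V' E'"
    have "x \<in> pos ` V'"
    proof (cases "x \<in> pos ` V'")
      case False
      then obtain b where b: "b \<in> E'" "x \<in> path_image (\<gamma> b)"
        using x by (auto simp: graph_image_def)
      then have "x \<in> {pos (src b), pos (tgt b)}" using two[OF b(1)] inV[of b] x sub by blast
      then show ?thesis using sub(3)[OF b(1)] by blast
    qed
    then obtain v where v: "v \<in> V'" "x = pos v" by blast
    then have "x \<in> {pos (src a), pos (tgt a)}" using inV[OF assms(2)] x sub by blast
    then have "v \<in> {src a, tgt a}" using v inj_pos ends[OF assms(2)] sub(1) by (auto dest: inj_onD)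
    then show "x \<in> pos ` ({src a, tgt a} \<inter> V')" using v by blast
  qed
  have "pos (src a) \<in> path_image (\<gamma> a)" "pos (tgt a) \<in> path_image (\<gamma> a)"
    using ends_\<gamma>[OF assms(2)] by (metis pathstart_in_path_image pathfinish_in_path_image)+
  then show "pos ` ({src a, tgt a} \<inter> V') \<subseteq> path_image (\<gamma> a) \<inter> image_of V' E'"
    by (auto simp: graph_image_def)
qed

lemma image_of_insert [simp]:
  "image_of V' (insert a E') = image_of V' E' \<union> path_image (\<gamma> a)"
  by (auto simp: graph_image_def)

lemma image_of_leaf:
  assumes "a \<in> E" "w = src a \<or> w = tgt a"
  shows "image_of (insert w V') (insert a E') = image_of V' E' \<union> path_image (\<gamma> a)"
proof -
  have "pos w \<in> path_image (\<gamma> a)"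
    using ends_\<gamma>[OF assms(1)] assms(2) by (metis pathstart_in_path_image pathfinish_in_path_image)
  then show ?thesis by (auto simp: graph_image_def)
qed

lemma wind_simps:
  "wind (\<lambda>a. c a + d a) z = wind c z + wind d z"
  "wind (\<lambda>a. c a - d a) z = wind c z - wind d z"
  "wind (\<lambda>a. - c a) z = - wind c z"
  "wind (\<lambda>a. k * c a) z = k * wind c z"
  by (simp_all add: wind_def sum.distrib sum_subtractf sum_negf algebra_simps sum_distrib_left)

lemma bdry_simps:
  "bdry (\<lambda>a. c a + d a) v = bdry c v + bdry d v"
  "bdry (\<lambda>a. c a - d a) v = bdry c v - bdry d v"
  "bdry (\<lambda>a. - c a) v = - bdry c v"
  "bdry (\<lambda>a. k * c a) v = k * bdry c v"
  by (simp_all add: bdry_def sum.distrib sum_subtractf sum_negf algebra_simps sum_distrib_left)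

lemma wind_remove:
  "a \<in> E \<Longrightarrow> wind c z = c a * winding_number (\<gamma> a) z + (\<Sum>b\<in>E - {a}. c b * winding_number (\<gamma> b) z)"
  using finE by (simp add: wind_def sum.remove)

lemma wind_single: "a \<in> E \<Longrightarrow> wind (\<lambda>b. if b = a then 1 else 0) z = winding_number (\<gamma> a) z"
  using finE by (simp add: wind_remove)

lemma bdry_single:
  "a \<in> E \<Longrightarrow> bdry (\<lambda>b. if b = a then 1 else 0) v = (if tgt a = v then 1 else 0) - (if src a = v then 1 else 0)"
  using finE by (simp add: bdry_def sum.remove)

section \<open>Simple arcs inside the built part, with the chains they traverse\<close>

text \<open>Couples the geometric arc \<open>g\<close> with the integral chain \<open>d\<close> of
  arrows along it. Such an arc will close a chord to a Jordan curve whose winding numbers are those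
  of a chain.\<close>

definition chain_arc :: "'v set \<Rightarrow> 'a set \<Rightarrow> 'v \<Rightarrow> 'v \<Rightarrow> (real \<Rightarrow> complex) \<Rightarrow> ('a \<Rightarrow> int) \<Rightarrow> bool" where
  "chain_arc V' E' p q g d \<longleftrightarrow> arc g \<and> pathstart g = pos p \<and> pathfinish g = pos q \<and>
     path_image g \<subseteq> image_of V' E' \<and> (\<forall>a. a \<notin> E' \<longrightarrow> d a = 0) \<and>
     (\<forall>v. bdry d v = (if q = v then 1 else 0) - (if p = v then 1 else 0)) \<and>
     (\<forall>z. z \<notin> image_of V' E' \<longrightarrow> winding_number g z = wind (\<lambda>a. of_int (d a)) z)"

lemma chain_arc_mono:
  assumes "chain_arc V' E' p q g d" "V' \<subseteq> V''" "E' \<subseteq> E''"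
  shows "chain_arc V'' E'' p q g d"
proof -
  have "image_of V' E' \<subseteq> image_of V'' E''" using assms by (auto simp: graph_image_def)
  then show ?thesis using assms unfolding chain_arc_def by blast
qed

lemma chain_arc_reverse:
  assumes "chain_arc V' E' p q g d"
  shows "chain_arc V' E' q p (reversepath g) (\<lambda>a. - d a)"
proof -
  have "winding_number (reversepath g) z = - winding_number g z" if "z \<notin> image_of V' E'" for z
    by (rule winding_number_reversepath) (use assms that in \<open>auto simp: chain_arc_def arc_imp_path\<close>)
  then show ?thesis
    using assms by (auto simp: chain_arc_def arc_reversepath bdry_simps wind_simps)
qed

lemma chain_arc_single:
  assumes "a \<in> E" "a \<in> E'"
  shows "chain_arc V' E' (src a) (tgt a) (\<gamma> a) (\<lambda>b. if b = a then 1 else 0)"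
  using assms arc_\<gamma> ends_\<gamma> by (auto simp: chain_arc_def graph_image_def bdry_single wind_single if_distrib[of of_int] cong: if_cong)

text \<open>Only a leaf needs work: an arc ending at the new vertex \<open>w\<close> runs inside the
  old part to \<open>u\<close> and then along the new arrow. The two pieces meet only at
  \<open>u\<close>, so their join is again simple.\<close>

lemma chain_arc_exists:
  assumes "built V' E'" "p \<in> V'" "q \<in> V'" "p \<noteq> q"
  shows "\<exists>g d. chain_arc V' E' p q g d"
  using assms
proof (induction arbitrary: p q)
  case (vertex v)
  then show ?case by simp
next
  case (chord V' E' a)
  then show ?case using chain_arc_mono by (meson subset_insertI subset_refl)
next
  case (leaf V' E' a u w)
  note sub = built_sub[OF leaf.hyps(1)]
  have na: "a \<notin> E'" using leaf.hyps sub by blast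
  let ?V = "insert w V'" and ?E = "insert a E'"
  have mono: "chain_arc ?V ?E p q g d" if "chain_arc V' E' p q g d" for p q g d
    using chain_arc_mono[OF that] by blast
  \<comment> \<open>The new arrow is traversed towards \<open>w\<close>, against its own direction
    if necessary.\<close>
  have aw: "\<exists>g d. chain_arc {u, w} {a} u w g d"
  proof -
    have *: "chain_arc {u, w} {a} (src a) (tgt a) (\<gamma> a) (\<lambda>b. if b = a then 1 else 0)"
      using chain_arc_single leaf.hyps by blast
    from leaf.hyps(5) show ?thesis
    proof
      assume "src a = u \<and> tgt a = w" then show ?thesis using * by blast
    next
      assume "src a = w \<and> tgt a = u" then show ?thesis using chain_arc_reverse[OF *] by auto
    qed
  qed
  then obtain ga da where ga: "chain_arc {u, w} {a} u w ga da" by blast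
  have img: "image_of {u, w} {a} = path_image (\<gamma> a)"
    using ends_\<gamma>[OF leaf.hyps(2)] leaf.hyps(5) pathstart_in_path_image[of "\<gamma> a"] pathfinish_in_path_image[of "\<gamma> a"]
    by (auto simp: graph_image_def)
  have gaU: "chain_arc ?V ?E u w ga da"
    by (rule chain_arc_mono[OF ga]) (use leaf.hyps(3) in auto)
  have to_w: "\<exists>g d. chain_arc ?V ?E p w g d" if p: "p \<in> V'" for p
  proof (cases "p = u")
    case True
    then show ?thesis using gaU by blast
  next
    case False
    then obtain g d where g: "chain_arc V' E' p u g d" using leaf.IH p leaf.hyps by blast
    have int: "path_image g \<inter> path_image ga \<subseteq> {pos u}"
    proof -
      have "path_image g \<inter> path_image ga \<subseteq> path_image (\<gamma> a) \<inter> image_of V' E'"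
        using g ga img by (auto simp: chain_arc_def)
      also have "\<dots> = pos ` ({src a, tgt a} \<inter> V')"
        by (rule arc_Int_image_of) (use leaf.hyps na in auto)
      also have "\<dots> \<subseteq> {pos u}" using leaf.hyps by auto
      finally show ?thesis .
    qed
    have arcj: "arc (g +++ ga)"
      by (rule arc_join) (use g ga int in \<open>auto simp: chain_arc_def\<close>)
    have "chain_arc ?V ?E p w (g +++ ga) (\<lambda>a. d a + da a)"
      unfolding chain_arc_def
    proof (intro conjI allI impI)
      show "path_image (g +++ ga) \<subseteq> image_of ?V ?E"
        using mono[OF g] gaU by (auto simp: chain_arc_def path_image_join)
      fix z assume z: "z \<notin> image_of ?V ?E"
      have "winding_number (g +++ ga) z = winding_number g z + winding_number ga z"
        by (rule winding_number_join) (use mono[OF g] gaU z in \<open>auto simp: chain_arc_def arc_imp_path\<close>)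
      then show "winding_number (g +++ ga) z = wind (\<lambda>a. of_int (d a + da a)) z"
        using mono[OF g] gaU z by (simp add: chain_arc_def wind_simps)
    qed (use arcj mono[OF g] gaU in \<open>auto simp: chain_arc_def bdry_simps\<close>)
    then show ?thesis by blast
  qed
  show ?case
  proof (cases "p = w")
    case True
    then show ?thesis using to_w[of q] leaf.prems chain_arc_reverse by blast
  next
    case pw: False
    show ?thesis
    proof (cases "q = w")
      case True then show ?thesis using to_w[of p] leaf.prems pw by blast
    next
      case False
      then have "\<exists>g d. chain_arc V' E' p q g d" using leaf.IH leaf.prems pw by auto
      then show ?thesis using mono by blast
    qed
  qed
qed

section \<open>The invariant relating chains to functions on faces\<close>

text \<open>Surjectivity with integral cycles. Applied to minus the indicator of a bounded face it
  yields the witness for \<open>face_sign\<close>.\<close>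

definition spans_regions :: "'v set \<Rightarrow> 'a set \<Rightarrow> bool" where
  "spans_regions V' E' \<longleftrightarrow>
    (\<forall>h::complex \<Rightarrow> int. region_fun (image_of V' E') h \<longrightarrow>
      (\<exists>c. (\<forall>a. a \<notin> E' \<longrightarrow> c a = 0) \<and> (\<forall>v. bdry c v = 0) \<and>
           (\<forall>z. z \<notin> image_of V' E' \<longrightarrow> wind (\<lambda>a. of_int (c a)) z = of_int (h z))))"

text \<open>Here \<open>c\<close> ranges over all complex chains, cycles or not; this is the
  uniqueness behind \<open>face_sign\<close>.\<close>

definition wind_injective :: "'v set \<Rightarrow> 'a set \<Rightarrow> bool" where
  "wind_injective V' E' \<longleftrightarrow>
    (\<forall>c. (\<forall>a. a \<notin> E' \<longrightarrow> c a = 0) \<longrightarrow> (\<forall>z. z \<notin> image_of V' E' \<longrightarrow> wind c z = 0) \<longrightarrow> (\<forall>a. c a = 0))"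

text \<open>The converse of \<open>spans_regions\<close>, over the rationals because the orthogonal
  projection produces rational cycles.\<close>

definition cycles_constant :: "'v set \<Rightarrow> 'a set \<Rightarrow> bool" where
  "cycles_constant V' E' \<longleftrightarrow>
    (\<forall>c::'a \<Rightarrow> rat. (\<forall>a. a \<notin> E' \<longrightarrow> c a = 0) \<longrightarrow> (\<forall>v. bdry c v = 0) \<longrightarrow>
      (\<exists>h. region_fun (image_of V' E') h \<and>
           (\<forall>z. z \<notin> image_of V' E' \<longrightarrow> wind (\<lambda>a. of_rat (c a)) z = of_rat (h z))))"

definition well_wound :: "'v set \<Rightarrow> 'a set \<Rightarrow> bool" where
  "well_wound V' E' \<longleftrightarrow> spans_regions V' E' \<and> wind_injective V' E' \<and> cycles_constant V' E' \<and>
     finite (components (- image_of V' E'))"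

lemma interior_image_insert:
  assumes "built V' E'" "a \<in> E"
  shows "interior (image_of V' E' \<union> path_image (\<gamma> a)) \<subseteq> image_of V' E'"
proof -
  have "closed (image_of V' E')"
    using compact_image_of built_sub[OF assms(1)] compact_imp_closed by blast
  then have "interior (image_of V' E' \<union> path_image (\<gamma> a)) = interior (image_of V' E')"
    using interior_closed_Un_empty_interior interior_arc_image arc_\<gamma> assms by blast
  then show ?thesis using interior_subset by blast
qed

lemma dense_complement:
  assumes "built V' E'" "a \<in> E" "z \<notin> image_of V' E'"
  shows "z \<in> closure (- (image_of V' E' \<union> path_image (\<gamma> a)))"
  unfolding closure_complement using interior_image_insert[OF assms(1,2)] assms(3) by blast

text \<open>The point \<open>w\<close> may lie on an arc outside \<open>E'\<close>: its winding
  number can jump there, but its coefficient is zero.\<close>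

lemma continuous_chain:
  assumes "built V' E'" "\<And>a. a \<notin> E' \<Longrightarrow> c a = 0" "w \<notin> image_of V' E'"
  shows "isCont (wind c) w"
proof -
  have "isCont (\<lambda>z. c a * winding_number (\<gamma> a) z) w" if "a \<in> E" for a
  proof (cases "a \<in> E'")
    case True
    then have "w \<notin> path_image (\<gamma> a)" using assms(3) by (auto simp: graph_image_def)
    then show ?thesis
      using continuous_at_winding_number[of "\<gamma> a" w] arc_\<gamma>[OF that] arc_imp_path
      by (intro continuous_mult continuous_const) auto
  next
    case False
    then show ?thesis using assms(2) by simp
  qed
  then show ?thesis unfolding wind_def by (intro continuous_sum) auto
qed

text \<open>Points of the newly added arc are limits of points off the whole image, so vanishing
  passes to them by continuity. This reduces injectivity to the smaller quiver once the new
  coefficient is known to be zero.\<close>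

lemma wind_zero_extend:
  assumes b: "built V' E'" and a: "a \<in> E" and c0: "\<And>b. b \<notin> E' \<Longrightarrow> c b = 0"
    and cz: "\<And>z. z \<notin> image_of V' E' \<union> path_image (\<gamma> a) \<Longrightarrow> wind c z = 0"
    and z: "z \<notin> image_of V' E'"
  shows "wind c z = 0"
proof -
  obtain s where s: "\<And>n. s n \<in> - (image_of V' E' \<union> path_image (\<gamma> a))" "s \<longlonglongrightarrow> z"
    using dense_complement[OF b a z] unfolding closure_sequential by blast
  have "(\<lambda>n. wind c (s n)) \<longlonglongrightarrow> wind c z"
    by (rule isCont_tendsto_compose[OF continuous_chain[OF b _ z] s(2)]) (rule c0)
  moreover have "wind c (s n) = 0" for n using cz s(1)[of n] by blast
  ultimately show ?thesis by (simp add: LIMSEQ_const_iff)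
qed

text \<open>The punctured plane is connected, so a function that is constant on it and zero far out
  vanishes, and the zero chain realises it.\<close>

lemma well_wound_vertex:
  assumes "v \<in> V"
  shows "well_wound {v} {}"
proof -
  have img: "image_of {v} {} = {pos v}" by (simp add: graph_image_def)
  have conn: "connected (- {pos v})"
    by (simp add: connected_punctured_universe)
  have "spans_regions {v} {}"
    unfolding spans_regions_def img
  proof (intro allI impI)
    fix h :: "complex \<Rightarrow> int" assume h: "region_fun {pos v} h"
    obtain R where R: "\<And>z. R \<le> norm z \<Longrightarrow> h z = 0" using h unfolding region_fun_def by blast
    \<comment> \<open>A point that is far enough out for \<open>R\<close> and differs from
      \<open>pos v\<close>, also when \<open>R\<close> is negative.\<close>
    define z0 where "z0 = complex_of_real (max R 0 + norm (pos v) + 1)"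
    have n: "norm z0 = max R 0 + norm (pos v) + 1" unfolding z0_def norm_of_real by simp
    have z0: "z0 \<noteq> pos v" using n by auto
    have "R \<le> norm z0" unfolding n by (smt (verit) norm_ge_zero)
    then have hz0: "h z0 = 0" by (rule R)
    have "h z = 0" if "z \<noteq> pos v" for z
    proof -
      have "connected_component (- {pos v}) z z0"
        using conn that z0 by (auto simp: connected_iff_connected_component)
      then show ?thesis using h z0 hz0 unfolding region_fun_def by metis
    qed
    then show "\<exists>c. (\<forall>a. a \<notin> {} \<longrightarrow> c a = 0) \<and> (\<forall>v. bdry c v = 0) \<and>
           (\<forall>z. z \<notin> {pos v} \<longrightarrow> wind (\<lambda>a. of_int (c a)) z = of_int (h z))"
      by (intro exI[of _ "\<lambda>_. 0"]) (auto simp: bdry_def wind_def)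
  qed
  moreover have "wind_injective {v} {}" by (simp add: wind_injective_def)
  moreover have "cycles_constant {v} {}"
    unfolding cycles_constant_def
    by (intro allI impI exI[of _ "\<lambda>_. 0"]) (simp add: region_fun_def wind_def)
  moreover have "finite (components (- image_of {v} {}))"
    unfolding img by (rule finite_subset[where B = "{- {pos v}}"])
      (use conn in \<open>auto simp: components_def connected_component_eq_self\<close>)
  ultimately show ?thesis by (simp add: well_wound_def)
qed

text \<open>The new arc meets the old image in one point and separates nothing, so the functions on
  faces stay the same. The new coefficient is zero for a cycle because of the boundary at the free
  end, and for a chain with zero winding numbers because of the singularity there.\<close>

lemma well_wound_leaf:
  assumes b: "built V' E'" and a: "a \<in> E" and u: "u \<in> V'" and w: "w \<notin> V'"
    and uw: "src a = u \<and> tgt a = w \<or> src a = w \<and> tgt a = u"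
    and IH: "well_wound V' E'"
  shows "well_wound (insert w V') (insert a E')"
proof -
  note sub = built_sub[OF b]
  have na: "a \<notin> E'" using w uw sub(3) by blast
  let ?S' = "image_of V' E'" and ?A = "path_image (\<gamma> a)"
  let ?S = "?S' \<union> ?A"
  have img: "image_of (insert w V') (insert a E') = ?S"
    using image_of_leaf[OF a] uw by blast
  have compS': "compact ?S'" by (rule compact_image_of[OF sub(1,2)])
  have compA: "compact ?A" using a arc_\<gamma> compact_arc_image by blast
  have compS: "compact ?S" by (rule compact_Un[OF compS' compA])
  have clS': "closed ?S'" by (rule compact_imp_closed[OF compS'])
  have int: "?A \<inter> ?S' = {pos u}"
    using arc_Int_image_of[OF b a na] uw u w by auto
  \<comment> \<open>Janiszewski's theorem for the old image and the arc: their intersection is a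
    point, hence connected, and the complement of an arc is connected.\<close>
  have cc: "connected_component (- ?S) x y"
    if "x \<notin> ?S" "y \<notin> ?S" "connected_component (- ?S') x y" for x y
  proof (rule Janiszewski[OF compS' compact_imp_closed[OF compA]])
    show "connected (?S' \<inter> ?A)" using int by (simp add: Int_commute)
    have "connected (- ?A)" using connected_arc_complement[OF arc_\<gamma>[OF a]] by simp
    then show "connected_component (- ?A) x y"
      using that by (auto simp: connected_iff_connected_component)
  qed fact
  have posw: "pos w \<notin> ?S'"
  proof
    assume "pos w \<in> ?S'"
    moreover have "pos w \<in> ?A"
      using uw ends_\<gamma>[OF a] by (metis pathstart_in_path_image pathfinish_in_path_image)
    ultimately have "pos w = pos u" using int by blast
    then show False using inj_pos uw ends[OF a] no_loop[OF a] by (auto dest: inj_onD)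
  qed
  have cl: "pos w \<in> closure (- ?S)"
    by (rule dense_complement[OF b a posw])
  have "spans_regions (insert w V') (insert a E')"
    unfolding spans_regions_def img
  proof (intro allI impI)
    fix h :: "complex \<Rightarrow> int" assume h: "region_fun ?S h"
    have "h x = h y" if "x \<notin> ?S" "y \<notin> ?S" "connected_component (- ?S') x y" for x y
      using h cc[OF that] unfolding region_fun_def by blast
    then obtain h' where h': "region_fun ?S' h'" "\<And>z. z \<notin> ?S \<Longrightarrow> h' z = h z"
      using region_fun_extend[OF compS clS' _ interior_image_insert[OF b a] h] by blast
    obtain c where "\<forall>a. a \<notin> E' \<longrightarrow> c a = 0" "\<forall>v. bdry c v = 0"
           "\<forall>z. z \<notin> ?S' \<longrightarrow> wind (\<lambda>a. of_int (c a)) z = of_int (h' z)"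
      using IH h'(1) unfolding well_wound_def spans_regions_def by blast
    then show "\<exists>c. (\<forall>b. b \<notin> insert a E' \<longrightarrow> c b = 0) \<and> (\<forall>v. bdry c v = 0) \<and>
           (\<forall>z. z \<notin> ?S \<longrightarrow> wind (\<lambda>a. of_int (c a)) z = of_int (h z))"
      using h'(2) by (intro exI[of _ c]) auto
  qed
  moreover have "wind_injective (insert w V') (insert a E')"
    unfolding wind_injective_def img
  proof (intro impI allI)
    fix c x
    assume c0: "\<forall>b. b \<notin> insert a E' \<longrightarrow> c b = 0" and cz: "\<forall>z. z \<notin> ?S \<longrightarrow> wind c z = 0"
    define c' where "c' = c(a := 0)"
    have c'0: "c' b = 0" if "b \<notin> E'" for b using c0 that by (auto simp: c'_def)
    have dec: "wind c z = c a * winding_number (\<gamma> a) z + wind c' z" for z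
      using wind_remove[OF a, of c z] wind_remove[OF a, of c' z] by (simp add: c'_def)
    \<comment> \<open>If \<open>c a\<close> were nonzero, the winding number of the new arc would
      equal \<open>- wind c' / c a\<close> off the image and so converge at the free end
      \<open>pos w\<close>, where it has a logarithmic singularity.\<close>
    have ca: "c a = 0"
    proof (rule ccontr)
      assume nz: "c a \<noteq> 0"
      obtain s where s: "\<And>n. s n \<in> - ?S" "s \<longlonglongrightarrow> pos w"
        using cl unfolding closure_sequential by blast
      let ?L = "- wind c' (pos w) / c a"
      have "(\<lambda>n. wind c' (s n)) \<longlonglongrightarrow> wind c' (pos w)"
        by (rule isCont_tendsto_compose[OF continuous_chain[OF b _ posw] s(2)]) (rule c'0)
      then have lim: "(\<lambda>n. - wind c' (s n) / c a) \<longlonglongrightarrow> ?L"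
        by (intro tendsto_divide tendsto_minus tendsto_const nz)
      have wn: "winding_number (\<gamma> a) (s n) = - wind c' (s n) / c a" for n
        using dec[of "s n"] cz s(1)[of n] nz by (auto simp: field_simps add_eq_0_iff)
      have eq: "pos (tgt a) - s n = exp (2 * pi * \<i> * (- wind c' (s n) / c a)) * (pos (src a) - s n)" for n
        using winding_number_exp_2pi[of "\<gamma> a" "s n"] s(1)[of n] arc_\<gamma>[OF a] arc_imp_path ends_\<gamma>[OF a]
        unfolding wn by auto
      have "(\<lambda>n. pos (tgt a) - s n) \<longlonglongrightarrow> pos (tgt a) - pos w"
        by (intro tendsto_intros s)
      moreover have "(\<lambda>n. pos (tgt a) - s n) \<longlonglongrightarrow> exp (2 * pi * \<i> * ?L) * (pos (src a) - pos w)"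
        unfolding eq by (intro tendsto_intros s lim)
      ultimately have "pos (tgt a) - pos w = exp (2 * pi * \<i> * ?L) * (pos (src a) - pos w)"
        by (rule LIMSEQ_unique)
      \<comment> \<open>One of the two differences is zero because \<open>w\<close> is an end of
        \<open>a\<close>; the exponential is nonzero, so the other difference is zero too.\<close>
      then have "pos (tgt a) = pos (src a)" using uw by auto
      then show False using inj_pos ends[OF a] no_loop[OF a] by (auto dest: inj_onD)
    qed
    have "wind c z = 0" if "z \<notin> ?S'" for z
      by (rule wind_zero_extend[OF b a _ _ that]) (use c0 ca cz in auto)
    then show "c x = 0"
      using IH c0 ca unfolding well_wound_def wind_injective_def by (metis insertE)
  qed
  moreover have "cycles_constant (insert w V') (insert a E')"
    unfolding cycles_constant_def img
  proof (intro allI impI)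
    fix c :: "'a \<Rightarrow> rat" assume c0: "\<forall>b. b \<notin> insert a E' \<longrightarrow> c b = 0" and cy: "\<forall>v. bdry c v = 0"
    \<comment> \<open>No arrow of \<open>E'\<close> touches \<open>w\<close>, so the boundary at
      \<open>w\<close> is the coefficient of \<open>a\<close> up to sign.\<close>
    have "bdry c w = c a * ((if tgt a = w then 1 else 0) - (if src a = w then 1 else 0))
        + (\<Sum>b\<in>E - {a}. c b * ((if tgt b = w then 1 else 0) - (if src b = w then 1 else 0)))"
      unfolding bdry_def using finE a by (simp add: sum.remove)
    also have "(\<Sum>b\<in>E - {a}. c b * ((if tgt b = w then 1 else 0) - (if src b = w then 1 else 0))) = 0"
    proof (rule sum.neutral, rule ballI)
      fix b assume b: "b \<in> E - {a}"
      show "c b * ((if tgt b = w then 1 else 0) - (if src b = w then 1 else 0)) = 0"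
      proof (cases "b \<in> E'")
        case True
        then have "tgt b \<noteq> w" "src b \<noteq> w" using sub(3) w by blast+
        then show ?thesis by simp
      qed (use c0 b in simp)
    qed
    finally have ca: "c a = 0" using cy uw no_loop[OF a] by (auto split: if_splits)
    then have "\<forall>b. b \<notin> E' \<longrightarrow> c b = 0" using c0 by auto
    then obtain h where h: "region_fun ?S' h" "\<forall>z. z \<notin> ?S' \<longrightarrow> wind (\<lambda>a. of_rat (c a)) z = of_rat (h z)"
      using IH cy unfolding well_wound_def cycles_constant_def by blast
    have "region_fun ?S h"
      using region_fun_mono[OF h(1)] by blast
    then show "\<exists>h. region_fun ?S h \<and> (\<forall>z. z \<notin> ?S \<longrightarrow> wind (\<lambda>a. of_rat (c a)) z = of_rat (h z))"
      using h(2) by blast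
  qed
  moreover have "finite (components (- ?S))"
    by (rule finite_components_refine[where S' = ?S' and \<phi> = "\<lambda>_. True"])
      (use IH cc in \<open>auto simp: well_wound_def\<close>)
  ultimately show ?thesis unfolding well_wound_def img by blast
qed

text \<open>An arc \<open>g\<close> of the old part closes the chord to a Jordan curve
  \<open>J\<close>, traversed by an integral cycle \<open>j\<close> with coefficient 1 at
  \<open>a\<close>. Subtracting a multiple of \<open>j\<close> brings a chain back to
  \<open>E'\<close>, and the winding number of \<open>J\<close> is a signed indicator of its
  inside.\<close>

lemma well_wound_chord:
  assumes b: "built V' E'" and a: "a \<in> E" and na: "a \<notin> E'" and sV: "src a \<in> V'" and tV: "tgt a \<in> V'"
    and IH: "well_wound V' E'"
  shows "well_wound V' (insert a E')"
proof -
  note sub = built_sub[OF b]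
  let ?S' = "image_of V' E'" and ?A = "path_image (\<gamma> a)"
  let ?S = "?S' \<union> ?A"
  obtain g d where gd: "chain_arc V' E' (tgt a) (src a) g d"
    using chain_arc_exists[OF b tV sV] no_loop[OF a] by metis
  have arcg: "arc g" and gS: "path_image g \<subseteq> ?S'" and d0: "\<And>b. b \<notin> E' \<Longrightarrow> d b = 0"
    and wg: "\<And>z. z \<notin> ?S' \<Longrightarrow> winding_number g z = wind (\<lambda>a. of_int (d a)) z"
    and dd: "\<And>v. bdry d v = (if src a = v then 1 else 0) - (if tgt a = v then 1 else 0)"
    and gends: "pathstart g = pathfinish (\<gamma> a)" "pathfinish g = pathstart (\<gamma> a)"
    using gd ends_\<gamma>[OF a] by (auto simp: chain_arc_def)
  define J where "J = g +++ \<gamma> a"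
  define j where "j b = d b + (if b = a then 1 else 0)" for b
  have int: "?A \<inter> ?S' = {pathstart (\<gamma> a), pathfinish (\<gamma> a)}"
    using arc_Int_image_of[OF b a na] sV tV ends_\<gamma>[OF a] by auto
  have imJ: "path_image J = path_image g \<union> ?A"
    unfolding J_def by (simp add: path_image_join gends)
  have sJ: "simple_path J" unfolding J_def
    by (rule simple_path_join_loop) (use arcg arc_\<gamma>[OF a] gends gS int in auto)
  have loop: "pathfinish J = pathstart J" unfolding J_def by (simp add: gends)
  have pathJ: "path J" using sJ simple_path_imp_path by blast
  have JS: "path_image J \<subseteq> ?S" using imJ gS by blast
  have ja: "j a = 1" using d0 na by (simp add: j_def)
  have j0: "j b = 0" if "b \<notin> insert a E'" for b using d0 that by (auto simp: j_def)
  have jcyc: "bdry j v = 0" for v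
    unfolding j_def bdry_simps dd bdry_single[OF a] by simp
  have wJ: "wind (\<lambda>b. of_int (j b)) z = winding_number J z" if "z \<notin> ?S" for z
  proof -
    have "winding_number J z = winding_number g z + winding_number (\<gamma> a) z"
      unfolding J_def
      by (rule winding_number_join) (use arcg arc_\<gamma>[OF a] arc_imp_path gends gS that in auto)
    then show ?thesis
      using wg[of z] that wind_single[OF a, of z]
      by (simp add: j_def wind_simps if_distrib[of of_int] cong: if_cong)
  qed
  note Jordan = Jordan_inside_outside[OF sJ loop]
  \<comment> \<open>The orientation of \<open>J\<close>, which depends on the embedding.\<close>
  obtain \<epsilon> :: int where eps: "\<epsilon> = 1 \<or> \<epsilon> = -1"
    and in_eps: "\<And>z. z \<in> inside (path_image J) \<Longrightarrow> winding_number J z = of_int \<epsilon>"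
  proof -
    consider "\<forall>z \<in> inside (path_image J). winding_number J z = 1" | "\<forall>z \<in> inside (path_image J). winding_number J z = -1"
      using simple_closed_path_winding_number_inside[OF sJ] loop by metis
    then show thesis
    proof cases
      case 1 then show thesis using that[of 1] by simp
    next
      case 2 then show thesis using that[of "-1"] by simp
    qed
  qed
  define hJ :: "complex \<Rightarrow> int" where "hJ z = (if z \<in> inside (path_image J) then \<epsilon> else 0)" for z
  have side: "z \<in> inside (path_image J) \<or> z \<in> outside (path_image J)" if "z \<notin> ?S" for z
    using that JS inside_Un_outside[of "path_image J"] by blast
  have disj: "z \<notin> inside (path_image J)" if "z \<in> outside (path_image J)" for z
    using that inside_Int_outside[of "path_image J"] by blast
  have whJ: "wind (\<lambda>b. of_int (j b)) z = of_int (hJ z)" if "z \<notin> ?S" for z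
  proof (cases "z \<in> inside (path_image J)")
    case True
    then show ?thesis using wJ[OF that] in_eps by (simp add: hJ_def)
  next
    case False
    then have "winding_number J z = 0"
      using side[OF that] winding_number_zero_in_outside[OF pathJ loop] by blast
    then show ?thesis using wJ[OF that] False by (simp add: hJ_def)
  qed
  have crossJ: "C \<inter> path_image J \<noteq> {}"
    if "connected C" "x \<in> C" "y \<in> C" "x \<in> inside (path_image J)" "y \<in> outside (path_image J)" for C x y
  proof
    assume "C \<inter> path_image J = {}"
    then have "C \<subseteq> inside (path_image J) \<union> outside (path_image J)"
      using inside_Un_outside[of "path_image J"] by blast
    then show False
      using connectedD[OF that(1), of "inside (path_image J)" "outside (path_image J)"] Jordan that disj by blast
  qed
  have regJ: "region_fun ?S hJ"
    unfolding region_fun_def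
  proof (intro conjI allI impI)
    fix x y assume xy: "connected_component (- ?S) x y"
    then obtain C where C: "connected C" "C \<subseteq> - ?S" "x \<in> C" "y \<in> C"
      unfolding connected_component_def by blast
    then have "x \<notin> ?S" "y \<notin> ?S" "C \<inter> path_image J = {}" using JS by blast+
    then have "x \<in> inside (path_image J) \<longleftrightarrow> y \<in> inside (path_image J)"
      using crossJ[OF C(1,3,4)] crossJ[OF C(1,4,3)] side[of x] side[of y] by blast
    then show "hJ x = hJ y" by (simp add: hJ_def)
  next
    have "bounded (inside (path_image J))" using Jordan by blast
    then obtain B where B: "\<And>x. x \<in> inside (path_image J) \<Longrightarrow> norm x \<le> B" using bounded_iff by metis
    show "\<exists>R. \<forall>z. R \<le> cmod z \<longrightarrow> hJ z = 0"
      by (rule exI[of _ "B + 1"]) (use B in \<open>force simp: hJ_def\<close>)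
  qed
  have compS': "compact ?S'" by (rule compact_image_of[OF sub(1,2)])
  have compA: "compact ?A" using a arc_\<gamma> compact_arc_image by blast
  have compS: "compact ?S" by (rule compact_Un[OF compS' compA])
  have compJ: "compact (path_image J)" using pathJ compact_path_image by blast
  have clS': "closed ?S'" by (rule compact_imp_closed[OF compS'])
  have SJ: "?S = ?S' \<union> path_image J" using imJ gS by blast
  \<comment> \<open>The chord itself meets the old image in two points, a disconnected set, so
    Janiszewski's theorem is applied to the whole curve \<open>J\<close>, which meets it in the arc
    \<open>g\<close>. The price is that \<open>x\<close> and \<open>y\<close> must lie on the same
    side of \<open>J\<close>.\<close>
  have cc: "connected_component (- ?S) x y"
    if "x \<notin> ?S" "y \<notin> ?S" "connected_component (- ?S') x y"
      "x \<in> inside (path_image J) \<longleftrightarrow> y \<in> inside (path_image J)" for x y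
    unfolding SJ
  proof (rule Janiszewski[OF compS' compact_imp_closed[OF compJ]])
    have "{pathstart (\<gamma> a), pathfinish (\<gamma> a)} \<subseteq> path_image g"
      unfolding gends[symmetric] by auto
    then have "?A \<inter> ?S' \<subseteq> path_image g" unfolding int .
    then have "?S' \<inter> path_image J = path_image g" unfolding imJ using gS by blast
    then show "connected (?S' \<inter> path_image J)" using arcg connected_arc_image by simp
    show "connected_component (- path_image J) x y"
    proof (cases "x \<in> inside (path_image J)")
      case True
      then show ?thesis unfolding connected_component_def
        using that Jordan by (intro exI[of _ "inside (path_image J)"]) (auto simp: inside_def)
    next
      case False
      then have "x \<in> outside (path_image J)" "y \<in> outside (path_image J)" using side that by blast+
      then show ?thesis unfolding connected_component_def
        using Jordan by (intro exI[of _ "outside (path_image J)"]) (auto simp: outside_def)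
    qed
  qed fact
  \<comment> \<open>The chord without its ends: connected and disjoint from the old image, so it
    lies in a single face of the smaller quiver, the only one that the chord can divide.\<close>
  define A0 where "A0 = ?A - {pathstart (\<gamma> a), pathfinish (\<gamma> a)}"
  have connA0: "connected A0" unfolding A0_def
    using connected_simple_path_endless arc_imp_simple_path arc_\<gamma>[OF a] by blast
  have A0S': "A0 \<inter> ?S' = {}" using int by (auto simp: A0_def)
  have "A0 \<noteq> {}" unfolding A0_def
    using nonempty_simple_path_endless arc_imp_simple_path arc_\<gamma>[OF a] by blast
  then obtain m where m: "m \<in> A0" by blast
  have mS': "m \<notin> ?S'" using m A0S' by blast
  \<comment> \<open>Every point of a Jordan curve is on the frontier of both sides.\<close>
  have near: "\<exists>x y. x \<in> ball m r \<and> y \<in> ball m r \<and> x \<in> inside (path_image J) \<and> y \<in> outside (path_image J)"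
    if r: "r > 0" for r
  proof -
    have "m \<in> path_image J" using m imJ by (simp add: A0_def)
    then have "m \<in> closure (inside (path_image J))" "m \<in> closure (outside (path_image J))"
      using Jordan by (metis DiffD1 frontier_def)+
    then obtain x y where "x \<in> inside (path_image J)" "dist x m < r" and "y \<in> outside (path_image J)" "dist y m < r"
      using r unfolding closure_approachable by blast
    then have "x \<in> ball m r \<and> y \<in> ball m r \<and> x \<in> inside (path_image J) \<and> y \<in> outside (path_image J)"
      by (simp add: dist_commute)
    then show ?thesis by blast
  qed
  have "open (- ?S')" "m \<in> - ?S'" using mS' clS' by (auto simp: open_Compl)
  then obtain r where r: "r > 0" "ball m r \<subseteq> - ?S'" using openE by blast
  have offS: "z \<notin> ?S" if "z \<in> ball m r" "z \<in> inside (path_image J) \<or> z \<in> outside (path_image J)" for z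
    using that r(2) SJ inside_no_overlap[of "path_image J"] outside_no_overlap[of "path_image J"] by blast
  obtain x0 x1 where x0: "x0 \<in> ball m r" "x0 \<in> inside (path_image J)"
    and x1: "x1 \<in> ball m r" "x1 \<in> outside (path_image J)"
    using near[OF r(1)] by blast
  have mcc: "connected_component (- ?S') m z" if "z \<in> ball m r" for z
    unfolding connected_component_def
    by (rule exI[of _ "ball m r"]) (use r that in auto)
  have "spans_regions V' (insert a E')"
    unfolding spans_regions_def image_of_insert
  proof (intro allI impI)
    fix h :: "complex \<Rightarrow> int" assume h: "region_fun ?S h"
    \<comment> \<open>\<open>n\<close> is the jump of \<open>h\<close> across the chord near
      \<open>m\<close>, corrected by the orientation; since
      \<open>\<epsilon> * \<epsilon> = 1\<close>, subtracting \<open>n * hJ\<close> removes that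
      jump.\<close>
    define n where "n = \<epsilon> * (h x0 - h x1)"
    define k where "k z = h z - n * hJ z" for z
    have ee: "\<epsilon> * \<epsilon> = 1" using eps by auto
    have hJx: "hJ x0 = \<epsilon>" "hJ x1 = 0" using x0 x1 disj by (auto simp: hJ_def)
    have k01: "k x0 = k x1"
    proof -
      have "k x0 = h x0 - (\<epsilon> * \<epsilon>) * (h x0 - h x1)" by (simp only: k_def n_def hJx ac_simps)
      then show ?thesis by (simp add: ee k_def hJx)
    qed
    have regk: "region_fun ?S k"
      unfolding k_def by (rule region_fun_combine[OF h regJ]) simp
    have same: "k x = k y" if "x \<notin> ?S" "y \<notin> ?S" "connected_component (- ?S') x y"
        "x \<in> inside (path_image J) \<longleftrightarrow> y \<in> inside (path_image J)" for x y
      using cc[OF that] regk unfolding region_fun_def by blast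
    \<comment> \<open>A connected set off the old image that joins the two sides must cross
      \<open>J\<close> on the open chord. Hence \<open>x\<close> and \<open>y\<close> both lie in
      the old face of \<open>m\<close>; on their own sides they compare with \<open>x0\<close> and
      \<open>x1\<close>, where \<open>k\<close> takes equal values.\<close>
    have opp: "k x = k y" if xy: "x \<notin> ?S" "y \<notin> ?S" "connected_component (- ?S') x y"
        "x \<in> inside (path_image J)" "y \<in> outside (path_image J)" for x y
    proof -
      obtain C where C: "connected C" "C \<subseteq> - ?S'" "x \<in> C" "y \<in> C"
        using xy(3) unfolding connected_component_def by blast
      obtain t where t: "t \<in> C" "t \<in> path_image J" using crossJ[OF C(1,3,4) xy(4,5)] by blast
      then have "t \<in> A0" using C(2) imJ gS int by (auto simp: A0_def)
      then have "connected_component (- ?S') t m"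
        using connA0 A0S' m unfolding connected_component_def by blast
      moreover have "connected_component (- ?S') x t" "connected_component (- ?S') t y"
        using C t unfolding connected_component_def by blast+
      ultimately have xm: "connected_component (- ?S') x m" and ym: "connected_component (- ?S') y m"
        by (meson connected_component_trans connected_component_sym)+
      have "k x = k x0"
        by (rule same) (use xy x0 offS connected_component_trans[OF xm mcc[OF x0(1)]] in auto)
      moreover have "k y = k x1"
        by (rule same) (use xy x1 offS connected_component_trans[OF ym mcc[OF x1(1)]] disj in auto)
      ultimately show ?thesis using k01 by simp
    qed
    have "k x = k y" if "x \<notin> ?S" "y \<notin> ?S" "connected_component (- ?S') x y" for x y
    proof (cases "x \<in> inside (path_image J) \<longleftrightarrow> y \<in> inside (path_image J)")
      case True then show ?thesis using same that by blast
    next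
      case False
      then show ?thesis
        using opp[OF that] opp[OF that(2,1) connected_component_sym[OF that(3)], symmetric]
          side[OF that(1)] side[OF that(2)] by blast
    qed
    then obtain k' where k': "region_fun ?S' k'" "\<And>z. z \<notin> ?S \<Longrightarrow> k' z = k z"
      using region_fun_extend[OF compS clS' _ interior_image_insert[OF b a] regk] by blast
    obtain c where c: "\<And>b. b \<notin> E' \<Longrightarrow> c b = 0" "\<And>v. bdry c v = 0"
           "\<And>z. z \<notin> ?S' \<Longrightarrow> wind (\<lambda>a. of_int (c a)) z = of_int (k' z)"
      using IH k'(1) unfolding well_wound_def spans_regions_def by blast
    show "\<exists>c. (\<forall>b. b \<notin> insert a E' \<longrightarrow> c b = 0) \<and> (\<forall>v. bdry c v = 0) \<and>
           (\<forall>z. z \<notin> ?S \<longrightarrow> wind (\<lambda>a. of_int (c a)) z = of_int (h z))"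
    proof (intro exI[of _ "\<lambda>b. c b + n * j b"] conjI allI impI)
      fix z assume z: "z \<notin> ?S"
      have "wind (\<lambda>b. of_int (c b + n * j b)) z = of_int (k z) + of_int n * of_int (hJ z)"
        using c(3)[of z] k'(2)[of z] whJ[of z] z by (simp add: wind_simps)
      then show "wind (\<lambda>b. of_int (c b + n * j b)) z = of_int (h z)" by (simp add: k_def)
    qed (use c j0 jcyc in \<open>auto simp: bdry_simps\<close>)
  qed
  moreover have "wind_injective V' (insert a E')"
    unfolding wind_injective_def image_of_insert
  proof (intro impI allI)
    fix c x
    assume c0: "\<forall>b. b \<notin> insert a E' \<longrightarrow> c b = 0" and cz: "\<forall>z. z \<notin> ?S \<longrightarrow> wind c z = 0"
    \<comment> \<open>As \<open>j a = 1\<close>, the coefficient of \<open>a\<close> cancels and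
      \<open>c'\<close> is supported on \<open>E'\<close>.\<close>
    define c' where "c' b = c b - c a * of_int (j b)" for b
    have c'0: "c' b = 0" if "b \<notin> E'" for b
      using c0 that j0[of b] ja by (cases "b = a") (auto simp: c'_def)
    have dec: "wind c' z = - (c a * of_int (hJ z))" if "z \<notin> ?S" for z
      unfolding c'_def wind_simps using cz whJ that by simp
    \<comment> \<open>Off the image \<open>wind c'\<close> is \<open>- c a * \<epsilon>\<close>
      inside \<open>J\<close> and 0 outside, a jump of size \<open>norm (c a)\<close> across the
      chord; yet \<open>wind c'\<close> is continuous at \<open>m\<close>, which is off the old
      image.\<close>
    have ca: "c a = 0"
    proof (rule ccontr)
      assume nz: "c a \<noteq> 0"
      have "isCont (wind c') m" using continuous_chain[OF b _ mS', of c'] c'0 by blast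
      moreover have "norm (c a) / 2 > 0" using nz by simp
      ultimately obtain \<delta> where del: "\<delta> > 0" "\<And>z. dist z m < \<delta> \<Longrightarrow> dist (wind c' z) (wind c' m) < norm (c a) / 2"
        unfolding continuous_at_eps_delta by blast
      obtain y0 y1 where y0: "y0 \<in> ball m (min r \<delta>)" "y0 \<in> inside (path_image J)"
        and y1: "y1 \<in> ball m (min r \<delta>)" "y1 \<in> outside (path_image J)"
        using near[of "min r \<delta>"] r(1) del(1) min_less_iff_conj by metis
      have y0': "wind c' y0 = - (c a * of_int \<epsilon>)" and y1': "wind c' y1 = 0"
        using dec[of y0] dec[of y1] offS[of y0] offS[of y1] y0 y1 disj by (auto simp: hJ_def)
      have "dist (wind c' y0) (wind c' m) < norm (c a) / 2" "dist (wind c' y1) (wind c' m) < norm (c a) / 2"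
        using del(2)[of y0] del(2)[of y1] y0 y1 by (simp_all add: dist_commute)
      then have "dist (wind c' y0) (wind c' y1) < norm (c a)"
        using dist_triangle2[of "wind c' y0" "wind c' y1" "wind c' m"] by simp
      moreover have "dist (wind c' y0) (wind c' y1) = norm (c a)"
        unfolding y0' y1' using eps by (auto simp: dist_norm)
      ultimately show False by simp
    qed
    have "wind c z = 0" if "z \<notin> ?S'" for z
      by (rule wind_zero_extend[OF b a _ _ that]) (use c0 ca cz in auto)
    then show "c x = 0"
      using IH c0 ca unfolding well_wound_def wind_injective_def by (metis insertE)
  qed
  moreover have "cycles_constant V' (insert a E')"
    unfolding cycles_constant_def image_of_insert
  proof (intro allI impI)
    fix c :: "'a \<Rightarrow> rat" assume c0: "\<forall>b. b \<notin> insert a E' \<longrightarrow> c b = 0" and cy: "\<forall>v. bdry c v = 0"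
    \<comment> \<open>The same correction by \<open>j\<close>. It keeps a cycle a cycle, and the
      removed part contributes \<open>c a * hJ\<close> to the function on faces.\<close>
    define c' where "c' b = c b - c a * of_int (j b)" for b
    have "bdry (\<lambda>b. of_int (j b) :: rat) v = of_int (bdry j v)" for v
      unfolding bdry_def of_int_sum by (intro sum.cong) auto
    then have c'b: "bdry c' v = 0" for v
      unfolding c'_def bdry_simps using cy jcyc by simp
    have c'0: "c' b = 0" if "b \<notin> E'" for b
      using c0 that j0[of b] ja by (cases "b = a") (auto simp: c'_def)
    obtain h where h: "region_fun ?S' h" "\<And>z. z \<notin> ?S' \<Longrightarrow> wind (\<lambda>a. of_rat (c' a)) z = of_rat (h z)"
      using IH c'0 c'b unfolding well_wound_def cycles_constant_def by blast
    define k where "k z = h z + c a * of_int (hJ z)" for z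
    have "region_fun ?S k"
      unfolding k_def by (rule region_fun_combine[OF region_fun_mono[OF h(1)] regJ]) auto
    moreover have "wind (\<lambda>a. of_rat (c a)) z = of_rat (k z)" if z: "z \<notin> ?S" for z
    proof -
      have "wind (\<lambda>b. of_rat (c b)) z = wind (\<lambda>b. of_rat (c' b) + of_rat (c a) * of_int (j b)) z"
        by (simp add: c'_def of_rat_diff of_rat_mult)
      also have "\<dots> = of_rat (h z) + of_rat (c a) * of_int (hJ z)"
        unfolding wind_simps using h(2)[of z] whJ[OF z] z by simp
      finally show ?thesis by (simp add: k_def of_rat_add of_rat_mult)
    qed
    ultimately show "\<exists>h. region_fun ?S h \<and> (\<forall>z. z \<notin> ?S \<longrightarrow> wind (\<lambda>a. of_rat (c a)) z = of_rat (h z))"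
      by blast
  qed
  moreover have "finite (components (- ?S))"
    by (rule finite_components_refine[where S' = ?S' and \<phi> = "\<lambda>x. x \<in> inside (path_image J)"])
      (use IH cc in \<open>auto simp: well_wound_def\<close>)
  ultimately show ?thesis unfolding well_wound_def image_of_insert by blast
qed

lemma well_wound_built: "built V' E' \<Longrightarrow> well_wound V' E'"
  by (induction rule: built.induct) (blast intro: well_wound_vertex well_wound_chord well_wound_leaf)+

section \<open>Boundary cycles of the bounded faces\<close>

definition "graph = graph_image V E pos \<gamma>"
definition "faces = bounded_faces V E pos \<gamma>"
definition "fsign = face_sign V E pos \<gamma>"

lemma wind_eq_imp_eq:
  assumes "well_wound V E" "\<And>a. a \<notin> E \<Longrightarrow> c a = 0" "\<And>a. a \<notin> E \<Longrightarrow> d a = 0"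
    and "\<And>z. z \<notin> graph \<Longrightarrow> wind c z = wind d z"
  shows "c = d"
proof
  fix a
  have "wind (\<lambda>a. c a - d a) z = 0" if "z \<notin> graph" for z
    unfolding wind_simps using assms(4)[OF that] by simp
  moreover have "wind_injective V E" using assms(1) by (simp add: well_wound_def)
  ultimately have "c a - d a = 0"
    using assms(2,3) unfolding wind_injective_def graph_def
    by (elim allE[of _ "\<lambda>a. c a - d a"]) simp
  then show "c a = d a" by simp
qed

text \<open>The integral cycle that realises minus the indicator of \<open>f\<close> satisfies the
  description, and winding numbers determine it. The third fact is not part of that description: it
  is inherited from this witness.\<close>

lemma face_sign_facts:
  assumes ww: "well_wound V E" and f: "f \<in> faces"
  shows "\<And>a. a \<notin> E \<Longrightarrow> fsign f a = 0"
    and "\<And>z. z \<notin> graph \<Longrightarrow> wind (\<lambda>a. of_int (fsign f a)) z = (if z \<in> f then -1 else 0)"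
    and "\<And>v. bdry (fsign f) v = 0"
proof -
  have fc: "f \<in> components (- graph)" and bf: "bounded f"
    using f by (auto simp: faces_def bounded_faces_def graph_def)
  \<comment> \<open>The value -1 reflects clockwise traversal as seen from inside the face.\<close>
  define h :: "complex \<Rightarrow> int" where "h z = (if z \<in> f then -1 else 0)" for z
  have "region_fun graph h"
    unfolding region_fun_def
  proof (intro conjI allI impI)
    fix x y assume xy: "connected_component (- graph) x y"
    obtain w where "f = connected_component_set (- graph) w" using fc by (rule componentsE)
    then have "x \<in> f \<longleftrightarrow> y \<in> f"
      using xy connected_component_trans connected_component_sym by fast
    then show "h x = h y" by (simp add: h_def)
  next
    obtain B where "\<And>x. x \<in> f \<Longrightarrow> norm x \<le> B" using bf bounded_iff by metis
    then show "\<exists>R. \<forall>z. R \<le> cmod z \<longrightarrow> h z = 0"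
      by (intro exI[of _ "B + 1"]) (force simp: h_def)
  qed
  then obtain c where c: "\<And>a. a \<notin> E \<Longrightarrow> c a = 0" "\<And>v. bdry c v = 0"
     "\<And>z. z \<notin> graph \<Longrightarrow> wind (\<lambda>a. of_int (c a)) z = of_int (h z)"
    using ww unfolding well_wound_def spans_regions_def graph_def by blast
  have eq: "fsign f = c"
    unfolding fsign_def face_sign_def
  proof (rule the_equality)
    show "(\<forall>a. a \<notin> E \<longrightarrow> c a = 0) \<and> (\<forall>z. z \<notin> graph_image V E pos \<gamma> \<longrightarrow>
         (\<Sum>a\<in>E. of_int (c a) * winding_number (\<gamma> a) z) = (if z \<in> f then -1 else 0))"
      using c by (simp add: wind_def graph_def h_def)
    fix c' assume c': "(\<forall>a. a \<notin> E \<longrightarrow> c' a = 0) \<and> (\<forall>z. z \<notin> graph_image V E pos \<gamma> \<longrightarrow>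
         (\<Sum>a\<in>E. of_int (c' a) * winding_number (\<gamma> a) z) = (if z \<in> f then -1 else 0))"
    have "(\<lambda>a. of_int (c' a) :: complex) = (\<lambda>a. of_int (c a))"
      by (rule wind_eq_imp_eq[OF ww]) (use c c' in \<open>auto simp: wind_def graph_def h_def\<close>)
    then show "c' = c" by (metis of_int_eq_iff ext)
  qed
  show "\<And>a. a \<notin> E \<Longrightarrow> fsign f a = 0"
    and "\<And>z. z \<notin> graph \<Longrightarrow> wind (\<lambda>a. of_int (fsign f a)) z = (if z \<in> f then -1 else 0)"
    and "\<And>v. bdry (fsign f) v = 0"
    unfolding eq using c by (auto simp: h_def)
qed

lemma finite_faces: "well_wound V E \<Longrightarrow> finite faces"
  by (simp add: well_wound_def faces_def bounded_faces_def)

lemma wind_face_combination: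
  assumes ww: "well_wound V E" and z: "z \<notin> graph"
  shows "wind (\<lambda>a. \<Sum>f\<in>faces. t f * of_int (fsign f a)) z = (\<Sum>f\<in>faces. if z \<in> f then - t f else 0)"
proof -
  have "wind (\<lambda>a. \<Sum>f\<in>faces. t f * of_int (fsign f a)) z
      = (\<Sum>f\<in>faces. t f * wind (\<lambda>a. of_int (fsign f a)) z)"
    unfolding wind_def sum_distrib_right sum_distrib_left
    by (subst sum.swap) (simp add: mult.assoc)
  also have "\<dots> = (\<Sum>f\<in>faces. if z \<in> f then - t f else 0)"
    by (intro sum.cong) (auto simp: face_sign_facts(2)[OF ww _ z])
  finally show ?thesis .
qed

lemma sum_faces_at:
  assumes "finite faces" "f \<in> faces" "z \<in> f"
  shows "(\<Sum>g\<in>faces. if z \<in> g then u g else (0::'b::comm_monoid_add)) = u f"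
proof -
  have "z \<in> g \<longleftrightarrow> g = f" if "g \<in> faces" for g
    using that assms components_nonoverlap[of f "- graph" g]
    by (auto simp: faces_def bounded_faces_def graph_def)
  then have "(\<Sum>g\<in>faces. if z \<in> g then u g else 0) = (\<Sum>g\<in>faces. if g = f then u g else 0)"
    by (intro sum.cong) auto
  then show ?thesis using assms by simp
qed

text \<open>At a point of \<open>f\<close> the winding number of the combination sees only the term
  of \<open>f\<close>, so it equals \<open>- t f\<close>.\<close>

lemma face_signs_independent:
  assumes ww: "well_wound V E" and f: "f \<in> faces"
    and z: "\<And>a. a \<in> E \<Longrightarrow> (\<Sum>f\<in>faces. t f * of_int (fsign f a)) = (0::complex)"
  shows "t f = 0"
proof -
  obtain z where z: "z \<in> f" "z \<notin> graph"
    using f in_components_nonempty in_components_subset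
    by (fastforce simp: faces_def bounded_faces_def graph_def)
  have "0 = wind (\<lambda>a. \<Sum>f\<in>faces. t f * of_int (fsign f a)) z"
    unfolding wind_def using assms(3) by simp
  also have "\<dots> = - t f"
    using wind_face_combination[OF ww z(2)] sum_faces_at[OF finite_faces[OF ww] f z(1), of "\<lambda>f. - t f"] by simp
  finally show ?thesis by simp
qed

text \<open>The coefficient of a face is minus the constant winding number of the cycle on it. Both
  chains then have the same winding numbers, zero on the unbounded component, and
  \<open>wind_injective\<close> identifies them.\<close>

lemma cycle_face_combination:
  fixes c :: "'a \<Rightarrow> rat"
  assumes ww: "well_wound V E" and cyc: "\<And>v. bdry c v = 0"
  shows "\<exists>t. \<forall>a\<in>E. c a = (\<Sum>f\<in>faces. t f * of_int (fsign f a))"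
proof -
  \<comment> \<open>Injectivity compares total functions vanishing off \<open>E\<close>, so
    \<open>c\<close> is cut off there.\<close>
  define d where "d a = (if a \<in> E then c a else 0)" for a
  have "bdry d v = 0" for v
    using cyc[of v] unfolding bdry_def d_def by (simp cong: sum.cong)
  moreover have "cycles_constant V E" using ww by (simp add: well_wound_def)
  moreover have "d a = 0" if "a \<notin> E" for a using that by (simp add: d_def)
  ultimately obtain h where h: "region_fun graph h"
     "\<And>z. z \<notin> graph \<Longrightarrow> wind (\<lambda>a. of_rat (d a)) z = of_rat (h z)"
    unfolding cycles_constant_def graph_def by blast
  define t where "t f = - h (SOME z. z \<in> f)" for f
  let ?c = "\<lambda>a. \<Sum>f\<in>faces. of_rat (t f) * of_int (fsign f a) :: complex"
  have "(\<lambda>a. of_rat (d a)) = ?c"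
  proof (rule wind_eq_imp_eq[OF ww])
    fix z assume z: "z \<notin> graph"
    define f where "f = connected_component_set (- graph) z"
    have zf: "z \<in> f" using z by (simp add: f_def)
    have fc: "f \<in> components (- graph)" using z by (auto simp: f_def components_def)
    have "wind ?c z = of_rat (h z)"
    proof (cases "bounded f")
      case True
      then have ff: "f \<in> faces" using fc by (simp add: faces_def bounded_faces_def graph_def)
      have "(SOME z. z \<in> f) \<in> f" using zf by (rule someI)
      then have "h z = h (SOME z. z \<in> f)"
        using h(1) unfolding region_fun_def f_def by blast
      moreover have "wind ?c z = - of_rat (t f)"
        unfolding wind_face_combination[OF ww z] by (rule sum_faces_at[OF finite_faces[OF ww] ff zf])
      ultimately show ?thesis by (simp add: t_def of_rat_minus)
    next
      case False
      have "z \<notin> g" if "g \<in> faces" for g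
        using that fc zf False components_nonoverlap[of f "- graph" g]
        by (auto simp: faces_def bounded_faces_def graph_def)
      then have "wind ?c z = 0" using wind_face_combination[OF ww z] by (simp cong: sum.cong)
      obtain R where R: "\<And>z. R \<le> norm z \<Longrightarrow> h z = 0" using h(1) unfolding region_fun_def by blast
      obtain y where "y \<in> f" "R \<le> norm y"
        using False unfolding bounded_iff by (meson linear)
      then have "h z = 0" using R h(1) unfolding region_fun_def f_def by (metis mem_Collect_eq)
      then show ?thesis using \<open>wind ?c z = 0\<close> by simp
    qed
    then show "wind (\<lambda>a. of_rat (d a)) z = wind ?c z" using h(2)[OF z] by simp
  qed (auto simp: d_def face_sign_facts(1)[OF ww])
  then have "of_rat (d a) = (of_rat (\<Sum>f\<in>faces. t f * of_int (fsign f a)) :: complex)" for a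
    by (simp add: of_rat_sum of_rat_mult fun_eq_iff)
  then have "d a = (\<Sum>f\<in>faces. t f * of_int (fsign f a))" for a by simp
  then show ?thesis by (intro exI[of _ t]) (metis d_def)
qed

end

subsection \<open>Cycles and coboundaries\<close>

text \<open>In the rational vector space \<open>'k\<close> the independent singleton
  \<open>{x}\<close> extends to a basis, so some functional takes the value 1 at
  \<open>x\<close>.\<close>

lemma rat_functional:
  fixes x :: "'k::field_char_0"
  assumes "x \<noteq> 0"
  obtains \<phi> :: "'k \<Rightarrow> rat" where "\<And>a b. \<phi> (a + b) = \<phi> a + \<phi> b" "\<And>q a. \<phi> (of_rat q * a) = q * \<phi> a" "\<phi> x \<noteq> 0"
proof -
  interpret vs: vector_space_pair "\<lambda>q (x::'k). of_rat q * x" "(*) :: rat \<Rightarrow> rat \<Rightarrow> rat"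
    by unfold_locales (simp_all add: algebra_simps of_rat_add of_rat_mult)
  have "vs.vs1.independent {x}" using assms by (simp add: vs.vs1.dependent_single)
  then obtain g where g: "Vector_Spaces.linear (\<lambda>q (x::'k). of_rat q * x) ((*) :: rat \<Rightarrow> rat \<Rightarrow> rat) g" "g x = 1"
    using vs.linear_independent_extend[of "{x}" "\<lambda>_. 1"] by auto
  then interpret Vector_Spaces.linear "\<lambda>q (x::'k). of_rat q * x" "(*) :: rat \<Rightarrow> rat \<Rightarrow> rat" g by simp
  show thesis using that[of g] add scale g(2) by simp
qed

text \<open>Gram-Schmidt, one vector at a time, allowing dependent families. The rationals matter: a
  vanishing sum of squares forces every entry to be zero.\<close>

lemma orthogonal_projection:
  fixes w :: "'v \<Rightarrow> 'a \<Rightarrow> rat"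
  assumes "finite S" "finite E"
  shows "\<exists>l. \<forall>v\<in>S. (\<Sum>a\<in>E. (x a - (\<Sum>u\<in>S. l u * w u a)) * w v a) = 0"
  using assms(1)
proof (induction S arbitrary: x)
  case empty
  then show ?case by simp
next
  case (insert v S)
  obtain l where l: "\<And>u. u \<in> S \<Longrightarrow> (\<Sum>a\<in>E. (x a - (\<Sum>u\<in>S. l u * w u a)) * w u a) = 0"
    using insert.IH by blast
  obtain m where m: "\<And>u. u \<in> S \<Longrightarrow> (\<Sum>a\<in>E. (w v a - (\<Sum>u\<in>S. m u * w u a)) * w u a) = 0"
    using insert.IH by blast
  define r where "r a = x a - (\<Sum>u\<in>S. l u * w u a)" for a
  define y where "y a = w v a - (\<Sum>u\<in>S. m u * w u a)" for a
  \<comment> \<open>\<open>y\<close> is the part of \<open>w v\<close> orthogonal to the earlier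
    vectors and \<open>t\<close> the coefficient of \<open>r\<close> along it. If the denominator is
    zero, \<open>y\<close> vanishes on \<open>E\<close> and every \<open>t\<close> serves.\<close>
  define t where "t = (\<Sum>a\<in>E. r a * y a) / (\<Sum>a\<in>E. y a * y a)"
  define l' where "l' u = (if u = v then t else l u - t * m u)" for u
  have res: "x a - (\<Sum>u\<in>insert v S. l' u * w u a) = r a - t * y a" for a
  proof -
    have "(\<Sum>u\<in>S. l' u * w u a) = (\<Sum>u\<in>S. l u * w u a) - t * (\<Sum>u\<in>S. m u * w u a)"
      unfolding sum_distrib_left sum_subtractf[symmetric]
      by (rule sum.cong) (use insert.hyps in \<open>auto simp: l'_def algebra_simps\<close>)
    then show ?thesis using insert.hyps by (simp add: r_def y_def l'_def algebra_simps)
  qed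
  have orthS: "(\<Sum>a\<in>E. (r a - t * y a) * w u a) = 0" if "u \<in> S" for u
  proof -
    have "(\<Sum>a\<in>E. (r a - t * y a) * w u a) = (\<Sum>a\<in>E. r a * w u a) - t * (\<Sum>a\<in>E. y a * w u a)"
      by (simp add: sum_subtractf sum_distrib_left algebra_simps)
    then show ?thesis using l[OF that] m[OF that] unfolding r_def y_def by simp
  qed
  have orthy: "(\<Sum>a\<in>E. (r a - t * y a) * y a) = 0"
  proof (cases "(\<Sum>a\<in>E. y a * y a) = 0")
    case True
    then have "y a = 0" if "a \<in> E" for a
      using that assms(2) sum_nonneg_eq_0_iff[of E "\<lambda>a. y a * y a"] by auto
    then show ?thesis by simp
  next
    case False
    have "(\<Sum>a\<in>E. (r a - t * y a) * y a) = (\<Sum>a\<in>E. r a * y a) - t * (\<Sum>a\<in>E. y a * y a)"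
      by (simp add: sum_subtractf sum_distrib_left algebra_simps)
    then show ?thesis using False by (simp add: t_def)
  qed
  have "(\<Sum>a\<in>E. (r a - t * y a) * w v a)
      = (\<Sum>a\<in>E. (r a - t * y a) * y a) + (\<Sum>a\<in>E. \<Sum>u\<in>S. m u * ((r a - t * y a) * w u a))"
  proof -
    have "z * w v a = z * y a + (\<Sum>u\<in>S. m u * (z * w u a))" for z a
    proof -
      have "w v a = y a + (\<Sum>u\<in>S. m u * w u a)" by (simp add: y_def)
      then show ?thesis by (simp add: distrib_left sum_distrib_left mult.left_commute)
    qed
    then show ?thesis by (simp only: sum.distrib)
  qed
  also have "(\<Sum>a\<in>E. \<Sum>u\<in>S. m u * ((r a - t * y a) * w u a)) = (\<Sum>u\<in>S. m u * (\<Sum>a\<in>E. (r a - t * y a) * w u a))"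
    unfolding sum_distrib_left by (rule sum.swap)
  also have "\<dots> = 0" by (rule sum.neutral) (simp add: orthS)
  finally have "(\<Sum>a\<in>E. (r a - t * y a) * w v a) = 0" using orthy by simp
  then show ?case using orthS unfolding res[symmetric] by blast
qed

context plane_quiver
begin

text \<open>Boundary and coboundary are adjoint up to sign, so cycles are orthogonal to
  coboundaries.\<close>

lemma bdry_adjoint:
  fixes x :: "'a \<Rightarrow> 'b::comm_ring_1"
  shows "(\<Sum>a\<in>E. x a * (l (src a) - l (tgt a))) = - (\<Sum>v\<in>V. l v * bdry x v)"
proof -
  have "l (src a) - l (tgt a) = - (\<Sum>v\<in>V. l v * ((if tgt a = v then 1 else 0) - (if src a = v then 1 else 0)))"
    if "a \<in> E" for a
    using ends[OF that] finV by (simp add: algebra_simps sum_subtractf if_distrib[of "\<lambda>z. _ * z"] cong: if_cong)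
  then have "(\<Sum>a\<in>E. x a * (l (src a) - l (tgt a)))
      = - (\<Sum>a\<in>E. \<Sum>v\<in>V. l v * (x a * ((if tgt a = v then 1 else 0) - (if src a = v then 1 else 0))))"
    by (simp add: sum_distrib_left sum_negf[symmetric] mult.left_commute cong: sum.cong)
  also have "\<dots> = - (\<Sum>v\<in>V. l v * bdry x v)"
    unfolding bdry_def sum_distrib_left by (subst sum.swap) simp
  finally show ?thesis .
qed

lemma bdry_face_combination:
  fixes t :: "complex set \<Rightarrow> 'b::comm_ring_1"
  assumes "well_wound V E"
  shows "bdry (\<lambda>a. \<Sum>f\<in>faces. t f * of_int (fsign f a)) v = 0"
proof -
  have *: "bdry (\<lambda>a. of_int (fsign f a) :: 'b) v = 0" if "f \<in> faces" for f
  proof -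
    have "bdry (\<lambda>a. of_int (fsign f a) :: 'b) v = of_int (bdry (fsign f) v)"
      unfolding bdry_def of_int_sum by (intro sum.cong) auto
    then show ?thesis using face_sign_facts(3)[OF assms that] by simp
  qed
  have "bdry (\<lambda>a. \<Sum>f\<in>faces. t f * of_int (fsign f a)) v = (\<Sum>f\<in>faces. t f * bdry (\<lambda>a. of_int (fsign f a)) v)"
    unfolding bdry_def sum_distrib_right sum_distrib_left
    by (subst sum.swap) (simp add: mult.assoc)
  then show ?thesis using * by simp
qed

text \<open>A rational functional that is nonzero on \<open>t f\<close> turns the relation into a
  rational vector that is both a cycle and a coboundary. It is orthogonal to itself, hence zero on
  \<open>E\<close>, and independence of the face signs gives a contradiction.\<close>

lemma face_coboundary_independent:
  fixes t :: "complex set \<Rightarrow> 'k::field_char_0"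
  assumes ww: "well_wound V E" and f: "f \<in> faces"
    and eq: "\<And>a. a \<in> E \<Longrightarrow> (\<Sum>f\<in>faces. t f * of_int (fsign f a)) = l (src a) - l (tgt a)"
  shows "t f = 0"
proof (rule ccontr)
  assume "t f \<noteq> 0"
  then obtain \<phi> :: "'k \<Rightarrow> rat" where add: "\<And>a b. \<phi> (a + b) = \<phi> a + \<phi> b"
    and scale: "\<And>q a. \<phi> (of_rat q * a) = q * \<phi> a" and nz: "\<phi> (t f) \<noteq> 0"
    using rat_functional by blast
  have zero: "\<phi> 0 = 0" using scale[of 0 0] by simp
  have sub: "\<phi> (a - b) = \<phi> a - \<phi> b" for a b using add[of "a - b" b] by simp
  have psum: "\<phi> (\<Sum>f\<in>A. g f) = (\<Sum>f\<in>A. \<phi> (g f))" for A :: "complex set set" and g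
    by (induction A rule: infinite_finite_induct) (simp_all add: zero add)
  have pint: "\<phi> (x * of_int n) = \<phi> x * of_int n" for x n
    using scale[of "of_int n" x] by (simp add: mult.commute)
  define x where "x a = (\<Sum>f\<in>faces. \<phi> (t f) * of_int (fsign f a))" for a
  have xl: "x a = \<phi> (l (src a)) - \<phi> (l (tgt a))" if "a \<in> E" for a
    using arg_cong[OF eq[OF that], of \<phi>] by (simp add: x_def psum pint sub)
  have bx: "bdry x v = 0" for v
    using bdry_face_combination[OF ww, of "\<lambda>f. \<phi> (t f)" v] unfolding x_def[symmetric] .
  have "(\<Sum>a\<in>E. x a * x a) = (\<Sum>a\<in>E. x a * (\<phi> (l (src a)) - \<phi> (l (tgt a))))"
    by (simp add: xl cong: sum.cong)
  also have "\<dots> = 0"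
    unfolding bdry_adjoint[of x "\<lambda>v. \<phi> (l v)"] bx by simp
  finally have x0: "x a = 0" if "a \<in> E" for a
    using that finE sum_nonneg_eq_0_iff[of E "\<lambda>a. x a * x a"] by auto
  have "of_rat (\<phi> (t f)) = (0::complex)"
  proof (rule face_signs_independent[OF ww f, where t = "\<lambda>f. of_rat (\<phi> (t f))"])
    fix a assume "a \<in> E"
    from arg_cong[OF x0[OF this], of "of_rat :: rat \<Rightarrow> complex"]
    show "(\<Sum>f\<in>faces. of_rat (\<phi> (t f)) * of_int (fsign f a)) = (0::complex)"
      by (simp add: x_def of_rat_sum of_rat_mult)
  qed
  then show False using nz by simp
qed

text \<open>\<open>w v\<close> is the coboundary of the indicator of \<open>v\<close>, so being
  orthogonal to all of them means being a cycle; the residual of the projection is then a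
  combination of faces.\<close>

lemma rat_face_coboundary_span:
  fixes x :: "'a \<Rightarrow> rat"
  assumes ww: "well_wound V E"
  shows "\<exists>t l. \<forall>a\<in>E. x a = (\<Sum>f\<in>faces. t f * of_int (fsign f a)) + (l (src a) - l (tgt a))"
proof -
  define w :: "'v \<Rightarrow> 'a \<Rightarrow> rat" where "w v a = (if src a = v then 1 else 0) - (if tgt a = v then 1 else 0)" for v a
  obtain l where l: "\<And>v. v \<in> V \<Longrightarrow> (\<Sum>a\<in>E. (x a - (\<Sum>u\<in>V. l u * w u a)) * w v a) = 0"
    using orthogonal_projection[OF finV finE, of x w] by blast
  define c where "c a = x a - (l (src a) - l (tgt a))" for a
  have lw: "(\<Sum>u\<in>V. l u * w u a) = l (src a) - l (tgt a)" if "a \<in> E" for a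
    using ends[OF that] finV by (simp add: w_def algebra_simps sum_subtractf if_distrib[of "\<lambda>z. _ * z"] cong: if_cong)
  have "bdry c v = 0" for v
  proof (cases "v \<in> V")
    case True
    have "bdry c v = - (\<Sum>a\<in>E. (x a - (\<Sum>u\<in>V. l u * w u a)) * w v a)"
      unfolding bdry_def sum_negf[symmetric]
    proof (rule sum.cong)
      fix a assume "a \<in> E"
      have "w v a = - ((if tgt a = v then 1 else 0) - (if src a = v then 1 else 0))" by (simp add: w_def)
      then show "c a * ((if tgt a = v then 1 else 0) - (if src a = v then 1 else 0))
          = - ((x a - (\<Sum>u\<in>V. l u * w u a)) * w v a)"
        unfolding lw[OF \<open>a \<in> E\<close>] c_def by simp
    qed simp
    then show ?thesis using l[OF True] by simp
  next
    case False
    then show ?thesis unfolding bdry_def by (intro sum.neutral) (use ends in auto)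
  qed
  then obtain t where "\<forall>a\<in>E. c a = (\<Sum>f\<in>faces. t f * of_int (fsign f a))"
    using cycle_face_combination[OF ww] by blast
  moreover have "x a = c a + (l (src a) - l (tgt a))" for a by (simp add: c_def)
  ultimately show ?thesis by (intro exI[of _ t] exI[of _ l]) metis
qed

text \<open>Each unit vector has a rational solution; these are cast into \<open>'k\<close> and
  combined with the entries of \<open>x\<close> as coefficients.\<close>

lemma face_coboundary_span:
  fixes x :: "'a \<Rightarrow> 'k::field_char_0"
  assumes ww: "well_wound V E"
  shows "\<exists>t l. \<forall>a\<in>E. x a = (\<Sum>f\<in>faces. t f * of_int (fsign f a)) + (l (src a) - l (tgt a))"
proof -
  have "\<forall>b. \<exists>t l. \<forall>a\<in>E. (if a = b then 1 else 0 :: rat) = (\<Sum>f\<in>faces. t f * of_int (fsign f a)) + (l (src a) - l (tgt a))"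
    using rat_face_coboundary_span[OF ww] by (intro allI)
  then obtain t l where tl: "\<And>b a. a \<in> E \<Longrightarrow> (if a = b then 1 else 0 :: rat)
      = (\<Sum>f\<in>faces. t b f * of_int (fsign f a)) + (l b (src a) - l b (tgt a))"
    by metis
  have tlk: "(if a = b then 1 else 0 :: 'k)
      = (\<Sum>f\<in>faces. of_rat (t b f) * of_int (fsign f a)) + (of_rat (l b (src a)) - of_rat (l b (tgt a)))"
    if "a \<in> E" for a b
    using arg_cong[OF tl[OF that, of b], of "of_rat :: rat \<Rightarrow> 'k"]
    by (simp add: of_rat_add of_rat_diff of_rat_sum of_rat_mult split: if_splits)
  define T where "T f = (\<Sum>b\<in>E. x b * of_rat (t b f))" for f
  define L where "L v = (\<Sum>b\<in>E. x b * of_rat (l b v))" for v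
  have "x a = (\<Sum>f\<in>faces. T f * of_int (fsign f a)) + (L (src a) - L (tgt a))" if a: "a \<in> E" for a
  proof -
    have "x a = (\<Sum>b\<in>E. x b * (if a = b then 1 else 0))"
      using a finE by (simp add: if_distrib[of "\<lambda>z. _ * z"] cong: if_cong)
    also have "\<dots> = (\<Sum>b\<in>E. (\<Sum>f\<in>faces. x b * of_rat (t b f) * of_int (fsign f a))
        + (x b * of_rat (l b (src a)) - x b * of_rat (l b (tgt a))))"
      unfolding tlk[OF a] by (simp add: algebra_simps sum_distrib_left)
    also have "\<dots> = (\<Sum>f\<in>faces. T f * of_int (fsign f a)) + (L (src a) - L (tgt a))"
      unfolding sum.distrib sum_subtractf T_def L_def sum_distrib_right
      by (subst sum.swap) simp
    finally show ?thesis .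
  qed
  then show ?thesis by blast
qed

end

subsection \<open>The path algebra\<close>

lemma sum_fun_apply: "(\<Sum>i\<in>S. f i) x = (\<Sum>i\<in>S. f i x)" for f :: "'i \<Rightarrow> 'b \<Rightarrow> 'c::comm_monoid_add"
  by (induction S rule: infinite_finite_induct) auto

text \<open>Induction rules produce eta-expanded goals, in which these rules would unfold sums of functions.\<close>

lemmas fun_apply = plus_fun_apply zero_fun_apply minus_apply uminus_apply
declare fun_apply [simp del]

lemma padd_eq: "padd x y = x + y" by (simp add: padd_def plus_fun_def)
lemma psub_eq: "psub x y = x - y" by (simp add: psub_def fun_diff_def)
lemma zero_fun_eq: "(\<lambda>_. 0) = (0 :: 'b \<Rightarrow> 'c::zero)" by (simp add: zero_fun_def)
lemmas fun_op_eq = padd_eq psub_eq zero_fun_eq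

lemma pscale_simps:
  "pscale c (x + y) = pscale c x + pscale c y"
  "pscale c (x - y) = pscale c x - pscale c y"
  "pscale (c + d) x = pscale c x + pscale d x"
  "pscale (c - d) x = pscale c x - pscale d x"
  "pscale c (pscale d x) = pscale (c * d) x"
  "pscale 0 x = 0" "pscale c 0 = 0" "pscale 1 x = x" "pscale (-1) x = - x"
  by (auto simp: pscale_def fun_eq_iff fun_apply algebra_simps)

lemma pscale_sum: "pscale c (\<Sum>i\<in>S. f i) = (\<Sum>i\<in>S. pscale c (f i))"
  by (auto simp: pscale_def fun_eq_iff sum_fun_apply sum_distrib_left)

lemma sum_pscale: "(\<Sum>i\<in>S. pscale (c i) x) = pscale (\<Sum>i\<in>S. c i) x"
  by (auto simp: pscale_def fun_eq_iff sum_fun_apply sum_distrib_right)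

locale path_algebra =
  fixes V :: "'v set" and E :: "'a set" and src tgt :: "'a \<Rightarrow> 'v"
  assumes finV: "finite V" and finE: "finite E"
    and ends: "\<And>a. a \<in> E \<Longrightarrow> src a \<in> V" "\<And>a. a \<in> E \<Longrightarrow> tgt a \<in> V"
begin

abbreviation "qpath \<equiv> is_path V E src tgt"
abbreviation "hv \<equiv> path_h tgt"
abbreviation vert :: "'v \<Rightarrow> ('v,'a) qpath \<Rightarrow> 'k::field" where "vert v \<equiv> pelem (v, [])"
abbreviation arr :: "'a \<Rightarrow> ('v,'a) qpath \<Rightarrow> 'k::field" where "arr a \<equiv> pelem (arrow_path src a)"
abbreviation alg :: "(('v,'a) qpath \<Rightarrow> 'k::field) set" where "alg \<equiv> PA V E src tgt"
abbreviation mul :: "(('v,'a) qpath \<Rightarrow> 'k::field) \<Rightarrow> (('v,'a) qpath \<Rightarrow> 'k) \<Rightarrow> (('v,'a) qpath \<Rightarrow> 'k)" (infixl "\<odot>" 70)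
  where "x \<odot> y \<equiv> pmult V E src tgt x y"

lemma qpath_Nil [simp]: "qpath (v, []) \<longleftrightarrow> v \<in> V"
  by (simp add: is_path_def)

lemma qpath_Cons [simp]: "qpath (v, a # as) \<longleftrightarrow> a \<in> E \<and> src a = v \<and> qpath (tgt a, as)"
proof (cases as)
  case Nil
  then show ?thesis using ends by (auto simp: is_path_def)
next
  case (Cons b bs)
  have "(\<forall>i. Suc i < length (a # as) \<longrightarrow> tgt ((a # as) ! i) = src ((a # as) ! Suc i)) \<longleftrightarrow>
      tgt a = src b \<and> (\<forall>i. Suc i < length as \<longrightarrow> tgt (as ! i) = src (as ! Suc i))" (is "?l \<longleftrightarrow> ?r")
  proof
    assume ?l
    then show ?r using Cons by force
  next
    assume r: ?r
    show ?l
    proof (intro allI impI)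
      fix i assume "Suc i < length (a # as)"
      then show "tgt ((a # as) ! i) = src ((a # as) ! Suc i)"
        using r Cons by (cases i) auto
    qed
  qed
  then show ?thesis using ends Cons by (auto simp: is_path_def)
qed

lemma hv_simps [simp]: "hv (v, []) = v" "hv (v, a # as) = hv (tgt a, as)"
  by (auto simp: path_h_def)

lemma hv_append: "hv (v, xs @ ys) = hv (hv (v, xs), ys)"
  by (induction xs arbitrary: v) auto

lemma qpath_append: "qpath (v, xs @ ys) \<longleftrightarrow> qpath (v, xs) \<and> qpath (hv (v, xs), ys)"
proof (induction xs arbitrary: v)
  case Nil
  then show ?case by (auto simp: is_path_def)
qed auto

lemma hv_in: "qpath p \<Longrightarrow> hv p \<in> V"
proof -
  have "qpath (v, xs) \<Longrightarrow> hv (v, xs) \<in> V" for v xs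
    by (induction xs arbitrary: v) auto
  then show "qpath p \<Longrightarrow> hv p \<in> V" by (metis surj_pair)
qed

lemma qpath_arrow [simp]: "a \<in> E \<Longrightarrow> qpath (arrow_path src a)"
  using ends by (simp add: arrow_path_def)

lemma arrow_path_ends [simp]: "fst (arrow_path src a) = src a" "hv (arrow_path src a) = tgt a"
  "snd (arrow_path src a) = [a]"
  by (simp_all add: arrow_path_def)

lemma alg_closed [intro, simp]:
  "0 \<in> alg" "x \<in> alg \<Longrightarrow> y \<in> alg \<Longrightarrow> x + y \<in> alg" "x \<in> alg \<Longrightarrow> pscale c x \<in> alg"
  "qpath p \<Longrightarrow> pelem p \<in> alg"
proof -
  show "0 \<in> alg" by (simp add: PA_def fun_apply)
  show "x + y \<in> alg" if "x \<in> alg" "y \<in> alg"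
  proof -
    have "{p. (x + y) p \<noteq> 0} \<subseteq> {p. x p \<noteq> 0} \<union> {p. y p \<noteq> 0}" by (auto simp: fun_apply)
    then have "finite {p. (x + y) p \<noteq> 0}" using that finite_subset by (fastforce simp: PA_def)
    then show ?thesis using that by (auto simp: PA_def fun_apply) (metis add.right_neutral)
  qed
  show "pscale c x \<in> alg" if "x \<in> alg"
  proof -
    have "{p. pscale c x p \<noteq> 0} \<subseteq> {p. x p \<noteq> 0}" by (auto simp: pscale_def)
    then have "finite {p. pscale c x p \<noteq> 0}" using that finite_subset by (fastforce simp: PA_def)
    then show ?thesis using that by (auto simp: PA_def pscale_def)
  qed
  show "pelem p \<in> alg" if "qpath p"
    using that by (auto simp: PA_def pelem_def)
qed

lemma alg_minus [intro, simp]: "x \<in> alg \<Longrightarrow> y \<in> alg \<Longrightarrow> x - y \<in> alg"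
  using alg_closed(2)[of x "pscale (-1) y"] alg_closed(3)[of y "-1"] by (simp add: pscale_simps)

lemma alg_sum [intro]: "(\<And>i. i \<in> S \<Longrightarrow> f i \<in> alg) \<Longrightarrow> (\<Sum>i\<in>S. f i) \<in> alg"
  by (induction S rule: infinite_finite_induct) auto

lemma alg_expand:
  assumes "finite S" "{p. x p \<noteq> 0} \<subseteq> S"
  shows "x = (\<Sum>p\<in>S. pscale (x p) (pelem p))"
proof
  fix q
  have "(\<Sum>p\<in>S. x p * pelem p q) = (\<Sum>p\<in>S. if p = q then x q else 0)"
    by (rule sum.cong) (auto simp: pelem_def)
  also have "\<dots> = x q" using assms by (auto simp: sum.delta)
  finally show "x q = (\<Sum>p\<in>S. pscale (x p) (pelem p)) q"
    by (simp add: sum_fun_apply pscale_def)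
qed

text \<open>Adds one scaled path at a time; identities that are linear in each argument thereby
  reduce to paths.\<close>

lemma alg_induct [consumes 1, case_names zero step]:
  fixes x :: "('v,'a) qpath \<Rightarrow> 'k::field"
  assumes "x \<in> alg" and "P 0"
    and "\<And>x c p. x \<in> alg \<Longrightarrow> P x \<Longrightarrow> qpath p \<Longrightarrow> P (x + pscale c (pelem p))"
  shows "P x"
proof -
  have "(\<Sum>p\<in>S. pscale (x p) (pelem p)) \<in> alg \<and> P (\<Sum>p\<in>S. pscale (x p) (pelem p))"
    if "finite S" "\<And>p. p \<in> S \<Longrightarrow> qpath p" for S
    using that
  proof (induction S)
    case empty
    then show ?case using assms(2) by simp
  next
    case (insert p S)
    then have "P ((\<Sum>p\<in>S. pscale (x p) (pelem p)) + pscale (x p) (pelem p))"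
      by (intro assms(3)) auto
    then show ?case using insert by (simp add: add.commute)
  qed
  moreover have "finite {p. x p \<noteq> 0}" "\<And>p. x p \<noteq> 0 \<Longrightarrow> qpath p" using assms(1) by (auto simp: PA_def)
  ultimately have "P (\<Sum>p\<in>{p. x p \<noteq> 0}. pscale (x p) (pelem p))" by blast
  then show ?thesis by (subst alg_expand[of "{p. x p \<noteq> 0}" x]) (use \<open>finite {p. x p \<noteq> 0}\<close> in auto)
qed

lemma mul_linear:
  "(x + y) \<odot> z = x \<odot> z + y \<odot> z" "z \<odot> (x + y) = z \<odot> x + z \<odot> y"
  "(x - y) \<odot> z = x \<odot> z - y \<odot> z" "z \<odot> (x - y) = z \<odot> x - z \<odot> y"
  "pscale c x \<odot> z = pscale c (x \<odot> z)" "z \<odot> pscale c x = pscale c (z \<odot> x)"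
  "0 \<odot> z = 0" "z \<odot> 0 = 0"
  by (auto simp: pmult_def fun_eq_iff fun_apply pscale_def algebra_simps sum.distrib sum_subtractf sum_distrib_left)

lemma mul_sum: "(\<Sum>i\<in>S. f i) \<odot> z = (\<Sum>i\<in>S. f i \<odot> z)" "z \<odot> (\<Sum>i\<in>S. f i) = (\<Sum>i\<in>S. z \<odot> f i)"
  by (induction S rule: infinite_finite_induct) (auto simp: mul_linear)

lemma mul_paths:
  assumes p: "qpath p" and q: "qpath q"
  shows "pelem p \<odot> pelem q = (if hv p = fst q then pelem (fst p, snd p @ snd q) else (0 :: _ \<Rightarrow> 'k::field))"
proof
  fix w
  \<comment> \<open>Only the splitting of \<open>w\<close> after \<open>i0\<close> arrows can
    contribute to the convolution sum.\<close>
  define i0 where "i0 = length (snd p)"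
  show "(pelem p \<odot> pelem q) w = (if hv p = fst q then pelem (fst p, snd p @ snd q) else (0 :: _ \<Rightarrow> 'k)) w"
  proof (cases "qpath w \<and> hv p = fst q \<and> w = (fst p, snd p @ snd q)")
    case True
    have summand: "pelem p (fst w, take i (snd w)) * pelem q (hv (fst w, take i (snd w)), drop i (snd w))
       = (if i = i0 then 1 else 0 :: 'k)" if "i \<le> length (snd w)" for i
    proof (cases "i = i0")
      case True
      then show ?thesis using \<open>qpath w \<and> hv p = fst q \<and> w = (fst p, snd p @ snd q)\<close>
        by (auto simp: pelem_def i0_def)
    next
      case False
      then have "length (take i (snd w)) \<noteq> length (snd p)" using that by (simp add: i0_def)
      then have "(fst w, take i (snd w)) \<noteq> p" by (metis snd_conv)
      then show ?thesis using False by (simp add: pelem_def)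
    qed
    have "i0 \<le> length (snd w)" using True by (simp add: i0_def)
    have "(pelem p \<odot> (pelem q :: _ \<Rightarrow> 'k)) w = (\<Sum>i\<in>{0..length (snd w)}. if i = i0 then 1 else 0 :: 'k)"
      unfolding pmult_def using True summand by (auto intro!: sum.cong)
    also have "\<dots> = 1" using \<open>i0 \<le> length (snd w)\<close> by simp
    finally have "(pelem p \<odot> pelem q) w = (1::'k)" .
    moreover have "pelem (fst p, snd p @ snd q) w = (1::'k)" using True by (simp add: pelem_def)
    ultimately show ?thesis using True by simp
  next
    case False
    have "pelem p (fst w, take i (snd w)) * pelem q (hv (fst w, take i (snd w)), drop i (snd w)) = (0::'k)"
      if w: "qpath w" for i
    proof (rule ccontr)
      assume "\<not> ?thesis"
      then have pw: "p = (fst w, take i (snd w))" and qw: "q = (hv (fst w, take i (snd w)), drop i (snd w))"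
        by (auto simp: pelem_def split: if_splits)
      have "hv p = fst q" using pw qw by (metis fst_conv)
      moreover have "w = (fst p, snd p @ snd q)" using pw qw by simp
      ultimately show False using False w by blast
    qed
    then have "(pelem p \<odot> pelem q) w = (0::'k)" unfolding pmult_def by (auto intro!: sum.neutral)
    moreover have "(if hv p = fst q then pelem (fst p, snd p @ snd q) else 0) w = (0::'k)"
    proof (cases "hv p = fst q")
      case True
      have "qpath (fst p, snd p @ snd q)"
        using p q True by (simp add: qpath_append)
      then have "w \<noteq> (fst p, snd p @ snd q)" using False True by blast
      then show ?thesis using True by (simp add: pelem_def)
    qed (simp add: fun_apply)
    ultimately show ?thesis by simp
  qed
qed

lemma qpath_concat: "qpath p \<Longrightarrow> qpath q \<Longrightarrow> hv p = fst q \<Longrightarrow> qpath (fst p, snd p @ snd q)"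
  by (simp add: qpath_append)

lemma mul_vert:
  assumes "qpath p" "v \<in> V"
  shows "pelem p \<odot> vert v = (if hv p = v then pelem p else 0)"
    "vert v \<odot> pelem p = (if fst p = v then pelem p else 0)"
  using assms by (auto simp: mul_paths)

lemma alg_mul [intro, simp]:
  fixes x :: "('v,'a) qpath \<Rightarrow> 'k::field"
  assumes "x \<in> alg" "y \<in> alg"
  shows "x \<odot> y \<in> alg"
  using assms(1)
proof (induction rule: alg_induct)
  case zero
  then show ?case by (simp add: mul_linear)
next
  case (step x c p)
  from assms(2) have "pelem p \<odot> y \<in> alg"
  proof (induction rule: alg_induct)
    case (step y d q)
    have "pelem p \<odot> (pelem q :: _ \<Rightarrow> 'k) \<in> alg"
      using \<open>qpath q\<close> \<open>qpath p\<close> by (simp add: mul_paths qpath_concat)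
    then show ?case using step by (simp add: mul_linear)
  qed (simp add: mul_linear)
  then show ?case using step by (simp add: mul_linear)
qed

lemma mul_assoc:
  fixes x y z :: "('v,'a) qpath \<Rightarrow> 'k::field"
  assumes "x \<in> alg" "y \<in> alg" "z \<in> alg"
  shows "x \<odot> y \<odot> z = x \<odot> (y \<odot> z)"
  using assms(1)
proof (induction rule: alg_induct)
  case (step x c p)
  from assms(2) have "pelem p \<odot> y \<odot> z = pelem p \<odot> (y \<odot> z)"
  proof (induction rule: alg_induct)
    case (step y d q)
    from assms(3) have "pelem p \<odot> pelem q \<odot> z = pelem p \<odot> (pelem q \<odot> z)"
    proof (induction rule: alg_induct)
      case (step z e r)
      have "pelem p \<odot> pelem q \<odot> pelem r = pelem p \<odot> (pelem q \<odot> (pelem r :: _ \<Rightarrow> 'k))"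
        using \<open>qpath p\<close> \<open>qpath q\<close> \<open>qpath r\<close>
        by (auto simp: mul_paths qpath_concat mul_linear hv_append)
      then show ?case using step by (simp add: mul_linear)
    qed (simp add: mul_linear)
    then show ?case using step by (simp add: mul_linear)
  qed (simp add: mul_linear)
  then show ?case using step by (simp add: mul_linear)
qed (simp add: mul_linear)

lemma mul_unit:
  fixes x :: "('v,'a) qpath \<Rightarrow> 'k::field"
  assumes "x \<in> alg"
  shows "x \<odot> (\<Sum>v\<in>V. vert v) = x"
  using assms
proof (induction rule: alg_induct)
  case (step x c p)
  have "pelem p \<odot> (\<Sum>v\<in>V. vert v) = (\<Sum>v\<in>V. if hv p = v then pelem p else (0 :: _ \<Rightarrow> 'k))"
    unfolding mul_sum by (rule sum.cong) (auto simp: mul_vert step)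
  also have "\<dots> = pelem p" using finV hv_in[OF \<open>qpath p\<close>] by simp
  finally show ?case using step by (simp add: mul_linear)
qed (simp add: mul_linear)

section \<open>Extending values on arrows to a derivation\<close>

definition lin_ext :: "(('v,'a) qpath \<Rightarrow> ('v,'a) qpath \<Rightarrow> 'k::field) \<Rightarrow> (('v,'a) qpath \<Rightarrow> 'k) \<Rightarrow> (('v,'a) qpath \<Rightarrow> 'k)" where
  "lin_ext f x = (\<Sum>p\<in>{p. x p \<noteq> 0}. pscale (x p) (f p))"

lemma lin_ext_superset:
  assumes "finite S" "{p. x p \<noteq> 0} \<subseteq> S"
  shows "lin_ext f x = (\<Sum>p\<in>S. pscale (x p) (f p))"
  unfolding lin_ext_def
  by (rule sum.mono_neutral_left) (use assms in \<open>auto simp: pscale_simps\<close>)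

lemma lin_ext_add:
  assumes "x \<in> alg" "y \<in> alg"
  shows "lin_ext f (x + y) = lin_ext f x + lin_ext f y"
proof -
  let ?S = "{p. x p \<noteq> 0} \<union> {p. y p \<noteq> 0}"
  have S: "finite ?S" using assms by (simp add: PA_def)
  have *: "lin_ext f u = (\<Sum>p\<in>?S. pscale (u p) (f p))" if "{p. u p \<noteq> 0} \<subseteq> ?S" for u
    by (rule lin_ext_superset[OF S that])
  have "lin_ext f (x + y) = (\<Sum>p\<in>?S. pscale ((x + y) p) (f p))" by (rule *) (auto simp: fun_apply)
  also have "\<dots> = lin_ext f x + lin_ext f y"
    unfolding *[of x, simplified] *[of y, simplified] by (simp add: pscale_simps sum.distrib fun_apply)
  finally show ?thesis .
qed

lemma lin_ext_scale:
  assumes "x \<in> alg"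
  shows "lin_ext f (pscale c x) = pscale c (lin_ext f x)"
proof -
  have S: "finite {p. x p \<noteq> 0}" using assms by (simp add: PA_def)
  have "lin_ext f (pscale c x) = (\<Sum>p\<in>{p. x p \<noteq> 0}. pscale (pscale c x p) (f p))"
    by (rule lin_ext_superset[OF S]) (auto simp: pscale_def)
  then show ?thesis unfolding lin_ext_def pscale_sum pscale_simps by (simp add: pscale_def)
qed

lemma lin_ext_pelem: "lin_ext f (pelem p) = f p"
proof -
  have "lin_ext f (pelem p) = (\<Sum>q\<in>{p}. pscale (pelem p q) (f q))"
    by (rule lin_ext_superset) (auto simp: pelem_def)
  then show ?thesis by (simp add: pelem_def pscale_simps)
qed

lemma lin_ext_zero: "lin_ext f 0 = 0" by (simp add: lin_ext_def fun_apply)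

text \<open>The Leibniz rule unrolled along a path: each arrow in turn is replaced by its value
  under \<open>g\<close>. Trivial paths go to 0.\<close>

fun deriv_list :: "('a \<Rightarrow> ('v,'a) qpath \<Rightarrow> 'k::field) \<Rightarrow> 'a list \<Rightarrow> ('v,'a) qpath \<Rightarrow> 'k" where
  "deriv_list g [] = 0"
| "deriv_list g (a # as) = g a \<odot> pelem (tgt a, as) + arr a \<odot> deriv_list g as"

definition deriv_ext :: "('a \<Rightarrow> ('v,'a) qpath \<Rightarrow> 'k::field) \<Rightarrow> ('v,'a,'k) op" where
  "deriv_ext g = lin_ext (\<lambda>p. deriv_list g (snd p))"

context
  fixes g :: "'a \<Rightarrow> ('v,'a) qpath \<Rightarrow> 'k::field"
  assumes g_alg: "\<And>a. a \<in> E \<Longrightarrow> g a \<in> alg"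
    and g_src: "\<And>a. a \<in> E \<Longrightarrow> vert (src a) \<odot> g a = g a"
    and g_tgt: "\<And>a. a \<in> E \<Longrightarrow> g a \<odot> vert (tgt a) = g a"
begin

lemma deriv_list_alg: "qpath (v, as) \<Longrightarrow> deriv_list g as \<in> alg"
  by (induction as arbitrary: v) (auto intro!: alg_closed alg_mul g_alg)

text \<open>The derivative of a path stays between the ends of that path, because every
  \<open>g a\<close> is parallel to \<open>a\<close>. This makes the Leibniz rule survive on
  products that are zero.\<close>

lemma deriv_list_src: "qpath (v, as) \<Longrightarrow> vert v \<odot> deriv_list g as = deriv_list g as"
proof (cases as)
  case (Cons a bs)
  assume "qpath (v, as)"
  then have a: "a \<in> E" "src a = v" "qpath (tgt a, bs)" using Cons by auto
  have "vert v \<odot> (g a \<odot> pelem (tgt a, bs)) = g a \<odot> pelem (tgt a, bs)"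
    using a g_src[OF a(1)] g_alg[OF a(1)] ends[OF a(1)] by (simp flip: mul_assoc)
  moreover have "vert v \<odot> (arr a \<odot> deriv_list g bs) = arr a \<odot> deriv_list g bs"
    using a deriv_list_alg[OF a(3)] ends[OF a(1)] by (simp add: mul_vert flip: mul_assoc)
  ultimately show ?thesis by (simp add: Cons mul_linear)
qed (simp add: mul_linear)

lemma deriv_list_tgt: "qpath (v, as) \<Longrightarrow> deriv_list g as \<odot> vert (hv (v, as)) = deriv_list g as"
proof (induction as arbitrary: v)
  case (Cons a bs)
  then have a: "a \<in> E" "src a = v" "qpath (tgt a, bs)" by auto
  let ?w = "hv (tgt a, bs)"
  have w: "?w \<in> V" using hv_in a by blast
  have "g a \<odot> pelem (tgt a, bs) \<odot> vert ?w = g a \<odot> pelem (tgt a, bs)"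
    using a w g_alg[OF a(1)] by (simp add: mul_assoc mul_vert)
  moreover have "arr a \<odot> deriv_list g bs \<odot> vert ?w = arr a \<odot> deriv_list g bs"
    using a w deriv_list_alg[OF a(3)] Cons.IH[OF a(3)] by (simp add: mul_assoc)
  ultimately show ?case by (simp add: mul_linear)
qed (simp add: mul_linear)

lemma deriv_list_append:
  assumes "qpath (v, xs)" "qpath (hv (v, xs), ys)"
  shows "deriv_list g (xs @ ys) = deriv_list g xs \<odot> pelem (hv (v, xs), ys) + pelem (v, xs) \<odot> deriv_list g ys"
  using assms
proof (induction xs arbitrary: v)
  case Nil
  then show ?case using deriv_list_src by (simp add: mul_linear)
next
  case (Cons a xs)
  then have a: "a \<in> E" "src a = v" "qpath (tgt a, xs)" "qpath (hv (tgt a, xs), ys)" by auto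
  let ?w = "hv (tgt a, xs)"
  have split: "pelem (tgt a, xs @ ys) = pelem (tgt a, xs) \<odot> (pelem (?w, ys) :: _ \<Rightarrow> 'k)"
    using a by (simp add: mul_paths)
  have cons: "pelem (v, a # xs) = arr a \<odot> (pelem (tgt a, xs) :: _ \<Rightarrow> 'k)"
    using a by (simp add: mul_paths)
  show ?case
    using a g_alg[OF a(1)] deriv_list_alg[OF a(3)] deriv_list_alg[OF a(4)]
    by (simp add: Cons.IH[OF a(3,4)] split cons mul_linear mul_assoc)
qed

lemma deriv_ext_alg: "x \<in> alg \<Longrightarrow> deriv_ext g x \<in> alg"
proof -
  assume "x \<in> alg"
  then have "qpath p" if "x p \<noteq> 0" for p using that unfolding PA_def by blast
  then have "deriv_list g (snd p) \<in> alg" if "x p \<noteq> 0" for p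
    using that deriv_list_alg[of "fst p" "snd p"] by simp
  then show ?thesis unfolding deriv_ext_def lin_ext_def by (intro alg_sum alg_closed) simp
qed

text \<open>If the paths do not concatenate, inserting the idempotents of their ends makes both
  Leibniz terms zero, to match the zero product.\<close>

lemma deriv_ext_paths:
  assumes "qpath p" "qpath q"
  shows "deriv_ext g (pelem p \<odot> pelem q) = deriv_ext g (pelem p) \<odot> pelem q + pelem p \<odot> deriv_ext g (pelem q)"
proof (cases "hv p = fst q")
  case True
  then show ?thesis
    using assms deriv_list_append[of "fst p" "snd p" "snd q"]
    by (simp add: mul_paths deriv_ext_def lin_ext_pelem)
next
  case False
  have d: "deriv_list g (snd p) \<in> alg" "deriv_list g (snd q) \<in> alg"
    using deriv_list_alg assms by (metis prod.collapse)+
  have v: "hv p \<in> V" "fst q \<in> V" using hv_in assms by (auto simp: is_path_def)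
  have "deriv_list g (snd p) \<odot> pelem q = deriv_list g (snd p) \<odot> vert (hv p) \<odot> pelem q"
    using deriv_list_tgt[of "fst p" "snd p"] assms by simp
  also have "\<dots> = 0" using d v assms False by (simp add: mul_assoc mul_vert mul_linear)
  finally have 1: "deriv_list g (snd p) \<odot> pelem q = 0" .
  have "pelem p \<odot> deriv_list g (snd q) = pelem p \<odot> (vert (fst q) \<odot> deriv_list g (snd q))"
    using deriv_list_src[of "fst q" "snd q"] assms by simp
  also have "\<dots> = 0" using d v assms False by (simp add: mul_vert mul_linear flip: mul_assoc)
  finally have 2: "pelem p \<odot> deriv_list g (snd q) = 0" .
  show ?thesis using 1 2 False assms
    by (simp add: mul_paths deriv_ext_def lin_ext_pelem lin_ext_zero)
qed

lemma deriv_ext_leibniz: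
  assumes "x \<in> alg" "y \<in> alg"
  shows "deriv_ext g (x \<odot> y) = deriv_ext g x \<odot> y + x \<odot> deriv_ext g y"
  using assms(1)
proof (induction rule: alg_induct)
  case (step x c p)
  from assms(2) have "deriv_ext g (pelem p \<odot> y) = deriv_ext g (pelem p) \<odot> y + pelem p \<odot> deriv_ext g y"
  proof (induction rule: alg_induct)
    case (step y d q)
    then show ?case
      using deriv_ext_paths[OF \<open>qpath p\<close> \<open>qpath q\<close>] \<open>qpath p\<close>
      by (simp add: mul_linear deriv_ext_def lin_ext_add lin_ext_scale pscale_simps)
  qed (simp add: mul_linear deriv_ext_def lin_ext_zero)
  then show ?case
    using step assms(2) by (simp add: mul_linear deriv_ext_def lin_ext_add lin_ext_scale pscale_simps)
qed (simp add: mul_linear deriv_ext_def lin_ext_zero)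

end

end

subsection \<open>Derivations into the quotient\<close>

locale path_quotient = path_algebra V E src tgt
  for V :: "'v set" and E :: "'a set" and src tgt :: "'a \<Rightarrow> 'v" +
  fixes I :: "(('v,'a) qpath \<Rightarrow> 'k::field) set" and Q :: "('v,'a) qpath set"
  assumes ideal: "is_ideal V E src tgt I" and R2: "in_R2 I"
    and basis: "path_class_basis V E src tgt I Q" and acyc: "acyclic_quot V tgt I Q"
begin

abbreviation cong :: "(('v,'a) qpath \<Rightarrow> 'k) \<Rightarrow> (('v,'a) qpath \<Rightarrow> 'k) \<Rightarrow> bool" (infix "\<doteq>" 50)
  where "x \<doteq> y \<equiv> x - y \<in> I"

abbreviation derivation :: "('v,'a,'k) op \<Rightarrow> bool" where
  "derivation \<equiv> diffop V E src tgt I"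

abbreviation D_op :: "'a \<Rightarrow> ('v,'a) qpath \<Rightarrow> ('v,'a,'k) op" where
  "D_op \<equiv> Drs V E src tgt I"

lemma ideal_closed:
  "I \<subseteq> alg" "0 \<in> I" "x \<in> I \<Longrightarrow> y \<in> I \<Longrightarrow> x + y \<in> I" "x \<in> I \<Longrightarrow> pscale c x \<in> I"
  "x \<in> I \<Longrightarrow> y \<in> alg \<Longrightarrow> x \<odot> y \<in> I" "x \<in> I \<Longrightarrow> y \<in> alg \<Longrightarrow> y \<odot> x \<in> I"
  using ideal unfolding is_ideal_def fun_op_eq by blast+

lemma ideal_minus: "x \<in> I \<Longrightarrow> - x \<in> I"
  using ideal_closed(4)[of x "-1"] by (simp add: pscale_simps)

lemma ideal_diff: "x \<in> I \<Longrightarrow> y \<in> I \<Longrightarrow> x - y \<in> I"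
  using ideal_closed(3)[of x "- y"] ideal_minus[of y] by simp

lemma ideal_sum: "(\<And>i. i \<in> S \<Longrightarrow> f i \<in> I) \<Longrightarrow> (\<Sum>i\<in>S. f i) \<in> I"
  by (induction S rule: infinite_finite_induct) (auto simp: ideal_closed)

lemma cong_refl: "x \<doteq> x" by (simp add: ideal_closed)

lemma cong_sym: "x \<doteq> y \<Longrightarrow> y \<doteq> x"
  using ideal_minus[of "x - y"] by simp

lemma cong_trans [trans]: "x \<doteq> y \<Longrightarrow> y \<doteq> z \<Longrightarrow> x \<doteq> z"
  using ideal_closed(3)[of "x - y" "y - z"] by simp

lemma cong_add: "x \<doteq> y \<Longrightarrow> x' \<doteq> y' \<Longrightarrow> x + x' \<doteq> y + y'"
  using ideal_closed(3)[of "x - y" "x' - y'"] by (simp add: algebra_simps)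

lemma cong_diff: "x \<doteq> y \<Longrightarrow> x' \<doteq> y' \<Longrightarrow> x - x' \<doteq> y - y'"
  using ideal_diff[of "x - y" "x' - y'"] by (simp add: algebra_simps)

lemma cong_scale: "x \<doteq> y \<Longrightarrow> pscale c x \<doteq> pscale c y"
  using ideal_closed(4)[of "x - y"] by (simp add: pscale_simps)

lemma cong_sum: "(\<And>i. i \<in> S \<Longrightarrow> f i \<doteq> h i) \<Longrightarrow> (\<Sum>i\<in>S. f i) \<doteq> (\<Sum>i\<in>S. h i)"
  using ideal_sum[of S "\<lambda>i. f i - h i"] by (simp add: sum_subtractf)

text \<open>Uses \<open>x x' - y y' = x (x' - y') + (x - y) y'\<close>, which is why just
  \<open>x\<close> and \<open>y'\<close> have to lie in the algebra.\<close>

lemma cong_mul: "x \<doteq> y \<Longrightarrow> x' \<doteq> y' \<Longrightarrow> x \<in> alg \<Longrightarrow> y' \<in> alg \<Longrightarrow> x \<odot> x' \<doteq> y \<odot> y'"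
proof -
  assume "x \<doteq> y" "x' \<doteq> y'" "x \<in> alg" "y' \<in> alg"
  then have "x \<odot> (x' - y') + (x - y) \<odot> y' \<in> I" by (intro ideal_closed)
  then show "x \<odot> x' \<doteq> y \<odot> y'" by (simp add: mul_linear)
qed

lemma cong_ideal: "x \<doteq> y \<Longrightarrow> x \<in> I \<longleftrightarrow> y \<in> I"
  using ideal_closed(3)[of "x - y" y] ideal_diff[of x "x - y"] by auto

section \<open>Derivations modulo \<open>I\<close> and their closure properties\<close>

lemma derivation_iff:
  "derivation D \<longleftrightarrow> (\<forall>x\<in>alg. D x \<in> alg) \<and> (\<forall>x\<in>alg. \<forall>y\<in>alg. D (x + y) \<doteq> D x + D y) \<and>
     (\<forall>c. \<forall>x\<in>alg. D (pscale c x) \<doteq> pscale c (D x)) \<and>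
     (\<forall>x\<in>alg. \<forall>y\<in>alg. D (x \<odot> y) \<doteq> D x \<odot> y + x \<odot> D y)"
  unfolding diffop_def fun_op_eq ..

lemma derivationD:
  assumes "derivation D" "x \<in> alg"
  shows "D x \<in> alg" "y \<in> alg \<Longrightarrow> D (x + y) \<doteq> D x + D y" "D (pscale c x) \<doteq> pscale c (D x)"
    "y \<in> alg \<Longrightarrow> D (x \<odot> y) \<doteq> D x \<odot> y + x \<odot> D y"
  using assms unfolding derivation_iff by blast+

lemma derivation_zero_arg:
  assumes "derivation D" shows "D 0 \<in> I"
  using derivationD(3)[OF assms, of 0 0] by (simp add: pscale_simps)

lemma derivation_add:
  assumes D: "derivation D" and D': "derivation D'"
  shows "derivation (\<lambda>x. D x + D' x)"
  unfolding derivation_iff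
proof (intro conjI ballI allI)
  fix x y :: "('v,'a) qpath \<Rightarrow> 'k" and c assume x: "x \<in> alg" and y: "y \<in> alg"
  note d = derivationD[OF D x] and d' = derivationD[OF D' x]
  show "D (x + y) + D' (x + y) \<doteq> (D x + D' x) + (D y + D' y)"
    using cong_add[OF d(2)[OF y] d'(2)[OF y]] by (simp add: algebra_simps)
  show "D (x \<odot> y) + D' (x \<odot> y) \<doteq> (D x + D' x) \<odot> y + x \<odot> (D y + D' y)"
    using cong_add[OF d(4)[OF y] d'(4)[OF y]] by (simp add: mul_linear algebra_simps)
next
  fix x :: "('v,'a) qpath \<Rightarrow> 'k" and c assume x: "x \<in> alg"
  note d = derivationD[OF D x] and d' = derivationD[OF D' x]
  show "D x + D' x \<in> alg" using d d' by auto
  show "D (pscale c x) + D' (pscale c x) \<doteq> pscale c (D x + D' x)"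
    using cong_add[OF d(3) d'(3)] by (simp add: pscale_simps)
qed

lemma derivation_scale:
  assumes D: "derivation D"
  shows "derivation (\<lambda>x. pscale k (D x))"
  unfolding derivation_iff
proof (intro conjI ballI allI)
  fix x y :: "('v,'a) qpath \<Rightarrow> 'k" assume x: "x \<in> alg" and y: "y \<in> alg"
  note d = derivationD[OF D x]
  show "pscale k (D (x + y)) \<doteq> pscale k (D x) + pscale k (D y)"
    using cong_scale[OF d(2)[OF y], of k] by (simp add: pscale_simps)
  show "pscale k (D (x \<odot> y)) \<doteq> pscale k (D x) \<odot> y + x \<odot> pscale k (D y)"
    using cong_scale[OF d(4)[OF y], of k] by (simp add: pscale_simps mul_linear)
next
  fix x :: "('v,'a) qpath \<Rightarrow> 'k" and c assume x: "x \<in> alg"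
  note d = derivationD[OF D x]
  show "pscale k (D x) \<in> alg" using d by auto
  show "pscale k (D (pscale c x)) \<doteq> pscale c (pscale k (D x))"
    using cong_scale[OF d(3), of k] by (simp add: pscale_simps mult.commute)
qed

lemma derivation_const_zero: "derivation (\<lambda>x. 0)"
  unfolding derivation_iff by (simp add: pscale_simps mul_linear ideal_closed)

lemma derivation_sum:
  assumes "\<And>j. j \<in> S \<Longrightarrow> derivation (F j)"
  shows "derivation (\<lambda>x. \<Sum>j\<in>S. pscale (c j) (F j x))"
  using assms
proof (induction S rule: infinite_finite_induct)
  case (insert j S)
  then have "derivation (\<lambda>x. pscale (c j) (F j x) + (\<Sum>j\<in>S. pscale (c j) (F j x)))"
    by (intro derivation_add derivation_scale) auto
  then show ?case using insert.hyps by simp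
qed (simp_all add: derivation_const_zero)

lemma derivation_diff:
  assumes D: "derivation D" and D': "derivation D'"
  shows "derivation (\<lambda>x. D x - D' x)"
  using derivation_add[OF D derivation_scale[OF D', of "-1"]] by (simp add: pscale_simps)

lemma derivation_inner:
  assumes m: "m \<in> alg"
  shows "derivation (\<lambda>x. m \<odot> x - x \<odot> m)"
  unfolding derivation_iff
proof (intro conjI ballI allI)
  fix x y :: "('v,'a) qpath \<Rightarrow> 'k" assume x: "x \<in> alg" and y: "y \<in> alg"
  have "m \<odot> (x + y) - (x + y) \<odot> m = (m \<odot> x - x \<odot> m) + (m \<odot> y - y \<odot> m)"
    by (simp add: mul_linear)
  then show "m \<odot> (x + y) - (x + y) \<odot> m \<doteq> (m \<odot> x - x \<odot> m) + (m \<odot> y - y \<odot> m)"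
    using cong_refl by metis
  have "m \<odot> (x \<odot> y) - (x \<odot> y) \<odot> m = (m \<odot> x - x \<odot> m) \<odot> y + x \<odot> (m \<odot> y - y \<odot> m)"
    using m x y by (simp add: mul_linear mul_assoc)
  then show "m \<odot> (x \<odot> y) - (x \<odot> y) \<odot> m \<doteq> (m \<odot> x - x \<odot> m) \<odot> y + x \<odot> (m \<odot> y - y \<odot> m)"
    using cong_refl by metis
next
  fix x :: "('v,'a) qpath \<Rightarrow> 'k" and c assume x: "x \<in> alg"
  show "m \<odot> x - x \<odot> m \<in> alg" using m x by auto
  show "m \<odot> pscale c x - pscale c x \<odot> m \<doteq> pscale c (m \<odot> x - x \<odot> m)"
    by (simp add: mul_linear pscale_simps ideal_closed)
qed

lemma derivation_paths:
  assumes D: "derivation D" and v: "\<And>v. v \<in> V \<Longrightarrow> D (vert v) \<in> I" and a: "\<And>a. a \<in> E \<Longrightarrow> D (arr a) \<in> I"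
  shows "qpath (v, as) \<Longrightarrow> D (pelem (v, as)) \<in> I"
proof (induction as arbitrary: v)
  case Nil
  then show ?case using assms(2) by simp
next
  case (Cons b bs)
  then have b: "b \<in> E" "src b = v" "qpath (tgt b, bs)" by auto
  have "pelem (v, b # bs) = arr b \<odot> (pelem (tgt b, bs) :: _ \<Rightarrow> 'k)"
    using b by (simp add: mul_paths)
  then have "D (pelem (v, b # bs)) \<doteq> D (arr b) \<odot> pelem (tgt b, bs) + arr b \<odot> D (pelem (tgt b, bs))"
    using derivationD(4)[OF D, of "arr b" "pelem (tgt b, bs)"] b by simp
  moreover have "D (arr b) \<odot> pelem (tgt b, bs) + arr b \<odot> D (pelem (tgt b, bs)) \<in> I"
    using a[OF b(1)] Cons.IH[OF b(3)] b by (intro ideal_closed) auto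
  ultimately show ?case using cong_ideal by blast
qed

text \<open>Vertices and arrows generate the algebra, so a derivation is determined modulo
  \<open>I\<close> by its values on them.\<close>

lemma derivation_zero:
  assumes D: "derivation D" and v: "\<And>v. v \<in> V \<Longrightarrow> D (vert v) \<in> I" and a: "\<And>a. a \<in> E \<Longrightarrow> D (arr a) \<in> I"
    and x: "x \<in> alg"
  shows "D x \<in> I"
  using x
proof (induction rule: alg_induct)
  case zero
  then show ?case by (rule derivation_zero_arg[OF D])
next
  case (step x c p)
  have "D (pscale c (pelem p)) \<doteq> pscale c (D (pelem p))"
    using derivationD(3)[OF D, of "pelem p" c] \<open>qpath p\<close> by simp
  moreover have "D (pelem p) \<in> I"
    using derivation_paths[OF D v a, of "fst p" "snd p"] \<open>qpath p\<close> by simp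
  ultimately have "D (pscale c (pelem p)) \<in> I" using cong_ideal ideal_closed(4) by blast
  then have "D x + D (pscale c (pelem p)) \<in> I" using step ideal_closed(3) by blast
  moreover have "D (x + pscale c (pelem p)) \<doteq> D x + D (pscale c (pelem p))"
    using derivationD(2)[OF D] step by simp
  ultimately show ?case using cong_ideal by blast
qed

text \<open>\<open>deriv_ext\<close> of the function that sends \<open>r\<close> to \<open>s\<close>
  and all other arrows to 0 is a witness for the \<open>SOME\<close>; since \<open>s\<close> is
  parallel to \<open>r\<close>, its hypotheses hold.\<close>

lemma Drs_facts:
  assumes r: "r \<in> E" and s: "qpath s" "fst s = src r" "hv s = tgt r"
  shows "derivation (D_op r s)" "D_op r s (arr r) \<doteq> pelem s"
    "\<And>a. a \<in> E \<Longrightarrow> a \<noteq> r \<Longrightarrow> D_op r s (arr a) \<in> I" "\<And>v. v \<in> V \<Longrightarrow> D_op r s (vert v) \<in> I"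
proof -
  define g :: "'a \<Rightarrow> ('v,'a) qpath \<Rightarrow> 'k" where "g a = (if a = r then pelem s else 0)" for a
  have g: "a \<in> E \<Longrightarrow> g a \<in> alg" "a \<in> E \<Longrightarrow> vert (src a) \<odot> g a = g a" "a \<in> E \<Longrightarrow> g a \<odot> vert (tgt a) = g a" for a
    using s ends[OF r] by (auto simp: g_def mul_vert mul_linear)
  have ga: "deriv_ext g (arr a) = g a" if "a \<in> E" for a
    using g(3)[OF that] by (simp add: deriv_ext_def lin_ext_pelem mul_linear)
  have "derivation (deriv_ext g)"
    unfolding derivation_iff
  proof (intro conjI ballI allI)
    fix x y :: "('v,'a) qpath \<Rightarrow> 'k" assume x: "x \<in> alg" and y: "y \<in> alg"
    show "deriv_ext g (x + y) \<doteq> deriv_ext g x + deriv_ext g y"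
      unfolding deriv_ext_def lin_ext_add[OF x y] by (rule cong_refl)
    show "deriv_ext g (x \<odot> y) \<doteq> deriv_ext g x \<odot> y + x \<odot> deriv_ext g y"
      using deriv_ext_leibniz[OF g x y] by (simp add: ideal_closed)
  next
    fix x :: "('v,'a) qpath \<Rightarrow> 'k" and c assume x: "x \<in> alg"
    show "deriv_ext g x \<in> alg" using deriv_ext_alg[OF g x] .
    show "deriv_ext g (pscale c x) \<doteq> pscale c (deriv_ext g x)"
      unfolding deriv_ext_def lin_ext_scale[OF x] by (rule cong_refl)
  qed
  moreover have "deriv_ext g (arr r) \<doteq> pelem s" using ga[OF r] by (simp add: g_def ideal_closed)
  moreover have "deriv_ext g (arr a) \<in> I" if "a \<in> E" "a \<noteq> r" for a
    using ga[OF that(1)] that by (simp add: g_def ideal_closed)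
  moreover have "deriv_ext g (vert v) \<in> I" for v
    by (simp add: deriv_ext_def lin_ext_pelem ideal_closed)
  ultimately have "\<exists>D. derivation D \<and> D (arr r) \<doteq> pelem s \<and>
      (\<forall>a\<in>E. a \<noteq> r \<longrightarrow> D (arr a) \<in> I) \<and> (\<forall>v\<in>V. D (vert v) \<in> I)" by blast
  from someI_ex[OF this] show "derivation (D_op r s)" "D_op r s (arr r) \<doteq> pelem s"
    "\<And>a. a \<in> E \<Longrightarrow> a \<noteq> r \<Longrightarrow> D_op r s (arr a) \<in> I" "\<And>v. v \<in> V \<Longrightarrow> D_op r s (vert v) \<in> I"
    unfolding Drs_def fun_op_eq by blast+
qed

section \<open>The path basis \<open>Q\<close> of the quotient\<close>

lemma short_coeff: "x \<in> I \<Longrightarrow> length (snd p) < 2 \<Longrightarrow> x p = 0"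
  using R2 unfolding in_R2_def by blast

text \<open>Elements of \<open>I\<close> have no coefficients on paths of length below 2, so
  vertices and arrows are the only paths in their classes. Hence they belong to \<open>Q\<close>
  themselves, not just up to congruence.\<close>

lemma cong_short_path:
  assumes "pelem q \<doteq> pelem p" "length (snd p) < 2"
  shows "q = p"
proof -
  have "(pelem q - pelem p) p = (0::'k)" by (rule short_coeff[OF assms])
  then show ?thesis by (simp add: pelem_def fun_apply split: if_splits)
qed

lemma Q_path: "q \<in> Q \<Longrightarrow> qpath q"
  using basis unfolding path_class_basis_def by blast

lemma vert_Q: "v \<in> V \<Longrightarrow> (v, []) \<in> Q"
proof -
  assume "v \<in> V"
  then obtain q where "q \<in> Q" "pelem q \<doteq> vert v"
    using basis unfolding path_class_basis_def fun_op_eq by blast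
  then show ?thesis using cong_short_path[of q "(v, [])"] by simp
qed

lemma arrow_Q: "a \<in> E \<Longrightarrow> arrow_path src a \<in> Q"
proof -
  assume "a \<in> E"
  then obtain q where "q \<in> Q" "pelem q \<doteq> arr a"
    using basis unfolding path_class_basis_def fun_op_eq by blast
  then show ?thesis using cong_short_path[of q "arrow_path src a"] by simp
qed

lemma Q_cycle:
  assumes "q \<in> Q" "fst q = hv q"
  obtains v where "v \<in> V" "q = (v, [])"
proof -
  obtain v where "v \<in> V" "pelem q \<doteq> vert v"
    using acyc assms unfolding acyclic_quot_def fun_op_eq path_t_def by blast
  then show thesis using that cong_short_path[of q "(v, [])"] by simp
qed

text \<open>A loop would be a closed element of \<open>Q\<close>, hence a trivial path. This is what
  provides genuine arcs for the planar part.\<close>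

lemma no_loops: "a \<in> E \<Longrightarrow> src a \<noteq> tgt a"
proof
  assume a: "a \<in> E" "src a = tgt a"
  then obtain v where "arrow_path src a = (v, [])"
    using Q_cycle[OF arrow_Q[OF a(1)]] by auto
  then show False by (simp add: arrow_path_def)
qed

lemma lincomb_paths_eq:
  "lincomb_paths Q c = (\<Sum>q\<in>{q\<in>Q. c q \<noteq> 0}. pscale (c q) (pelem q))"
  by (simp add: lincomb_paths_def fun_eq_iff sum_fun_apply pscale_def)

lemma Q_independent:
  fixes c :: "('v,'a) qpath \<Rightarrow> 'k"
  assumes S: "finite S" "S \<subseteq> Q" and sum: "(\<Sum>q\<in>S. pscale (c q) (pelem q)) \<in> I" and q: "q \<in> S"
  shows "c q = 0"
proof -
  define d where "d q = (if q \<in> S then c q else 0)" for q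
  have sub: "{q \<in> Q. d q \<noteq> 0} \<subseteq> S" by (auto simp: d_def)
  then have fin: "finite {q \<in> Q. d q \<noteq> 0}" using S finite_subset by blast
  have "lincomb_paths Q d = (\<Sum>q\<in>S. pscale (d q) (pelem q))"
    unfolding lincomb_paths_eq
    by (rule sum.mono_neutral_left) (use S sub in \<open>auto simp: pscale_simps\<close>)
  also have "\<dots> = (\<Sum>q\<in>S. pscale (c q) (pelem q))" by (rule sum.cong) (auto simp: d_def)
  finally have "lincomb_paths Q d \<in> I" using sum by simp
  then have "\<forall>q\<in>Q. d q = 0" using basis fin unfolding path_class_basis_def by blast
  then have "d q = 0" using q S by blast
  then show ?thesis using q by (simp add: d_def)
qed

lemma Q_expand:
  fixes x :: "('v,'a) qpath \<Rightarrow> 'k"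
  assumes "x \<in> alg"
  obtains S c where "finite S" "S \<subseteq> Q" "x \<doteq> (\<Sum>q\<in>S. pscale (c q) (pelem q))"
proof -
  obtain c where "finite {q\<in>Q. c q \<noteq> 0}" "x \<doteq> lincomb_paths Q c"
    using basis assms unfolding path_class_basis_def fun_op_eq by blast
  then show thesis using that[of "{q\<in>Q. c q \<noteq> 0}" c] unfolding lincomb_paths_eq by blast
qed

section \<open>The proposed basis and its values on vertices and arrows\<close>

text \<open>\<open>F\<close> is an arbitrary index set and faces will enter only through their sign
  vectors, so the algebra below is independent of the embedding.\<close>

definition basis_index :: "'f set \<Rightarrow> ('a \<times> ('v,'a) qpath + 'f) set" where
  "basis_index F = {Inl (r, s) | r s. r \<in> E \<and> s \<in> Q \<and> path_t s = src r \<and> path_h tgt s = tgt r \<and>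
                        psub (pelem s) (pelem (arrow_path src r)) \<notin> I} \<union> Inr ` F"

definition sign_op :: "('a \<Rightarrow> int) \<Rightarrow> ('v,'a,'k) op" where
  "sign_op n = (\<lambda>x p. \<Sum>a\<in>E. of_int (n a) * Drs V E src tgt I a (arrow_path src a) x p)"

definition basis_op :: "('f \<Rightarrow> 'a \<Rightarrow> int) \<Rightarrow> 'a \<times> ('v,'a) qpath + 'f \<Rightarrow> ('v,'a,'k) op" where
  "basis_op sg = case_sum (\<lambda>(r, s). Drs V E src tgt I r s) (\<lambda>f. sign_op (sg f))"

definition arrow_value :: "('f \<Rightarrow> 'a \<Rightarrow> int) \<Rightarrow> 'a \<times> ('v,'a) qpath + 'f \<Rightarrow> 'a \<Rightarrow> ('v,'a) qpath \<Rightarrow> 'k" where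
  "arrow_value sg j a = (case j of Inl (r, s) \<Rightarrow> (if r = a then pelem s else 0)
      | Inr f \<Rightarrow> pscale (of_int (sg f a)) (arr a))"

lemma basis_index_Inl:
  "Inl (r, s) \<in> basis_index F \<longleftrightarrow> r \<in> E \<and> s \<in> Q \<and> fst s = src r \<and> hv s = tgt r \<and> s \<noteq> arrow_path src r"
proof -
  have "pelem s \<doteq> arr r \<longleftrightarrow> s = arrow_path src r"
    using cong_short_path[of s "arrow_path src r"] cong_refl by auto
  then show ?thesis by (cases s) (auto simp: basis_index_def fun_op_eq path_t_def)
qed

lemma basis_index_Inr: "Inr f \<in> basis_index F \<longleftrightarrow> f \<in> F"
  by (auto simp: basis_index_def)

lemma sign_op_eq: "sign_op n = (\<lambda>x. \<Sum>a\<in>E. pscale (of_int (n a)) (D_op a (arrow_path src a) x))"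
  by (simp add: sign_op_def fun_eq_iff sum_fun_apply pscale_def)

lemma basis_op_facts:
  assumes "j \<in> basis_index F"
  shows "derivation (basis_op sg j)" "v \<in> V \<Longrightarrow> basis_op sg j (vert v) \<in> I"
    "a \<in> E \<Longrightarrow> basis_op sg j (arr a) \<doteq> arrow_value sg j a"
proof -
  have "derivation (basis_op sg j) \<and> (v \<in> V \<longrightarrow> basis_op sg j (vert v) \<in> I) \<and>
    (a \<in> E \<longrightarrow> basis_op sg j (arr a) \<doteq> arrow_value sg j a)"
  proof (cases j)
    case (Inl rs)
    obtain r s where rs: "rs = (r, s)" by (cases rs)
    have r: "r \<in> E" and s: "qpath s" "fst s = src r" "hv s = tgt r"
      using assms Q_path unfolding Inl rs basis_index_Inl by auto
    show ?thesis using Drs_facts[OF r s] by (auto simp: Inl rs basis_op_def arrow_value_def)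
  next
    case (Inr f)
    have D: "derivation (D_op b (arrow_path src b))" "D_op b (arrow_path src b) (arr b) \<doteq> arr b"
      "\<And>a. a \<in> E \<Longrightarrow> a \<noteq> b \<Longrightarrow> D_op b (arrow_path src b) (arr a) \<in> I"
      "\<And>v. v \<in> V \<Longrightarrow> D_op b (arrow_path src b) (vert v) \<in> I" if "b \<in> E" for b
      using Drs_facts[OF that, of "arrow_path src b"] that by auto
    have op: "basis_op sg j = (\<lambda>x. \<Sum>b\<in>E. pscale (of_int (sg f b)) (D_op b (arrow_path src b) x))"
      by (simp add: Inr basis_op_def sign_op_eq)
    have "derivation (basis_op sg j)" unfolding op by (rule derivation_sum) (rule D(1))
    moreover have "basis_op sg j (vert v) \<in> I" if "v \<in> V"
      unfolding op by (intro ideal_sum ideal_closed D(4) that)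
    moreover have "basis_op sg j (arr a) \<doteq> arrow_value sg j a" if a: "a \<in> E"
    proof -
      have "basis_op sg j (arr a) \<doteq> (\<Sum>b\<in>E. if b = a then pscale (of_int (sg f a)) (arr a) else 0)"
        unfolding op
      proof (rule cong_sum)
        fix b assume b: "b \<in> E"
        show "pscale (of_int (sg f b)) (D_op b (arrow_path src b) (arr a)) \<doteq>
          (if b = a then pscale (of_int (sg f a)) (arr a) else 0)"
        proof (cases "b = a")
          case True
          then show ?thesis using cong_scale[OF D(2)[OF b]] by auto
        next
          case False
          then show ?thesis using D(3)[OF b a] ideal_closed(4) by auto
        qed
      qed
      also have "(\<Sum>b\<in>E. if b = a then pscale (of_int (sg f a)) (arr a) else 0) = arrow_value sg j a"
        using a finE by (simp add: Inr arrow_value_def)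
      finally show ?thesis .
    qed
    ultimately show ?thesis by blast
  qed
  then show "derivation (basis_op sg j)" "v \<in> V \<Longrightarrow> basis_op sg j (vert v) \<in> I"
    "a \<in> E \<Longrightarrow> basis_op sg j (arr a) \<doteq> arrow_value sg j a" by blast+
qed

lemma lincomb_ops_eq:
  "lincomb_ops J c H = (\<lambda>x. \<Sum>j\<in>{j\<in>J. c j \<noteq> 0}. pscale (c j) (H j x))"
  by (simp add: lincomb_ops_def fun_eq_iff sum_fun_apply pscale_def)

lemma lincomb_vert: "v \<in> V \<Longrightarrow> lincomb_ops (basis_index F) c (basis_op sg) (vert v) \<in> I"
  unfolding lincomb_ops_eq by (intro ideal_sum ideal_closed) (auto intro: basis_op_facts)

definition support_at :: "'f set \<Rightarrow> ('a \<times> ('v,'a) qpath + 'f \<Rightarrow> 'k) \<Rightarrow> 'a \<Rightarrow> ('v,'a) qpath set" where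
  "support_at F c a = {s. Inl (a, s) \<in> basis_index F \<and> c (Inl (a, s)) \<noteq> 0}"

lemma finite_support_at:
  fixes F :: "'f set"
  assumes "finite {j \<in> basis_index F. c j \<noteq> 0}"
  shows "finite (support_at F c a)"
proof -
  have "finite ((\<lambda>s. Inl (a, s) :: 'a \<times> ('v,'a) qpath + 'f) ` support_at F c a)"
    by (rule finite_subset[OF _ assms]) (auto simp: support_at_def)
  then show ?thesis by (rule finite_imageD) (simp add: inj_on_def)
qed

text \<open>Operators with index \<open>Inl (a, s)\<close> contribute paths \<open>s\<close>
  different from the arrow \<open>a\<close>, so the coefficient of \<open>a\<close> itself comes
  from the sign vectors alone.\<close>

lemma lincomb_arr:
  assumes fin: "finite {j \<in> basis_index F. c j \<noteq> 0}" and finF: "finite F" and a: "a \<in> E"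
  shows "lincomb_ops (basis_index F) c (basis_op sg) (arr a) \<doteq>
    (\<Sum>s\<in>support_at F c a. pscale (c (Inl (a, s))) (pelem s))
      + pscale (\<Sum>f\<in>F. c (Inr f) * of_int (sg f a)) (arr a)"
proof -
  let ?N = "{j \<in> basis_index F. c j \<noteq> 0}"
  let ?h = "\<lambda>j. pscale (c j) (arrow_value sg j a)"
  let ?A = "(\<lambda>s. Inl (a, s)) ` support_at F c a"
  have "lincomb_ops (basis_index F) c (basis_op sg) (arr a) \<doteq> (\<Sum>j\<in>?N. ?h j)"
    unfolding lincomb_ops_eq by (intro cong_sum cong_scale) (auto intro: basis_op_facts a)
  also have "(\<Sum>j\<in>?N. ?h j) = (\<Sum>j\<in>?A \<union> Inr ` F. ?h j)"
  proof (rule sum.mono_neutral_cong)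
    show "finite (?A \<union> Inr ` F)" using finite_support_at[OF fin] finF by simp
    show "?h j = 0" if "j \<in> ?N - (?A \<union> Inr ` F)" for j
    proof (cases j)
      case (Inl rs)
      obtain r s where rs: "rs = (r, s)" by (cases rs)
      have "r \<noteq> a" using that unfolding Inl rs by (auto simp: support_at_def)
      then show ?thesis by (simp add: Inl rs arrow_value_def pscale_simps)
    qed (use that in \<open>auto simp: basis_index_Inr\<close>)
    show "?h j = 0" if "j \<in> ?A \<union> Inr ` F - ?N" for j
      using that by (auto simp: support_at_def basis_index_Inr pscale_simps)
  qed (use fin in auto)
  also have "(\<Sum>j\<in>?A \<union> Inr ` F. ?h j) = (\<Sum>j\<in>?A. ?h j) + (\<Sum>j\<in>Inr ` F. ?h j)"
    by (rule sum.union_disjoint) (use finite_support_at[OF fin] finF in auto)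
  also have "(\<Sum>j\<in>?A. ?h j) = (\<Sum>s\<in>support_at F c a. pscale (c (Inl (a, s))) (pelem s))"
    by (subst sum.reindex) (auto simp: inj_on_def arrow_value_def)
  also have "(\<Sum>j\<in>Inr ` F. ?h j) = pscale (\<Sum>f\<in>F. c (Inr f) * of_int (sg f a)) (arr a)"
    by (subst sum.reindex) (auto simp: inj_on_def arrow_value_def pscale_simps sum_pscale)
  finally show ?thesis .
qed

lemma commutator_vert:
  assumes S: "finite S" "S \<subseteq> Q" and v: "v \<in> V"
  shows "(\<Sum>q\<in>S. pscale (c q) (pelem q)) \<odot> vert v - vert v \<odot> (\<Sum>q\<in>S. pscale (c q) (pelem q))
    = (\<Sum>q\<in>S. pscale (c q * ((if hv q = v then 1 else 0) - (if fst q = v then 1 else 0))) (pelem q))"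
  unfolding mul_sum mul_linear sum_subtractf[symmetric]
proof (rule sum.cong)
  fix q assume "q \<in> S"
  then have "qpath q" using S Q_path by blast
  then show "pscale (c q) (pelem q \<odot> vert v) - pscale (c q) (vert v \<odot> pelem q)
    = pscale (c q * ((if hv q = v then 1 else 0) - (if fst q = v then 1 else 0))) (pelem q)"
    using v by (simp add: mul_vert pscale_simps algebra_simps)
qed simp

text \<open>The source of the coboundaries: a vertex on the left keeps \<open>a\<close> if it is its
  start, on the right if it is its end.\<close>

lemma vertex_commutator_arr:
  assumes fin: "finite S" and S: "\<And>q. q \<in> S \<Longrightarrow> c q \<noteq> 0 \<Longrightarrow> \<exists>v\<in>V. q = (v, [])" and a: "a \<in> E"
    and l: "\<And>v. l v = (if (v, []) \<in> S then c (v, []) else 0)"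
  shows "(\<Sum>q\<in>S. pscale (c q) (pelem q)) \<odot> arr a - arr a \<odot> (\<Sum>q\<in>S. pscale (c q) (pelem q))
    = pscale (l (src a) - l (tgt a)) (arr a)"
proof -
  have "(\<Sum>q\<in>S. pscale (c q) (pelem q)) \<odot> arr a - arr a \<odot> (\<Sum>q\<in>S. pscale (c q) (pelem q))
    = (\<Sum>q\<in>S. pscale ((if q = (src a, []) then c q else 0) - (if q = (tgt a, []) then c q else 0)) (arr a))"
    unfolding mul_sum mul_linear sum_subtractf[symmetric]
  proof (rule sum.cong)
    fix q assume q: "q \<in> S"
    show "pscale (c q) (pelem q \<odot> arr a) - pscale (c q) (arr a \<odot> pelem q)
      = pscale ((if q = (src a, []) then c q else 0) - (if q = (tgt a, []) then c q else 0)) (arr a)"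
    proof (cases "c q = 0")
      case False
      then obtain v where v: "v \<in> V" "q = (v, [])" using S q by blast
      then show ?thesis
        using a no_loops[OF a] by (auto simp: mul_vert pscale_simps)
    qed (auto simp: pscale_simps)
  qed simp
  also have "\<dots> = pscale (l (src a) - l (tgt a)) (arr a)"
    unfolding sum_pscale sum_subtractf l using fin by (simp add: sum.delta)
  finally show ?thesis .
qed

section \<open>Independence modulo inner derivations\<close>

text \<open>If the combination is inner, its vanishing on vertices makes the inner element a
  combination of vertices modulo \<open>I\<close>. Comparing coefficients at each arrow kills those
  of the \<open>Inl\<close> operators and leaves a relation between sign vectors and a coboundary,
  to which \<open>indep\<close> applies.\<close>

lemma basis_ops_independent:
  fixes F :: "'f set" and sg :: "'f \<Rightarrow> 'a \<Rightarrow> int" and c :: "'a \<times> ('v,'a) qpath + 'f \<Rightarrow> 'k"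
  assumes finF: "finite F"
    and indep: "\<And>(t::'f \<Rightarrow> 'k) l f. (\<And>a. a \<in> E \<Longrightarrow> (\<Sum>f\<in>F. t f * of_int (sg f a)) = l (src a) - l (tgt a)) \<Longrightarrow> f \<in> F \<Longrightarrow> t f = 0"
    and fin: "finite {j \<in> basis_index F. c j \<noteq> 0}"
    and inner: "inner_op V E src tgt I (lincomb_ops (basis_index F) c (basis_op sg))"
    and j: "j \<in> basis_index F"
  shows "c j = 0"
proof -
  let ?L = "lincomb_ops (basis_index F) c (basis_op sg)"
  obtain m where m: "m \<in> alg" and mL: "\<And>x. x \<in> alg \<Longrightarrow> ?L x \<doteq> m \<odot> x - x \<odot> m"
    using inner unfolding inner_op_def fun_op_eq by blast
  obtain S \<mu> where S: "finite S" "S \<subseteq> Q" and mS: "m \<doteq> (\<Sum>q\<in>S. pscale (\<mu> q) (pelem q))"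
    using Q_expand[OF m] by blast
  define M where "M = (\<Sum>q\<in>S. pscale (\<mu> q) (pelem q))"
  have M: "M \<in> alg" unfolding M_def using S Q_path by (auto intro!: alg_sum alg_closed)
  have LM: "?L x \<doteq> M \<odot> x - x \<odot> M" if x: "x \<in> alg" for x
    by (rule cong_trans[OF mL[OF x]])
      (intro cong_diff cong_mul cong_refl m x M, use mS in \<open>auto simp: M_def\<close>)
  have vertices: "\<exists>v\<in>V. q = (v, [])" if q: "q \<in> S" and nz: "\<mu> q \<noteq> 0" for q
  proof (cases "fst q = hv q")
    case True
    then show ?thesis using Q_cycle[of q] q S by blast
  next
    case False
    have v: "hv q \<in> V" using hv_in Q_path q S by blast
    have "M \<odot> vert (hv q) - vert (hv q) \<odot> M \<in> I"
      using LM[of "vert (hv q)"] lincomb_vert[OF v] cong_ideal v by (meson alg_closed(4) qpath_Nil)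
    \<comment> \<open>In the commutator with its end vertex, a non-closed \<open>q\<close> has
      coefficient \<open>\<mu> q\<close>, and the elements of \<open>Q\<close> are independent
      modulo \<open>I\<close>.\<close>
    then have "\<mu> q * ((if hv q = hv q then 1 else 0) - (if fst q = hv q then 1 else 0)) = 0"
      unfolding M_def commutator_vert[OF S v] by (rule Q_independent[OF S _ q])
    then show ?thesis using False nz by simp
  qed
  define l where "l v = (if (v, []) \<in> S then \<mu> (v, []) else 0)" for v
  define X where "X a = (\<Sum>f\<in>F. c (Inr f) * of_int (sg f a))" for a
  have arrow: "X a = l (src a) - l (tgt a) \<and> (\<forall>s\<in>support_at F c a. c (Inl (a, s)) = 0)" if a: "a \<in> E" for a
  proof -
    let ?S = "support_at F c a"
    \<comment> \<open>Collects the coefficient of the arrow and those of the other paths in one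
      function on \<open>Q\<close>.\<close>
    define d where "d s = (if s = arrow_path src a then X a - (l (src a) - l (tgt a)) else c (Inl (a, s)))" for s
    have S': "finite ?S" "?S \<subseteq> Q" "arrow_path src a \<notin> ?S"
      using finite_support_at[OF fin] by (auto simp: support_at_def basis_index_Inl)
    have Ma: "M \<odot> arr a - arr a \<odot> M = pscale (l (src a) - l (tgt a)) (arr a)"
      unfolding M_def by (rule vertex_commutator_arr[OF S(1) vertices a l_def])
    have "(\<Sum>s\<in>?S. pscale (c (Inl (a, s))) (pelem s)) + pscale (X a) (arr a) \<doteq> pscale (l (src a) - l (tgt a)) (arr a)"
      using cong_trans[OF cong_sym[OF lincomb_arr[OF fin finF a, of sg]] LM[of "arr a"]] a
      unfolding Ma X_def by simp
    then have "(\<Sum>s\<in>?S. pscale (c (Inl (a, s))) (pelem s)) + pscale (X a - (l (src a) - l (tgt a))) (arr a) \<in> I"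
      by (simp add: pscale_simps algebra_simps)
    also have "(\<Sum>s\<in>?S. pscale (c (Inl (a, s))) (pelem s)) = (\<Sum>s\<in>?S. pscale (d s) (pelem s))"
      by (rule sum.cong) (use S' in \<open>auto simp: d_def\<close>)
    also have "(\<Sum>s\<in>?S. pscale (d s) (pelem s)) + pscale (X a - (l (src a) - l (tgt a))) (arr a)
        = (\<Sum>s\<in>insert (arrow_path src a) ?S. pscale (d s) (pelem s))"
      using S' by (simp add: d_def add.commute)
    finally have "(\<Sum>s\<in>insert (arrow_path src a) ?S. pscale (d s) (pelem s)) \<in> I" .
    then have d0: "d s = 0" if "s \<in> insert (arrow_path src a) ?S" for s
      using Q_independent[of "insert (arrow_path src a) ?S" d s] S' that arrow_Q[OF a] by simp
    have "c (Inl (a, s)) = 0" if "s \<in> ?S" for s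
    proof -
      have "s \<noteq> arrow_path src a" using that S'(3) by blast
      then show ?thesis using d0[of s] that by (simp add: d_def)
    qed
    then show ?thesis using d0[of "arrow_path src a"] by (simp add: d_def)
  qed
  show ?thesis
  proof (cases j)
    case (Inl rs)
    obtain r s where rs: "rs = (r, s)" by (cases rs)
    have r: "r \<in> E" using j unfolding Inl rs basis_index_Inl by blast
    show ?thesis
    proof (rule ccontr)
      assume "c j \<noteq> 0"
      then have "s \<in> support_at F c r" using j by (simp add: Inl rs support_at_def)
      then show False using arrow[OF r] \<open>c j \<noteq> 0\<close> by (simp add: Inl rs)
    qed
  next
    case (Inr f)
    have "(\<Sum>f\<in>F. c (Inr f) * of_int (sg f a)) = l (src a) - l (tgt a)" if "a \<in> E" for a
      using arrow[OF that] by (simp add: X_def)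
    then show ?thesis using indep[of "\<lambda>f. c (Inr f)" l f] j by (simp add: Inr basis_index_Inr)
  qed
qed

section \<open>Spanning modulo inner derivations\<close>

text \<open>Take \<open>m\<close> as the sum of \<open>D(v) v\<close> over all vertices.
  Orthogonality of the idempotents gives \<open>m w = D(w) w\<close>. The Leibniz rule for
  \<open>w v\<close>, multiplied by \<open>v\<close> on the right and summed over \<open>v\<close>,
  gives \<open>w m = D(w) w - D(w)\<close> modulo \<open>I\<close>, because the vertices sum to a
  right unit.\<close>

lemma inner_on_vertices:
  assumes D: "derivation D"
  obtains m where "m \<in> alg" "\<And>v. v \<in> V \<Longrightarrow> D (vert v) \<doteq> m \<odot> vert v - vert v \<odot> m"
proof -
  define m where "m = (\<Sum>v\<in>V. D (vert v) \<odot> vert v)"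
  have De: "D (vert v) \<in> alg" if "v \<in> V" for v using derivationD(1)[OF D] that by simp
  have m: "m \<in> alg" unfolding m_def using De by (auto intro!: alg_sum)
  have "D (vert w) \<doteq> m \<odot> vert w - vert w \<odot> m" if w: "w \<in> V" for w
  proof -
    have "m \<odot> vert w = (\<Sum>v\<in>V. if v = w then D (vert w) \<odot> vert w else 0)"
      unfolding m_def mul_sum
    proof (rule sum.cong)
      fix v assume v: "v \<in> V"
      then show "D (vert v) \<odot> vert v \<odot> vert w = (if v = w then D (vert w) \<odot> vert w else 0)"
        using De[OF v] w by (simp add: mul_assoc mul_vert mul_linear)
    qed simp
    then have mw: "m \<odot> vert w = D (vert w) \<odot> vert w" using finV w by simp
    have "vert w \<odot> m \<doteq> (\<Sum>v\<in>V. (if v = w then D (vert w) \<odot> vert w else 0) - D (vert w) \<odot> vert v)"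
      unfolding m_def mul_sum
    proof (rule cong_sum)
      fix v assume v: "v \<in> V"
      have "D (vert w \<odot> vert v) \<doteq> D (vert w) \<odot> vert v + vert w \<odot> D (vert v)"
        using derivationD(4)[OF D, of "vert w" "vert v"] v w by simp
      from cong_diff[OF cong_sym[OF this] cong_refl[of "D (vert w) \<odot> vert v"]]
      have "vert w \<odot> D (vert v) \<doteq> D (vert w \<odot> vert v) - D (vert w) \<odot> vert v" by simp
      also have "D (vert w \<odot> vert v) - D (vert w) \<odot> vert v \<doteq> (if v = w then D (vert w) else 0) - D (vert w) \<odot> vert v"
        using v w derivation_zero_arg[OF D] by (intro cong_diff cong_refl) (auto simp: mul_vert ideal_closed)
      finally have "vert w \<odot> D (vert v) \<odot> vert v \<doteq> ((if v = w then D (vert w) else 0) - D (vert w) \<odot> vert v) \<odot> vert v"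
        by (rule cong_mul) (use v w De in \<open>auto simp: ideal_closed\<close>)
      also have "((if v = w then D (vert w) else 0) - D (vert w) \<odot> vert v) \<odot> vert v
          = (if v = w then D (vert w) \<odot> vert w else 0) - D (vert w) \<odot> vert v"
        using v w De by (simp add: mul_linear mul_assoc mul_vert)
      finally show "vert w \<odot> (D (vert v) \<odot> vert v) \<doteq> (if v = w then D (vert w) \<odot> vert w else 0) - D (vert w) \<odot> vert v"
        using v w De by (simp add: mul_assoc)
    qed
    also have "(\<Sum>v\<in>V. (if v = w then D (vert w) \<odot> vert w else 0) - D (vert w) \<odot> vert v)
        = D (vert w) \<odot> vert w - D (vert w)"
      unfolding sum_subtractf mul_sum(2)[symmetric] mul_unit[OF De[OF w]] using finV w by simp
    finally have "m \<odot> vert w - vert w \<odot> m \<doteq> D (vert w) \<odot> vert w - (D (vert w) \<odot> vert w - D (vert w))"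
      unfolding mw by (intro cong_diff cong_refl)
    also have "D (vert w) \<odot> vert w - (D (vert w) \<odot> vert w - D (vert w)) = D (vert w)" by simp
    finally show ?thesis by (rule cong_sym)
  qed
  then show thesis using that m by blast
qed

text \<open>As \<open>D\<close> vanishes on vertices modulo \<open>I\<close>, it commutes with
  multiplication by them; cutting an expansion of \<open>D(a)\<close> with the idempotents at both
  ends of \<open>a\<close> leaves only paths parallel to \<open>a\<close>.\<close>

lemma arrow_value_expand:
  assumes D: "derivation D" and v: "\<And>v. v \<in> V \<Longrightarrow> D (vert v) \<in> I" and a: "a \<in> E"
  obtains S c where "finite S" "S \<subseteq> {q \<in> Q. fst q = src a \<and> hv q = tgt a}"
    "D (arr a) \<doteq> (\<Sum>q\<in>S. pscale (c q) (pelem q))"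
proof -
  have Da: "D (arr a) \<in> alg" using derivationD(1)[OF D] a by simp
  have e: "src a \<in> V" "tgt a \<in> V" using ends a by auto
  have s: "vert (src a) \<odot> arr a = (arr a :: _ \<Rightarrow> 'k)" and t: "arr a \<odot> vert (tgt a) = (arr a :: _ \<Rightarrow> 'k)"
    using a e by (simp_all add: mul_vert)
  have "D (arr a) \<doteq> D (vert (src a)) \<odot> arr a + vert (src a) \<odot> D (arr a)"
    using derivationD(4)[OF D, of "vert (src a)" "arr a"] a e s by simp
  also have "D (vert (src a)) \<odot> arr a + vert (src a) \<odot> D (arr a) \<doteq> 0 + vert (src a) \<odot> D (arr a)"
    using v[OF e(1)] a by (intro cong_add cong_refl) (simp add: ideal_closed)
  finally have 1: "D (arr a) \<doteq> vert (src a) \<odot> D (arr a)" by simp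
  have "D (arr a) \<doteq> D (arr a) \<odot> vert (tgt a) + arr a \<odot> D (vert (tgt a))"
    using derivationD(4)[OF D, of "arr a" "vert (tgt a)"] a e t by simp
  also have "D (arr a) \<odot> vert (tgt a) + arr a \<odot> D (vert (tgt a)) \<doteq> D (arr a) \<odot> vert (tgt a) + 0"
    using v[OF e(2)] a by (intro cong_add cong_refl) (simp add: ideal_closed)
  finally have 2: "D (arr a) \<doteq> D (arr a) \<odot> vert (tgt a)" by simp
  obtain S c where S: "finite S" "S \<subseteq> Q" and exp: "D (arr a) \<doteq> (\<Sum>q\<in>S. pscale (c q) (pelem q))"
    using Q_expand[OF Da] by blast
  let ?M = "\<Sum>q\<in>S. pscale (c q) (pelem q) :: _ \<Rightarrow> 'k"
  let ?S = "{q \<in> S. fst q = src a \<and> hv q = tgt a}"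
  have M: "?M \<in> alg" using S Q_path by (auto intro!: alg_sum alg_closed)
  have "D (arr a) \<doteq> vert (src a) \<odot> D (arr a) \<odot> vert (tgt a)"
    by (rule cong_trans[OF 2]) (use 1 Da e in \<open>auto intro!: cong_mul cong_refl\<close>)
  also have "vert (src a) \<odot> D (arr a) \<odot> vert (tgt a) \<doteq> vert (src a) \<odot> ?M \<odot> vert (tgt a)"
    using exp Da M e by (intro cong_mul cong_refl) auto
  also have "vert (src a) \<odot> ?M \<odot> vert (tgt a) = (\<Sum>q\<in>S. if fst q = src a \<and> hv q = tgt a then pscale (c q) (pelem q) else 0)"
    unfolding mul_sum
  proof (rule sum.cong)
    fix q assume "q \<in> S"
    then have "qpath q" using S Q_path by blast
    then show "vert (src a) \<odot> pscale (c q) (pelem q) \<odot> vert (tgt a)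
        = (if fst q = src a \<and> hv q = tgt a then pscale (c q) (pelem q) else 0)"
      using e by (simp add: mul_linear mul_vert pscale_simps)
  qed simp
  also have "\<dots> = (\<Sum>q\<in>?S. pscale (c q) (pelem q))"
    using S by (simp add: sum.inter_filter)
  finally show thesis using that[of ?S c] S by auto
qed

lemma basis_ops_span:
  fixes F :: "'f set" and sg :: "'f \<Rightarrow> 'a \<Rightarrow> int"
  assumes finF: "finite F"
    and span: "\<And>x::'a \<Rightarrow> 'k. \<exists>t l. \<forall>a\<in>E. x a = (\<Sum>f\<in>F. t f * of_int (sg f a)) + (l (src a) - l (tgt a))"
    and D: "derivation D"
  shows "\<exists>c. finite {j \<in> basis_index F. c j \<noteq> 0} \<and>
     inner_op V E src tgt I (\<lambda>x. psub (D x) (lincomb_ops (basis_index F) c (basis_op sg) x))"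
proof -
  obtain m where m: "m \<in> alg" and mv: "\<And>v. v \<in> V \<Longrightarrow> D (vert v) \<doteq> m \<odot> vert v - vert v \<odot> m"
    using inner_on_vertices[OF D] by blast
  define D1 where "D1 x = D x - (m \<odot> x - x \<odot> m)" for x
  have D1: "derivation D1" unfolding D1_def by (rule derivation_diff[OF D derivation_inner[OF m]])
  have D1v: "D1 (vert v) \<in> I" if "v \<in> V" for v using mv[OF that] by (simp add: D1_def)
  have "\<forall>a\<in>E. \<exists>S c. finite S \<and> S \<subseteq> {q \<in> Q. fst q = src a \<and> hv q = tgt a} \<and>
    D1 (arr a) \<doteq> (\<Sum>q\<in>S. pscale (c q) (pelem q))"
  proof
    fix a assume a: "a \<in> E"
    show "\<exists>S c. finite S \<and> S \<subseteq> {q \<in> Q. fst q = src a \<and> hv q = tgt a} \<and>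
      D1 (arr a) \<doteq> (\<Sum>q\<in>S. pscale (c q) (pelem q))"
      by (rule arrow_value_expand[OF D1 _ a]) (use D1v in blast)+
  qed
  from bchoice[OF this] obtain S where "\<forall>a\<in>E. \<exists>c. finite (S a) \<and>
    S a \<subseteq> {q \<in> Q. fst q = src a \<and> hv q = tgt a} \<and> D1 (arr a) \<doteq> (\<Sum>q\<in>S a. pscale (c q) (pelem q))" by blast
  from bchoice[OF this] obtain d where Sd: "\<And>a. a \<in> E \<Longrightarrow> finite (S a)" "\<And>a. a \<in> E \<Longrightarrow> S a \<subseteq> {q \<in> Q. fst q = src a \<and> hv q = tgt a}"
    "\<And>a. a \<in> E \<Longrightarrow> D1 (arr a) \<doteq> (\<Sum>q\<in>S a. pscale (d a q) (pelem q))"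
    by blast
  \<comment> \<open>The coefficient of \<open>a\<close> in \<open>D1(a)\<close>: the only part that
    the \<open>Inl\<close> operators cannot produce, left to faces and vertices.\<close>
  define x where "x a = (if arrow_path src a \<in> S a then d a (arrow_path src a) else 0)" for a
  obtain t l where tl: "\<And>a. a \<in> E \<Longrightarrow> x a = (\<Sum>f\<in>F. t f * of_int (sg f a)) + (l (src a) - l (tgt a))"
    using span[of x] by blast
  define c where "c = case_sum (\<lambda>(a, s). if a \<in> E \<and> s \<in> S a then d a s else 0) t"
  have fin: "finite {j \<in> basis_index F. c j \<noteq> 0}"
  proof (rule finite_subset)
    show "{j \<in> basis_index F. c j \<noteq> 0} \<subseteq> Inl ` (SIGMA a:E. S a) \<union> Inr ` F"
    proof
      fix j assume j: "j \<in> {j \<in> basis_index F. c j \<noteq> 0}"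
      show "j \<in> Inl ` (SIGMA a:E. S a) \<union> Inr ` F"
      proof (cases j)
        case (Inl rs)
        then show ?thesis using j by (auto simp: c_def split: if_splits prod.splits)
      next
        case (Inr f)
        then show ?thesis using j by (auto simp: basis_index_Inr)
      qed
    qed
    show "finite (Inl ` (SIGMA a:E. S a) \<union> Inr ` F)" using finE finF Sd(1) by simp
  qed
  let ?L = "lincomb_ops (basis_index F) c (basis_op sg)"
  \<comment> \<open>The commutator with this combination of vertices realises the coboundary of
    \<open>l\<close> on arrows and is zero on vertices.\<close>
  define M where "M = (\<Sum>q\<in>(\<lambda>v. (v, [] :: 'a list)) ` V. pscale (l (fst q)) (pelem q) :: _ \<Rightarrow> 'k)"
  have M: "M \<in> alg" unfolding M_def by (auto intro!: alg_sum alg_closed)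
  \<comment> \<open>The remainder after both corrections. It vanishes modulo \<open>I\<close> on the
    generators, hence everywhere, so \<open>D\<close> differs from the combination by the inner
    derivation of \<open>m + M\<close>.\<close>
  define D2 where "D2 x = D1 x - (M \<odot> x - x \<odot> M) - ?L x" for x
  have "derivation ?L"
    unfolding lincomb_ops_eq by (rule derivation_sum) (use basis_op_facts(1) in blast)
  then have D2: "derivation D2"
    unfolding D2_def by (intro derivation_diff D1 derivation_inner M)
  have D2x: "D2 y \<in> I" if y: "y \<in> alg" for y
  proof (rule derivation_zero[OF D2 _ _ y])
    fix v assume v: "v \<in> V"
    have "M \<odot> vert v - vert v \<odot> M = 0"
      unfolding M_def
    proof (subst commutator_vert)
      show "(\<lambda>v. (v, [])) ` V \<subseteq> Q" using vert_Q by blast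
    qed (use finV v in \<open>auto intro!: sum.neutral simp: pscale_simps\<close>)
    then show "D2 (vert v) \<in> I"
      unfolding D2_def using D1v[OF v] lincomb_vert[OF v, of F c sg] by (simp add: ideal_diff)
  next
    fix a assume a: "a \<in> E"
    have Ma: "M \<odot> arr a - arr a \<odot> M = pscale (l (src a) - l (tgt a)) (arr a)"
    proof -
      let ?V = "(\<lambda>v. (v, [] :: 'a list)) ` V"
      define k where "k v = (if (v, []) \<in> ?V then l (fst (v, [] :: 'a list)) else 0)" for v
      have "M \<odot> arr a - arr a \<odot> M = pscale (k (src a) - k (tgt a)) (arr a)"
        unfolding M_def by (rule vertex_commutator_arr[OF _ _ a k_def]) (use finV in auto)
      moreover have "k (src a) = l (src a)" "k (tgt a) = l (tgt a)" using ends[OF a] by (auto simp: k_def)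
      ultimately show ?thesis by simp
    qed
    let ?X = "\<Sum>f\<in>F. t f * of_int (sg f a)"
    let ?T = "support_at F c a"
    have La: "?L (arr a) \<doteq> (\<Sum>s\<in>?T. pscale (d a s) (pelem s)) + pscale ?X (arr a)"
    proof -
      have "(\<Sum>s\<in>?T. pscale (c (Inl (a, s))) (pelem s)) = (\<Sum>s\<in>?T. pscale (d a s) (pelem s) :: _ \<Rightarrow> 'k)"
        by (rule sum.cong) (auto simp: support_at_def c_def split: if_splits)
      then show ?thesis using lincomb_arr[OF fin finF a, of sg] by (simp add: c_def)
    qed
    have "(\<Sum>q\<in>S a. pscale (d a q) (pelem q)) = (\<Sum>s\<in>?T. pscale (d a s) (pelem s)) + pscale (x a) (arr a)"
    proof -
      have T: "?T \<subseteq> S a - {arrow_path src a}" 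
        by (auto simp: support_at_def c_def basis_index_Inl split: if_splits)
      have "(\<Sum>s\<in>?T. pscale (d a s) (pelem s)) = (\<Sum>s\<in>S a - {arrow_path src a}. pscale (d a s) (pelem s) :: _ \<Rightarrow> 'k)"
      proof (rule sum.mono_neutral_left[OF _ T])
        show "finite (S a - {arrow_path src a})" using Sd(1)[OF a] by simp
        show "\<forall>s\<in>S a - {arrow_path src a} - ?T. pscale (d a s) (pelem s) = (0 :: _ \<Rightarrow> 'k)"
        proof
          fix s assume s: "s \<in> S a - {arrow_path src a} - ?T"
          then have "Inl (a, s) \<in> basis_index F" using Sd(2)[OF a] a by (auto simp: basis_index_Inl)
          then have "d a s = 0" using s a by (auto simp: support_at_def c_def)
          then show "pscale (d a s) (pelem s) = (0 :: _ \<Rightarrow> 'k)" by (simp add: pscale_simps)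
        qed
      qed
      moreover have "(\<Sum>q\<in>S a. pscale (d a q) (pelem q)) = pscale (x a) (arr a) + (\<Sum>s\<in>S a - {arrow_path src a}. pscale (d a s) (pelem s) :: _ \<Rightarrow> 'k)"
        using Sd(1)[OF a] by (simp add: x_def sum.remove pscale_simps)
      ultimately show ?thesis by (simp add: add.commute)
    qed
    then have D1a: "D1 (arr a) \<doteq> (\<Sum>s\<in>?T. pscale (d a s) (pelem s)) + pscale (x a) (arr a)"
      using Sd(3)[OF a] by simp
    have "D2 (arr a) \<doteq> ((\<Sum>s\<in>?T. pscale (d a s) (pelem s)) + pscale (x a) (arr a))
        - pscale (l (src a) - l (tgt a)) (arr a) - ((\<Sum>s\<in>?T. pscale (d a s) (pelem s)) + pscale ?X (arr a))"
        (is "_ \<doteq> ?Z")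
      unfolding D2_def Ma by (intro cong_diff cong_refl D1a La)
    also have "?Z = 0" unfolding tl[OF a] pscale_simps(3) by simp
    finally show "D2 (arr a) \<in> I" by simp
  qed
  have "inner_op V E src tgt I (\<lambda>x. psub (D x) (?L x))"
    unfolding inner_op_def fun_op_eq
  proof (intro bexI[of _ "m + M"] ballI)
    fix x :: "('v,'a) qpath \<Rightarrow> 'k" assume "x \<in> alg"
    then have "D2 x \<in> I" by (rule D2x)
    then show "D x - ?L x \<doteq> (m + M) \<odot> x - x \<odot> (m + M)"
      unfolding D2_def D1_def by (simp add: mul_linear algebra_simps)
  qed (use m M in auto)
  then show ?thesis using fin by blast
qed

text \<open>Together the last two hypotheses say that the sign vectors form a basis of the functions
  on arrows modulo coboundaries.\<close>

theorem H1_basis_signs: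
  fixes F :: "'f set" and sg :: "'f \<Rightarrow> 'a \<Rightarrow> int"
  assumes "finite F"
    and "\<And>(t::'f \<Rightarrow> 'k) l f. (\<And>a. a \<in> E \<Longrightarrow> (\<Sum>f\<in>F. t f * of_int (sg f a)) = l (src a) - l (tgt a)) \<Longrightarrow> f \<in> F \<Longrightarrow> t f = 0"
    and "\<And>x::'a \<Rightarrow> 'k. \<exists>t l. \<forall>a\<in>E. x a = (\<Sum>f\<in>F. t f * of_int (sg f a)) + (l (src a) - l (tgt a))"
  shows "H1_basis V E src tgt I (basis_index F) (basis_op sg)"
  unfolding H1_basis_def
proof (intro conjI ballI allI impI)
  fix j assume "j \<in> basis_index F"
  then show "derivation (basis_op sg j)" by (rule basis_op_facts)
next
  fix c :: "'a \<times> ('v,'a) qpath + 'f \<Rightarrow> 'k" and j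
  assume "finite {j \<in> basis_index F. c j \<noteq> 0}"
    and "inner_op V E src tgt I (lincomb_ops (basis_index F) c (basis_op sg))"
    and "j \<in> basis_index F"
  then show "c j = 0" by (rule basis_ops_independent[of F sg, rotated 2]) (fact assms)+
next
  fix D assume "derivation D"
  then show "\<exists>c. finite {j \<in> basis_index F. c j \<noteq> 0} \<and>
     inner_op V E src tgt I (\<lambda>x. psub (D x) (lincomb_ops (basis_index F) c (basis_op sg) x))"
    by (rule basis_ops_span[of F sg, rotated 2]) (fact assms)+
qed

end

theorem theorem3p7:
  fixes V :: "'v set" and E :: "'a set" and src tgt :: "'a \<Rightarrow> 'v"
    and pos :: "'v \<Rightarrow> complex" and \<gamma> :: "'a \<Rightarrow> real \<Rightarrow> complex"
    and I :: "(('v,'a) qpath \<Rightarrow> 'k::field_char_0) set"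
    and Q :: "('v,'a) qpath set"
  assumes "finite V" and "finite E"
    and "\<forall>a\<in>E. src a \<in> V \<and> tgt a \<in> V"
    and "quiver_connected V E src tgt"
    and "planar_embedding V E src tgt pos \<gamma>"
    and "is_ideal V E src tgt I"
    and "in_R2 I"
    and "path_class_basis V E src tgt I Q"
    and "acyclic_quot V tgt I Q"
  shows "H1_basis V E src tgt I
     ({Inl (r, s) | r s. r \<in> E \<and> s \<in> Q \<and> path_t s = src r \<and> path_h tgt s = tgt r \<and>
                        psub (pelem s) (pelem (arrow_path src r)) \<notin> I}
      \<union> Inr ` bounded_faces V E pos \<gamma>)
     (case_sum (\<lambda>(r, s). Drs V E src tgt I r s) (\<lambda>f. Dface V E src tgt pos \<gamma> I f))"
proof -
  interpret pq: path_quotient V E src tgt I Q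
    by unfold_locales (use assms in auto)
  \<comment> \<open>Absence of loops comes from the quotient.\<close>
  interpret pl: plane_quiver V E src tgt pos \<gamma>
    by unfold_locales (use assms pq.no_loops in auto)
  have "finite pl.faces \<and>
    (\<forall>(t::complex set \<Rightarrow> 'k) l. (\<forall>a\<in>E. (\<Sum>f\<in>pl.faces. t f * of_int (pl.fsign f a)) = l (src a) - l (tgt a)) \<longrightarrow>
      (\<forall>f\<in>pl.faces. t f = 0)) \<and>
    (\<forall>x::'a \<Rightarrow> 'k. \<exists>t l. \<forall>a\<in>E. x a = (\<Sum>f\<in>pl.faces. t f * of_int (pl.fsign f a)) + (l (src a) - l (tgt a)))"
  \<comment> \<open>The construction by leaves and chords starts from a vertex. For the empty quiver
    the whole plane is the only component, so there is no bounded face.\<close>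
  proof (cases "V = {}")
    case True
    then have E: "E = {}" using assms(3) by auto
    have "components (UNIV :: complex set) = {UNIV}"
      by (simp add: components_eq_sing_iff)
    moreover have "graph_image V E pos \<gamma> = {}" using True E by (simp add: graph_image_def)
    ultimately have "pl.faces = {}"
      unfolding pl.faces_def bounded_faces_def using not_bounded_UNIV by auto
    then show ?thesis using E by simp
  next
    case False
    then have ww: "pl.well_wound V E" using pl.well_wound_built pl.built_all assms(4) by blast
    show ?thesis
    proof (intro conjI allI impI ballI)
      show "finite pl.faces" by (rule pl.finite_faces[OF ww])
    next
      fix t :: "complex set \<Rightarrow> 'k" and l f
      assume "\<forall>a\<in>E. (\<Sum>f\<in>pl.faces. t f * of_int (pl.fsign f a)) = l (src a) - l (tgt a)" "f \<in> pl.faces"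
      then show "t f = 0" using pl.face_coboundary_independent[OF ww, of f t l] by blast
    next
      fix x :: "'a \<Rightarrow> 'k"
      show "\<exists>t l. \<forall>a\<in>E. x a = (\<Sum>f\<in>pl.faces. t f * of_int (pl.fsign f a)) + (l (src a) - l (tgt a))"
        by (rule pl.face_coboundary_span[OF ww])
    qed
  qed
  then have "H1_basis V E src tgt I (pq.basis_index pl.faces) (pq.basis_op pl.fsign)"
    by (intro pq.H1_basis_signs) blast+
  then show ?thesis
    unfolding pq.basis_index_def pq.basis_op_def pq.sign_op_def pl.faces_def pl.fsign_def Dface_def .
qed

end
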